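(* Let $Y\in 2^\omega$ be Solovay-$\Sigma^1_1$-generic. Then $\omega_1^Y=\omega_1^{\mathrm{CK}}$.
   Context: Work in Cantor space $2^\omega$ with the uniform (Lebesgue) measure $\lambda$. A $\Sigma^1_1$ closed set is a closed subset of $2^\omega$ which is $\Sigma^1_1$ (lightface) as a set of reals. A sequence $(F_n)_{n\in\omega}$ of subsets of $2^\omega$ is uniformly $\Sigma^1_1$ if $\{(n,X): X\in F_n\}$ is $\Sigma^1_1$. A real $X$ is Solovay-$\Sigma^1_1$-generic if for every uniformly $\Sigma^1_1$ sequence $(F_n)_{n\in\omega}$ of closed sets each of positive measure, either $X\in F_n$ for some $n$, or there is a $\Sigma^1_1$ closed set $G$ of positive measure with $G\cap\bigcup_n F_n=\emptyset$ and $X\in G$. $\omega_1^Y$ denotes the least ordinal not computable in $Y$, and $\omega_1^{\mathrm{CK}}$ the least non-computable ordinal. *)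

theory Defs
  imports "HOL-Probability.Probability"
begin

section \<open>Oracle computability\<close>

text \<open>
  Kleene's mu-recursive schemes with an additional scheme querying an oracle
  \<open>f :: nat \<Rightarrow> nat\<close>. A program denotes, for each oracle and each arity, a partial function;
  \<open>None\<close> means undefined (divergence or ill-formed arity). \<open>Mu g\<close> is unbounded search:
  \<open>g\<close> has to converge to a nonzero value at all arguments below the result.
\<close>

datatype prog =
    Zero
  | Succ
  | Query
  | Proj nat
  | Comp prog "prog list"
  | PrimRec prog prog
  | Mu prog

fun run :: "prog \<Rightarrow> (nat \<Rightarrow> nat) \<Rightarrow> nat list \<Rightarrow> nat option" where
  "run Zero f xs = Some 0"
| "run Succ f xs = (case xs of [x] \<Rightarrow> Some (Suc x) | _ \<Rightarrow> None)"
| "run Query f xs = (case xs of [x] \<Rightarrow> Some (f x) | _ \<Rightarrow> None)"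
| "run (Proj i) f xs = (if i < length xs then Some (xs ! i) else None)"
| "run (Comp g hs) f xs =
     (let ys = map (\<lambda>h. run h f xs) hs
      in if None \<in> set ys then None else run g f (map the ys))"
| "run (PrimRec g h) f xs =
     (case xs of
        [] \<Rightarrow> None
      | n # zs \<Rightarrow>
          rec_nat (run g f zs)
            (\<lambda>i prev. case prev of None \<Rightarrow> None | Some v \<Rightarrow> run h f (i # v # zs)) n)"
| "run (Mu g) f xs =
     (if \<exists>z. run g f (z # xs) = Some 0 \<and> (\<forall>y<z. run g f (y # xs) \<noteq> None)
      then Some (LEAST z. run g f (z # xs) = Some 0) else None)"

type_synonym cantor = "nat \<Rightarrow> bool"

definition char_fun :: "cantor \<Rightarrow> nat \<Rightarrow> nat" where
  "char_fun X n = (if X n then 1 else 0)"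

definition join :: "(nat \<Rightarrow> nat) \<Rightarrow> (nat \<Rightarrow> nat) \<Rightarrow> nat \<Rightarrow> nat" where
  "join f g n = (if even n then f (n div 2) else g (n div 2))"

text \<open>
  A recursive relation with \<open>k\<close> number arguments and one argument in Baire space: a single
  program, halting on every oracle and every \<open>k\<close>-tuple, computes its characteristic function.
\<close>

definition recursive_rel :: "nat \<Rightarrow> (nat list \<Rightarrow> (nat \<Rightarrow> nat) \<Rightarrow> bool) \<Rightarrow> bool" where
  "recursive_rel k R \<longleftrightarrow>
     (\<exists>p. \<forall>ns f. length ns = k \<longrightarrow> run p f ns = Some (if R ns f then 1 else 0))"


section \<open>Lightface \<open>\<Sigma>\<^sup>1\<^sub>1\<close> sets\<close>

text \<open>
  \<open>A \<subseteq> \<omega>\<^sup>k \<times> 2\<^sup>\<omega>\<close> is \<open>\<Sigma>\<^sup>1\<^sub>1\<close> if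
  \<open>A(ns, X) \<longleftrightarrow> (\<exists>Z \<in> \<omega>\<^sup>\<omega>. \<forall>m. R(m, ns, X, Z))\<close> for some recursive \<open>R\<close>; the two function
  arguments are presented to \<open>R\<close> as the join of \<open>X\<close> and \<open>Z\<close>. There are no real parameters.
\<close>

definition Sigma11 :: "nat \<Rightarrow> (nat list \<Rightarrow> cantor \<Rightarrow> bool) \<Rightarrow> bool" where
  "Sigma11 k A \<longleftrightarrow>
     (\<exists>R. recursive_rel (Suc k) R \<and>
          (\<forall>ns X. length ns = k \<longrightarrow>
             (A ns X \<longleftrightarrow> (\<exists>Z. \<forall>m. R (m # ns) (join (char_fun X) Z)))))"

definition Sigma11_set :: "cantor set \<Rightarrow> bool" where
  "Sigma11_set G \<longleftrightarrow> Sigma11 0 (\<lambda>_ X. X \<in> G)"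

definition uniformly_Sigma11 :: "(nat \<Rightarrow> cantor set) \<Rightarrow> bool" where
  "uniformly_Sigma11 F \<longleftrightarrow> Sigma11 1 (\<lambda>ns X. X \<in> F (ns ! 0))"


section \<open>Solovay-\<open>\<Sigma>\<^sup>1\<^sub>1\<close>-genericity\<close>

text \<open>
  The topology on \<open>nat \<Rightarrow> bool\<close> is the product topology, which is the library's topology on
  function types; closed sets are therefore measurable for the product measure below.
\<close>

definition cantor_measure :: "cantor measure" where
  "cantor_measure = (\<Pi>\<^sub>M n\<in>UNIV. measure_pmf (bernoulli_pmf (1 / 2)))"

definition solovay_Sigma11_generic :: "cantor \<Rightarrow> bool" where
  "solovay_Sigma11_generic X \<longleftrightarrow>
     (\<forall>F :: nat \<Rightarrow> cantor set.
        uniformly_Sigma11 F \<and> (\<forall>n. closed (F n)) \<and> (\<forall>n. emeasure cantor_measure (F n) > 0)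
        \<longrightarrow> (\<exists>n. X \<in> F n) \<or>
            (\<exists>G. Sigma11_set G \<and> closed G \<and> emeasure cantor_measure G > 0 \<and>
                 G \<inter> (\<Union>n. F n) = {} \<and> X \<in> G))"

instance bool :: second_countable_topology
proof
  show "\<exists>B :: bool set set. countable B \<and> open = generate_topology B"
    by (intro exI[of _ UNIV] conjI ext iffI discrete_topology_class.open_discrete)
      (auto intro: generate_topology.Basis countable_finite)
qed

lemma sets_cantor_measure: "sets cantor_measure = sets borel"
proof -
  have "sets cantor_measure = sets (\<Pi>\<^sub>M n\<in>(UNIV :: nat set). (borel :: bool measure))"
    unfolding cantor_measure_def
    by (intro sets_PiM_cong) (auto simp: sets_borel_eq_count_space)
  then show ?thesis by (simp only: sets_PiM_equal_borel)
qed


section \<open>Countable ordinals and \<open>\<omega>\<^sub>1\<^sup>Y\<close>\<close>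

text \<open>
  The countable ordinals are the isomorphism types of well-orders whose field is a set of natural
  numbers. (Well-orders in the library are reflexive, so \<open>Field r = {n. (n, n) \<in> r}\<close>.)
\<close>

quotient_type cord = "nat rel" / partial: "\<lambda>r s :: nat rel. (r, s) \<in> ordIso"
proof (rule part_equivpI)
  show "\<exists>r :: nat rel. (r, r) \<in> ordIso"
    using card_of_Well_order ordIso_reflexive by blast
  show "symp (\<lambda>r s :: nat rel. (r, s) \<in> ordIso)"
    by (auto intro!: sympI ordIso_symmetric)
  show "transp (\<lambda>r s :: nat rel. (r, s) \<in> ordIso)"
    by (auto intro!: transpI intro: ordIso_transitive)
qed

instantiation cord :: wellorder
begin

lift_definition less_eq_cord :: "cord \<Rightarrow> cord \<Rightarrow> bool" is "\<lambda>r s. (r, s) \<in> ordLeq"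
  by (meson ordIso_ordLeq_trans ordIso_symmetric ordLeq_ordIso_trans)

lift_definition less_cord :: "cord \<Rightarrow> cord \<Rightarrow> bool" is "\<lambda>r s. (r, s) \<in> ordLess"
  by (meson ordIso_ordLess_trans ordIso_symmetric ordLess_ordIso_trans)

instance
proof
  fix x y z :: cord
  have wo: "Well_order r" if "(r, r) \<in> ordIso" for r :: "nat rel"
    using that unfolding ordIso_def by blast
  show "x < y \<longleftrightarrow> x \<le> y \<and> \<not> y \<le> x"
    by transfer (metis wo not_ordLess_iff_ordLeq ordLess_imp_ordLeq not_ordLess_ordLeq)
  show "x \<le> x"
    by transfer (simp add: ordIso_iff_ordLeq)
  show "x \<le> y \<Longrightarrow> y \<le> z \<Longrightarrow> x \<le> z"
    by transfer (rule ordLeq_transitive)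
  show "x \<le> y \<Longrightarrow> y \<le> x \<Longrightarrow> x = y"
    by transfer (simp add: ordIso_iff_ordLeq)
  show "x \<le> y \<or> y \<le> x"
    by transfer (meson wo ordLeq_total)
next
  fix P :: "cord \<Rightarrow> bool" and a :: cord
  assume step: "\<And>x. (\<And>y. y < x \<Longrightarrow> P y) \<Longrightarrow> P x"
  have "wf {(x :: cord, y). x < y}"
  proof (rule wf_subset)
    show "wf (inv_image ordLess rep_cord)"
      by (rule wf_inv_image[OF wf_ordLess])
    show "{(x :: cord, y). x < y} \<subseteq> inv_image ordLess rep_cord"
      by (auto simp: less_cord.rep_eq)
  qed
  then show "P a"
    by (induction a rule: wf_induct_rule) (use step in blast)
qed

end

definition otype :: "nat rel \<Rightarrow> cord" where
  "otype r = abs_cord r"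

lemma otype_eq_iff: "Well_order r \<Longrightarrow> Well_order s \<Longrightarrow> otype r = otype s \<longleftrightarrow> (r, s) \<in> ordIso"
  unfolding otype_def using Quotient_rel[OF Quotient_cord] ordIso_reflexive by metis

definition computable_ordinal :: "cantor \<Rightarrow> cord \<Rightarrow> bool" where
  "computable_ordinal Y \<alpha> \<longleftrightarrow>
     (\<exists>r. Well_order r \<and> otype r = \<alpha> \<and>
          (\<exists>p. \<forall>m n. run p (char_fun Y) [m, n] = Some (if (m, n) \<in> r then 1 else 0)))"

text \<open>
  The least ordinal not computable in \<open>Y\<close>. There are countable ordinals not computable in \<open>Y\<close>
  (lemma \<open>ex_not_computable_ordinal\<close> below), so ranging over countable ordinals only does not
  affect the minimum.
\<close>

definition omega1 :: "cantor \<Rightarrow> cord" where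
  "omega1 Y = (LEAST \<alpha>. \<not> computable_ordinal Y \<alpha>)"

text \<open>
  Computability without an oracle is computability in the empty set, whose characteristic
  function, the constant \<open>0\<close>, is itself computed by the program \<open>Zero\<close>.
\<close>

definition omega1_CK :: cord where
  "omega1_CK = omega1 (\<lambda>_. False)"

instance prog :: countable
  by countable_datatype

lemma uncountable_cord:
  includes cardinal_syntax
  shows "uncountable (UNIV :: cord set)"
proof
  assume cnt: "countable (UNIV :: cord set)"
  have cle: "countable A \<longleftrightarrow> |A| \<le>o natLeq" for A :: "'x set"
  proof -
    have "countable A \<longleftrightarrow> |A| \<le>o |UNIV :: nat set|"
      unfolding countable_def card_of_ordLeq[symmetric] by simp
    then show ?thesis using card_of_nat ordLeq_ordIso_trans ordIso_symmetric by blast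
  qed
  define w where "w = cardSuc natLeq"
  have cw: "Card_order w" unfolding w_def by (rule cardSuc_Card_order[OF natLeq_Card_order])
  then have ww: "Well_order w" by (rule card_order_on_well_order_on)
  have ex: "\<exists>r :: nat rel. (r, Restr w (underS w x)) \<in> ordIso" if "x \<in> Field w" for x
  proof -
    have "|underS w x| <o w" using card_of_underS[OF cw that] .
    then have "|underS w x| \<le>o natLeq"
      unfolding w_def using cardSuc_ordLeq_ordLess[OF natLeq_Card_order card_of_Card_order] by blast
    then have "countable (underS w x)" using cle by blast
    then obtain h :: "_ \<Rightarrow> nat" where h: "inj_on h (underS w x)" unfolding countable_def by blast
    let ?s = "Restr w (underS w x)"
    have "inj_on h (Field ?s)" using h by (rule inj_on_subset) (auto simp: Field_def)
    then have "(?s, dir_image ?s h) \<in> ordIso"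
      using Well_order_Restr[OF ww] by (intro dir_image_ordIso) auto
    then show ?thesis using ordIso_symmetric by blast
  qed
  then obtain g where g: "\<And>x. x \<in> Field w \<Longrightarrow> ((g x :: nat rel), Restr w (underS w x)) \<in> ordIso"
    by metis
  have wo: "Well_order (g x)" if "x \<in> Field w" for x
    using g[OF that] unfolding ordIso_def by blast
  have lt: "g x <o g y" if xy: "x \<in> Field w" "y \<in> Field w" "(x, y) \<in> w" "x \<noteq> y" for x y
  proof -
    have ofx: "ofilter w (underS w x)" and ofy: "ofilter w (underS w y)"
      using ww by (simp_all add: wo_rel_def wo_rel.underS_ofilter)
    have "underS w x \<subset> underS w y"
    proof -
      have lo: "Linear_order w" using ww by (simp add: well_order_on_def)
      then have "(y, x) \<notin> w"
        using xy by (auto simp: order_on_defs dest: antisymD)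
      then show ?thesis
        using underS_incl_iff[OF lo xy(1,2)] underS_incl_iff[OF lo xy(2,1)] xy(3) by blast
    qed
    then have "Restr w (underS w x) <o Restr w (underS w y)"
      using ofilter_subset_ordLess[OF ww ofx ofy] by blast
    then show ?thesis
      using g[OF xy(1)] g[OF xy(2)] ordIso_ordLess_trans ordLess_ordIso_trans ordIso_symmetric
      by metis
  qed
  have "inj_on (\<lambda>x. otype (g x)) (Field w)"
  proof (rule inj_onI, rule ccontr)
    fix x y assume xy: "x \<in> Field w" "y \<in> Field w" "otype (g x) = otype (g y)" "x \<noteq> y"
    have "(x, y) \<in> w \<or> (y, x) \<in> w"
      using ww xy wo_rel.TOTALS[of w] unfolding wo_rel_def by blast
    then have "g x <o g y \<or> g y <o g x" using lt xy by metis
    moreover have "(g x, g y) \<in> ordIso" using xy wo otype_eq_iff by blast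
    ultimately show False using not_ordLess_ordIso ordIso_symmetric by blast
  qed
  then have "countable (Field w)"
    using cnt by (metis countable_image_inj_on countable_subset subset_UNIV)
  then have "|Field w| \<le>o natLeq" using cle by blast
  moreover have "natLeq <o |Field w|"
    using cardSuc_greater[OF natLeq_Card_order] card_of_Field_ordIso[OF cw] ordIso_symmetric
      ordLess_ordIso_trans unfolding w_def by blast
  ultimately show False using not_ordLess_ordLeq by blast
qed

lemma ex_not_computable_ordinal: "\<exists>\<alpha>. \<not> computable_ordinal Y \<alpha>"
proof (rule ccontr)
  assume "\<not> ?thesis"
  then have all: "computable_ordinal Y \<alpha>" for \<alpha> by blast
  define h where "h p = otype {(m, n). run p (char_fun Y) [m, n] = Some 1}" for p
  have "\<alpha> \<in> range h" for \<alpha>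
  proof -
    obtain r p where rp: "otype r = \<alpha>"
      "\<And>m n. run p (char_fun Y) [m, n] = Some (if (m, n) \<in> r then 1 else 0)"
      using all[of \<alpha>] unfolding computable_ordinal_def by blast
    have "{(m, n). run p (char_fun Y) [m, n] = Some 1} = r" by (auto simp: rp(2) split: if_splits)
    then show ?thesis using rp(1) unfolding h_def by blast
  qed
  then have "countable (UNIV :: cord set)"
    by (metis countable_image countableI_type countable_subset subsetI)
  then show False using uncountable_cord by blast
qed

end

theory Submission
  imports Defs "HOL-Library.Nat_Bijection"
begin

text \<open>
  Suppose that \<open>Y\<close> is generic and computes a well-order of type \<open>\<omega>\<^sub>1\<^sup>C\<^sup>K\<close> by a program \<open>q\<close>.

  Call a set \<open>A\<close> big at \<open>Y\<close> if its relative measure in the cylinders around \<open>Y\<close> is bounded away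
  from \<open>0\<close>, and small at \<open>Y\<close> if a closed \<open>\<Sigma>\<^sup>1\<^sub>1\<close> set containing \<open>Y\<close> meets it in a null set. The
  set of the points with a fixed lower bound for the density is closed and, for \<open>\<Sigma>\<^sup>1\<^sub>1\<close> sets, again
  \<open>\<Sigma>\<^sup>1\<^sub>1\<close>; hence genericity says that of the members of a uniform \<open>\<Sigma>\<^sup>1\<^sub>1\<close> sequence one is big or
  the union is small. The two cases exclude each other because a generic real lies in no null
  closed \<open>\<Sigma>\<^sup>1\<^sub>1\<close> set: by number uniformization of co-analytic relations, the complement of such a
  set contains a uniform \<open>\<Sigma>\<^sup>1\<^sub>1\<close> sequence of clopen sets of measure tending to \<open>1\<close>.

  By induction along the well-order of \<open>Y\<close>, the sets \<open>ill n\<close> of the reals \<open>X\<close> for which \<open>q\<close>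
  computes an order ill-founded below \<open>n\<close> are not big at \<open>Y\<close>. So there is a closed
  \<open>\<Sigma>\<^sup>1\<^sub>1\<close> set \<open>G\<close> containing \<open>Y\<close> which meets each \<open>ill n\<close> in a null set. Then, for computable trees \<open>T\<close>,
  well-foundedness becomes \<open>\<Sigma>\<^sup>1\<^sub>1\<close>: \<open>T\<close> is well-founded if and only if for some \<open>n\<close> there are
  positively many \<open>X \<in> G\<close> for which the rank of \<open>T\<close> is at most that of \<open>n\<close> in the order computed
  by \<open>q\<close> from \<open>X\<close>. A tree of attempts at verifying this statement about the tree itself gives the
  contradiction.
\<close>

section \<open>Total computable functionals\<close>

text \<open>Genericity speaks of closed sets, while \<open>ill n\<close> and the sets given by rank
  comparison are merely analytic. Passing to a density core loses outer measure at most
  \<open>\<delta>\<close>, so a set all of whose cores are null is null; this makes the dichotomy of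
  big and small exhaustive. As these sets are not visibly Borel, sizes are outer measures. Having
  measure above a given fraction is again an analytic condition by compactness: an inner
  approximation bounds the witness function by some \<open>H\<close>, and for bounded witnesses
  Koenig's lemma reduces the question to counting strings at every finite level.

  The failure of \<open>Sim\<close> is co-analytic and cannot enter an analytic sequence. The
  analytic relation \<open>Opp\<close> covers it; \<open>Opp\<close> may overlap with
  \<open>Sim\<close>, but it is small at \<open>Y\<close> whenever \<open>Sim\<close> holds for
  \<open>Y\<close> with a well-founded element on the left.

  The final tree has a path iff its Kleene-Brouwer order is simulated for positively many
  \<open>X \<in> G\<close>. A path would make these \<open>X\<close> ill-founded. Without a path the
  order is a computable well-order, \<open>Y\<close> simulates it, and smallness of
  \<open>Opp\<close> passes this on to positively many \<open>X \<in> G\<close>.\<close>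

definition crec :: "nat \<Rightarrow> (nat list \<Rightarrow> (nat \<Rightarrow> nat) \<Rightarrow> nat) \<Rightarrow> bool" where
  "crec k F \<longleftrightarrow> (\<exists>p. \<forall>xs f. length xs = k \<longrightarrow> run p f xs = Some (F xs f))"

definition cdec :: "nat \<Rightarrow> (nat list \<Rightarrow> (nat \<Rightarrow> nat) \<Rightarrow> bool) \<Rightarrow> bool" where
  "cdec k P \<longleftrightarrow> crec k (\<lambda>xs f. if P xs f then 1 else 0)"

text \<open>Argument lists of a fixed length, given componentwise, so that the list for a
  composition can be assembled by \<open>#\<close> and \<open>tl\<close>.\<close>

definition crecl :: "nat \<Rightarrow> (nat list \<Rightarrow> (nat \<Rightarrow> nat) \<Rightarrow> nat list) \<Rightarrow> bool" where
  "crecl k L \<longleftrightarrow>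
     (\<exists>As. (\<forall>A\<in>set As. crec k A) \<and> (\<forall>xs f. length xs = k \<longrightarrow> L xs f = map (\<lambda>A. A xs f) As))"

named_theorems crec_intros

lemma crec_cong: "(\<And>xs f. length xs = k \<Longrightarrow> F xs f = G xs f) \<Longrightarrow> crec k F = crec k G"
  unfolding crec_def by (metis (no_types, lifting))

lemma cdec_cong: "(\<And>xs f. length xs = k \<Longrightarrow> P xs f = Q xs f) \<Longrightarrow> cdec k P = cdec k Q"
  unfolding cdec_def by (rule crec_cong) simp

lemma crec_if_cdec: "cdec k P \<Longrightarrow> crec k (\<lambda>xs f. if P xs f then 1 else 0)"
  by (simp add: cdec_def)

lemma recursive_rel_iff_cdec: "recursive_rel k R \<longleftrightarrow> cdec k R"
  by (simp add: recursive_rel_def cdec_def crec_def)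

lemma crecl_nil [crec_intros]: "crecl k (\<lambda>xs f. [])"
  unfolding crecl_def by (rule exI[of _ "[]"]) simp

lemma crecl_cons [crec_intros]:
  assumes "crec k A" "crecl k L" shows "crecl k (\<lambda>xs f. A xs f # L xs f)"
proof -
  obtain As where "\<forall>A\<in>set As. crec k A" "\<forall>xs f. length xs = k \<longrightarrow> L xs f = map (\<lambda>A. A xs f) As"
    using assms(2) unfolding crecl_def by blast
  then show ?thesis unfolding crecl_def using assms(1) by (intro exI[of _ "A # As"]) auto
qed

lemma crec_app:
  assumes F: "crec n F" and L: "crecl k L"
    and len: "\<And>xs f. length xs = k \<Longrightarrow> length (L xs f) = n"
  shows "crec k (\<lambda>xs f. F (L xs f) f)"
proof -
  obtain p where p: "\<And>xs f. length xs = n \<Longrightarrow> run p f xs = Some (F xs f)"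
    using F unfolding crec_def by blast
  obtain As where As: "\<forall>A\<in>set As. crec k A"
      "\<And>xs f. length xs = k \<Longrightarrow> L xs f = map (\<lambda>A. A xs f) As"
    using L unfolding crecl_def by blast
  obtain q where q: "\<And>A xs f. A \<in> set As \<Longrightarrow> length xs = k \<Longrightarrow> run (q A) f xs = Some (A xs f)"
    using As(1) unfolding crec_def by metis
  have "run (Comp p (map q As)) f xs = Some (F (L xs f) f)" if "length xs = k" for xs f
  proof -
    have eq: "map (\<lambda>h. run h f xs) (map q As) = map Some (L xs f)"
      using q that As(2)[OF that] by simp
    show ?thesis unfolding run.simps Let_def eq using p len[OF that] by (auto simp: comp_def)
  qed
  then show ?thesis unfolding crec_def by blast
qed

lemma cdec_app:
  assumes "cdec n P" "crecl k L" "\<And>xs f. length xs = k \<Longrightarrow> length (L xs f) = n"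
  shows "cdec k (\<lambda>xs f. P (L xs f) f)"
  using crec_app[OF assms(1)[unfolded cdec_def] assms(2,3)] unfolding cdec_def .

lemma crec_Suc [crec_intros]:
  assumes "crec k A" shows "crec k (\<lambda>xs f. Suc (A xs f))"
proof -
  have "crec 1 (\<lambda>xs f. Suc (xs ! 0))"
    unfolding crec_def by (rule exI[of _ Succ]) (auto simp: length_Suc_conv)
  from crec_app[OF this, of k "\<lambda>xs f. [A xs f]"] assms show ?thesis
    by (simp add: crecl_cons crecl_nil)
qed

lemma crec_query [crec_intros]:
  assumes "crec k A" shows "crec k (\<lambda>xs f. f (A xs f))"
proof -
  have "crec 1 (\<lambda>xs f. f (xs ! 0))"
    unfolding crec_def by (rule exI[of _ Query]) (auto simp: length_Suc_conv)
  from crec_app[OF this, of k "\<lambda>xs f. [A xs f]"] assms show ?thesis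
    by (simp add: crecl_cons crecl_nil)
qed

lemma crec_const [crec_intros]: "crec k (\<lambda>xs f. c)"
proof (induction c)
  case 0
  show ?case unfolding crec_def by (rule exI[of _ Zero]) simp
qed (rule crec_Suc)

lemma crec_nth: "i < k \<Longrightarrow> crec k (\<lambda>xs f. xs ! i)"
  unfolding crec_def by (rule exI[of _ "Proj i"]) simp

lemma nth_funpow_tl: "i + j < length xs \<Longrightarrow> (tl ^^ j) xs ! i = xs ! (i + j)"
  by (induction j arbitrary: i xs) (auto simp: funpow_swap1 nth_tl)

lemma length_funpow_tl [simp]: "length ((tl ^^ j) xs) = length xs - j"
  by (induction j) auto

text \<open>Rules with a bound variable prepend its value to the arguments, so under nested binders
  an outer argument shows up as an entry of an iterated tail.\<close>

lemma crec_nth_tl: "i + j < k \<Longrightarrow> crec k (\<lambda>xs f. (tl ^^ j) xs ! i)"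
  using crec_nth[of "i + j" k] by (subst crec_cong) (auto simp: nth_funpow_tl)

lemmas crec_nths [crec_intros] =
  crec_nth_tl[where j = 0, simplified]
  crec_nth_tl[where j = "Suc 0", simplified]
  crec_nth_tl[where j = "Suc (Suc 0)", simplified]
  crec_nth_tl[where j = "Suc (Suc (Suc 0))", simplified]
  crec_nth_tl[where j = "Suc (Suc (Suc (Suc 0)))", simplified]
  crec_nth_tl[where j = "Suc (Suc (Suc (Suc (Suc 0))))", simplified]
  crec_nth_tl[where j = "Suc (Suc (Suc (Suc (Suc (Suc 0)))))", simplified]
  crec_nth_tl[where j = "Suc (Suc (Suc (Suc (Suc (Suc (Suc 0))))))", simplified]

lemma crecl_funpow_tl: "j \<le> k \<Longrightarrow> crecl k (\<lambda>xs f. (tl ^^ j) xs)"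
  unfolding crecl_def
proof (intro exI[of _ "map (\<lambda>i xs f. xs ! (i + j)) [0..<k - j]"] conjI allI impI ballI)
  fix xs :: "nat list" assume "j \<le> k" "length xs = k"
  then show "(tl ^^ j) xs = map (\<lambda>A. A xs f) (map (\<lambda>i xs f. xs ! (i + j)) [0..<k - j])" for f :: "nat \<Rightarrow> nat"
    by (intro nth_equalityI) (auto simp: nth_funpow_tl)
qed (auto intro: crec_nth)

lemmas crecl_tls [crec_intros] =
  crecl_funpow_tl[where j = 0, simplified]
  crecl_funpow_tl[where j = "Suc 0", simplified]
  crecl_funpow_tl[where j = "Suc (Suc 0)", simplified]
  crecl_funpow_tl[where j = "Suc (Suc (Suc 0))", simplified]
  crecl_funpow_tl[where j = "Suc (Suc (Suc (Suc 0)))", simplified]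
  crecl_funpow_tl[where j = "Suc (Suc (Suc (Suc (Suc 0))))", simplified]
  crecl_funpow_tl[where j = "Suc (Suc (Suc (Suc (Suc (Suc 0)))))", simplified]

lemma crec_weaken:
  assumes "crec n A" "j + n = k" shows "crec k (\<lambda>xs f. A ((tl ^^ j) xs) f)"
  by (rule crec_app[OF assms(1) crecl_funpow_tl]) (use assms(2) in auto)

lemma crecl_weaken:
  assumes "crecl n L" "j + n = k" shows "crecl k (\<lambda>xs f. L ((tl ^^ j) xs) f)"
proof -
  obtain As where "\<forall>A\<in>set As. crec n A"
      "\<And>xs f. length xs = n \<Longrightarrow> L xs f = map (\<lambda>A. A xs f) As"
    using assms(1) unfolding crecl_def by blast
  then show ?thesis unfolding crecl_def using assms(2)
    by (intro exI[of _ "map (\<lambda>A xs f. A ((tl ^^ j) xs) f) As"]) (auto intro!: crec_weaken)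
qed

lemma crec_rec [crec_intros]:
  assumes G: "crec k G" and H: "crec (Suc (Suc k)) (\<lambda>xs f. H (xs ! 0) (xs ! 1) (tl (tl xs)) f)"
    and N: "crec k N"
  shows "crec k (\<lambda>xs f. rec_nat (G xs f) (\<lambda>i v. H i v xs f) (N xs f))"
proof -
  obtain g where g: "\<And>xs f. length xs = k \<Longrightarrow> run g f xs = Some (G xs f)"
    using G unfolding crec_def by blast
  obtain h where h: "\<And>xs f. length xs = Suc (Suc k) \<Longrightarrow>
      run h f xs = Some (H (xs ! 0) (xs ! 1) (tl (tl xs)) f)"
    using H unfolding crec_def by blast
  have "run (PrimRec g h) f (n # xs) = Some (rec_nat (G xs f) (\<lambda>i v. H i v xs f) n)"
    if "length xs = k" for n xs f
    using that by (induction n) (auto simp: g h)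
  then have "\<forall>xs f. length xs = Suc k \<longrightarrow> run (PrimRec g h) f xs =
      Some (rec_nat (G (tl xs) f) (\<lambda>i v. H i v (tl xs) f) (xs ! 0))"
    by (auto simp: length_Suc_conv)
  then have "crec (Suc k) (\<lambda>xs f. rec_nat (G (tl xs) f) (\<lambda>i v. H i v (tl xs) f) (xs ! 0))"
    unfolding crec_def by blast
  from crec_app[OF this crecl_cons[OF N crecl_funpow_tl[of 0]]] show ?thesis by simp
qed

section \<open>Arithmetic, Boolean connectives and bounded quantifiers\<close>

lemma crec_add [crec_intros]:
  assumes "crec k A" "crec k B" shows "crec k (\<lambda>xs f. A xs f + B xs f)"
proof -
  have "a + b = rec_nat a (\<lambda>i v. Suc v) b" for a b :: nat by (induction b) auto
  then show ?thesis by (simp only:) (intro crec_intros assms; simp)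
qed

lemma crec_mult [crec_intros]:
  assumes "crec k A" "crec k B" shows "crec k (\<lambda>xs f. A xs f * B xs f)"
proof -
  have "a * b = rec_nat 0 (\<lambda>i v. v + a) b" for a b :: nat by (induction b) auto
  then have eq: "(\<lambda>xs f. A xs f * B xs f) = (\<lambda>xs f. rec_nat 0 (\<lambda>i v. v + A xs f) (B xs f))" by simp
  show ?thesis unfolding eq
    by (rule crec_rec[OF crec_const _ assms(2)])
      (use crec_weaken[OF assms(1), of 2 "Suc (Suc k)"] in \<open>auto intro!: crec_intros simp: numeral_2_eq_2\<close>)
qed

lemma crec_power [crec_intros]:
  assumes "crec k A" "crec k B" shows "crec k (\<lambda>xs f. A xs f ^ B xs f)"
proof -
  have "a ^ b = rec_nat 1 (\<lambda>i v. a * v) b" for a b :: nat by (induction b) auto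
  then have eq: "(\<lambda>xs f. A xs f ^ B xs f) = (\<lambda>xs f. rec_nat 1 (\<lambda>i v. A xs f * v) (B xs f))" by simp
  show ?thesis unfolding eq
    by (rule crec_rec[OF crec_const _ assms(2)])
      (use crec_weaken[OF assms(1), of 2 "Suc (Suc k)"] in \<open>auto intro!: crec_intros simp: numeral_2_eq_2\<close>)
qed

lemma crec_diff [crec_intros]:
  assumes "crec k A" "crec k B" shows "crec k (\<lambda>xs f. A xs f - B xs f)"
proof -
  \<comment> \<open>Subtraction iterates the predecessor, which is the recursion returning its own
    counter.\<close>
  have "a - b = rec_nat a (\<lambda>i v. rec_nat 0 (\<lambda>j w. j) v) b" for a b :: nat
  proof (induction b)
    case (Suc b)
    have "rec_nat 0 (\<lambda>j w. j) v = v - 1" for v :: nat by (cases v) auto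
    with Suc show ?case by simp
  qed simp
  then show ?thesis by (simp only:) (intro crec_intros assms; simp)
qed

lemma cdec_not [crec_intros]: "cdec k P \<Longrightarrow> cdec k (\<lambda>xs f. \<not> P xs f)"
proof -
  assume "cdec k P"
  then have "crec k (\<lambda>xs f. 1 - (if P xs f then 1 else 0))"
    by (intro crec_diff crec_const crec_if_cdec)
  then show ?thesis unfolding cdec_def by (subst crec_cong) auto
qed

lemma cdec_conj [crec_intros]: "cdec k P \<Longrightarrow> cdec k Q \<Longrightarrow> cdec k (\<lambda>xs f. P xs f \<and> Q xs f)"
proof -
  assume "cdec k P" "cdec k Q"
  then have "crec k (\<lambda>xs f. (if P xs f then 1 else 0) * (if Q xs f then 1 else 0))"
    by (intro crec_mult crec_if_cdec)
  then show ?thesis unfolding cdec_def by (subst crec_cong) auto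
qed

lemma cdec_disj [crec_intros]: "cdec k P \<Longrightarrow> cdec k Q \<Longrightarrow> cdec k (\<lambda>xs f. P xs f \<or> Q xs f)"
  using cdec_not[OF cdec_conj[OF cdec_not[of k P] cdec_not[of k Q]]] by simp

lemma cdec_imp [crec_intros]: "cdec k P \<Longrightarrow> cdec k Q \<Longrightarrow> cdec k (\<lambda>xs f. P xs f \<longrightarrow> Q xs f)"
  unfolding imp_conv_disj by (intro cdec_disj cdec_not)

lemma cdec_const [crec_intros]: "cdec k (\<lambda>xs f. b)"
  unfolding cdec_def by (rule crec_const)

lemma cdec_le [crec_intros]:
  assumes "crec k A" "crec k B" shows "cdec k (\<lambda>xs f. A xs f \<le> B xs f)"
proof -
  have "crec k (\<lambda>xs f. 1 - (A xs f - B xs f))" by (intro crec_intros assms)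
  then show ?thesis unfolding cdec_def by (subst crec_cong) auto
qed

lemma cdec_less [crec_intros]:
  assumes "crec k A" "crec k B" shows "cdec k (\<lambda>xs f. A xs f < B xs f)"
  using cdec_le[OF crec_Suc[OF assms(1)] assms(2)] by (simp add: Suc_le_eq)

lemma cdec_eq [crec_intros]:
  assumes "crec k A" "crec k B" shows "cdec k (\<lambda>xs f. A xs f = B xs f)"
proof -
  have "cdec k (\<lambda>xs f. A xs f \<le> B xs f \<and> B xs f \<le> A xs f)" by (intro crec_intros assms)
  then show ?thesis by (subst cdec_cong) auto
qed

lemma crec_if [crec_intros]:
  assumes "cdec k P" "crec k A" "crec k B"
  shows "crec k (\<lambda>xs f. if P xs f then A xs f else B xs f)"
proof -
  have "crec k (\<lambda>xs f. (if P xs f then 1 else 0) * A xs f + (if \<not> P xs f then 1 else 0) * B xs f)"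
    by (intro crec_add crec_mult crec_if_cdec cdec_not assms)
  then show ?thesis by (subst crec_cong) auto
qed

lemma crec_sum [crec_intros]:
  assumes A: "crec (Suc k) (\<lambda>xs f. A (xs ! 0) (tl xs) f)" and N: "crec k N"
  shows "crec k (\<lambda>xs f. \<Sum>i<N xs f. A i xs f)"
proof -
  have "(\<Sum>i<n. a i) = rec_nat 0 (\<lambda>i v. v + a i) n" for n and a :: "nat \<Rightarrow> nat"
    by (induction n) auto
  then have eq: "(\<lambda>xs f. \<Sum>i<N xs f. A i xs f) = (\<lambda>xs f. rec_nat 0 (\<lambda>i v. v + A i xs f) (N xs f))"
    by simp
  have "crecl (Suc (Suc k)) (\<lambda>xs f. xs ! 0 # tl (tl xs))"
    by (intro crec_intros) auto
  from crec_app[OF A this] have "crec (Suc (Suc k)) (\<lambda>xs f. A (xs ! 0) (tl (tl xs)) f)" by simp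
  then show ?thesis unfolding eq
    by (intro crec_rec[OF crec_const _ N] crec_add) (auto intro: crec_nth)
qed

lemma cdec_ball [crec_intros]:
  assumes A: "cdec (Suc k) (\<lambda>xs f. P (xs ! 0) (tl xs) f)" and N: "crec k N"
  shows "cdec k (\<lambda>xs f. \<forall>i<N xs f. P i xs f)"
proof -
  have "cdec k (\<lambda>xs f. (\<Sum>i<N xs f. if P i xs f then 0 else 1 :: nat) = 0)"
    by (intro cdec_eq crec_sum[where A = "\<lambda>i xs f. if P i xs f then 0 else 1"] crec_if A N crec_const)
  then show ?thesis by (subst cdec_cong) auto
qed

lemma cdec_bex [crec_intros]:
  assumes A: "cdec (Suc k) (\<lambda>xs f. P (xs ! 0) (tl xs) f)" and N: "crec k N"
  shows "cdec k (\<lambda>xs f. \<exists>i<N xs f. P i xs f)"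
  using cdec_not[OF cdec_ball[OF cdec_not[OF A] N]] by simp

lemma cdec_bex_le [crec_intros]:
  assumes A: "cdec (Suc k) (\<lambda>xs f. P (xs ! 0) (tl xs) f)" and N: "crec k N"
  shows "cdec k (\<lambda>xs f. \<exists>i\<le>N xs f. P i xs f)"
  using cdec_bex[OF A crec_Suc[OF N]] by (simp add: less_Suc_eq_le)

lemma sum_if_eq_card: "(\<Sum>i<n. if P i then 1 else 0) = card {i. i < n \<and> P i}" for n :: nat
  by (simp add: sum.If_cases Int_def)

lemma crec_div [crec_intros]:
  assumes "crec k A" "crec k B" shows "crec k (\<lambda>xs f. A xs f div B xs f)"
proof -
  \<comment> \<open>The quotient counts the positive multiples of \<open>b\<close> up to
    \<open>a\<close>; for \<open>b = 0\<close> nothing is counted, in accordance with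
    \<open>a div 0 = 0\<close>.\<close>
  have *: "(\<Sum>i<a. if b \<noteq> 0 \<and> Suc i * b \<le> a then 1 else 0) = a div b" for a b :: nat
  proof (cases "b = 0")
    case False
    have "Suc i * b \<le> a \<longleftrightarrow> i < a div b" for i
      using False less_eq_div_iff_mult_less_eq[of b "Suc i" a] by (simp add: Suc_le_eq)
    moreover have "i < a div b \<Longrightarrow> i < a" for i
      using div_le_dividend[of a b] by linarith
    ultimately have "{i. i < a \<and> b \<noteq> 0 \<and> Suc i * b \<le> a} = {..<a div b}"
      using False by blast
    then show ?thesis unfolding sum_if_eq_card by simp
  qed simp
  have "crec 2 (\<lambda>xs f. \<Sum>i<xs!0. if xs ! 1 \<noteq> 0 \<and> Suc i * xs ! 1 \<le> xs ! 0 then 1 else 0)"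
    by (rule crec_intros | simp; fail)+
  then have "crec 2 (\<lambda>xs f. xs ! 0 div xs ! 1)"
    unfolding * .
  from crec_app[OF this crecl_cons[OF assms(1) crecl_cons[OF assms(2) crecl_nil]]]
  show ?thesis by simp
qed

lemma crec_mod [crec_intros]:
  assumes "crec k A" "crec k B" shows "crec k (\<lambda>xs f. A xs f mod B xs f)"
proof -
  have "crec k (\<lambda>xs f. A xs f - A xs f div B xs f * B xs f)" by (intro crec_intros assms)
  then show ?thesis by (simp add: modulo_nat_def)
qed

section \<open>Clocked evaluation\<close>

text \<open>
  \<open>crun p f s xs\<close> runs \<open>p\<close> for \<open>s\<close> stages, refusing oracle queries at arguments \<open>\<ge> s\<close>:
  the value \<open>0\<close> means that no result was found, \<open>Suc v\<close> is the result \<open>v\<close>.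
\<close>

fun crun :: "prog \<Rightarrow> (nat \<Rightarrow> nat) \<Rightarrow> nat \<Rightarrow> nat list \<Rightarrow> nat" where
  "crun Zero f s xs = 1"
| "crun Succ f s xs = (case xs of [x] \<Rightarrow> Suc (Suc x) | _ \<Rightarrow> 0)"
| "crun Query f s xs = (case xs of [x] \<Rightarrow> if x < s then Suc (f x) else 0 | _ \<Rightarrow> 0)"
| "crun (Proj i) f s xs = (if i < length xs then Suc (xs ! i) else 0)"
| "crun (Comp g hs) f s xs =
     (let ys = map (\<lambda>h. crun h f s xs) hs
      in if 0 \<in> set ys then 0 else crun g f s (map (\<lambda>y. y - 1) ys))"
| "crun (PrimRec g h) f s xs =
     (case xs of
        [] \<Rightarrow> 0
      | n # zs \<Rightarrow>
          rec_nat (crun g f s zs)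
            (\<lambda>i v. if v = 0 then 0 else crun h f s (i # (v - 1) # zs)) n)"
| "crun (Mu g) f s xs =
     (\<Sum>z<s. if crun g f s (z # xs) = 1 \<and> (\<forall>y<z. 1 < crun g f s (y # xs)) then Suc z else 0)"

lemma sum_unique_if:
  fixes F :: "nat \<Rightarrow> nat"
  assumes "z < s" "P z" "\<And>y. P y \<Longrightarrow> y = z"
  shows "(\<Sum>y<s. if P y then F y else 0) = F z"
proof -
  have "(\<Sum>y<s. if P y then F y else 0) = (\<Sum>y<s. if y = z then F y else 0)"
  proof (rule sum.cong)
    show "(if P y then F y else 0) = (if y = z then F y else 0)" for y
      using assms(2) assms(3)[of y] by (cases "y = z") auto
  qed simp
  then show ?thesis using assms(1) by simp
qed

text \<open>At most one \<open>z\<close> meets the condition in the sum, so the sum is a bounded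
  search. The value \<open>1\<close> of \<open>crun\<close> is the result \<open>0\<close>, larger
  values are nonzero results.\<close>

lemma crun_Mu_eq_Suc:
  "crun (Mu g) f s xs = Suc v \<longleftrightarrow>
     v < s \<and> crun g f s (v # xs) = 1 \<and> (\<forall>y<v. 1 < crun g f s (y # xs))" (is "_ \<longleftrightarrow> v < s \<and> ?P v")
proof -
  let ?P = "\<lambda>z. crun g f s (z # xs) = 1 \<and> (\<forall>y<z. 1 < crun g f s (y # xs))"
  have uniq: "?P y \<Longrightarrow> ?P z \<Longrightarrow> y = z" for y z
    by (metis less_irrefl linorder_neqE_nat)
  show ?thesis
  proof
    assume "v < s \<and> ?P v"
    then show "crun (Mu g) f s xs = Suc v"
      unfolding crun.simps using uniq by (intro sum_unique_if) blast+
  next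
    assume eq: "crun (Mu g) f s xs = Suc v"
    then have "(\<Sum>z<s. if ?P z then Suc z else 0) \<noteq> 0" by simp
    then obtain z where "z \<in> {..<s}" "(if ?P z then Suc z else 0) \<noteq> 0"
      by (rule sum.not_neutral_contains_not_neutral)
    then have z: "z < s" "?P z" by (auto split: if_splits)
    then have "crun (Mu g) f s xs = Suc z"
      unfolding crun.simps using uniq by (intro sum_unique_if) blast+
    with eq z show "v < s \<and> ?P v" by simp
  qed
qed

lemma crun_Comp_eq_Suc:
  "crun (Comp g hs) f s xs = Suc v \<longleftrightarrow>
     0 \<notin> set (map (\<lambda>h. crun h f s xs) hs) \<and>
     crun g f s (map (\<lambda>y. y - 1) (map (\<lambda>h. crun h f s xs) hs)) = Suc v"
  unfolding crun.simps Let_def by (cases "0 \<in> set (map (\<lambda>h. crun h f s xs) hs)") simp_all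

text \<open>The use principle: a successful run of \<open>s\<close> stages has seen the oracle only
  below \<open>s\<close>, and a longer clock does not alter a result already found.\<close>

lemma crun_mono:
  assumes "s \<le> t" "\<And>x. x < s \<Longrightarrow> f x = g x" "crun p f s xs = Suc v"
  shows "crun p g t xs = Suc v"
  using assms(3)
proof (induction p arbitrary: xs v)
  case (Comp p qs)
  let ?ys = "map (\<lambda>q. crun q f s xs) qs"
  have nz: "0 \<notin> set ?ys" and eq: "crun p f s (map (\<lambda>y. y - 1) ?ys) = Suc v"
    using Comp.prems unfolding crun_Comp_eq_Suc by blast+
  have "crun q g t xs = crun q f s xs" if "q \<in> set qs" for q
  proof -
    have "crun q f s xs \<in> set ?ys" using that by simp
    with nz have "crun q f s xs \<noteq> 0" by metis
    then obtain w where "crun q f s xs = Suc w" using not0_implies_Suc by blast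
    with Comp.IH(2)[OF that this] show ?thesis by simp
  qed
  then have eq2: "map (\<lambda>q. crun q g t xs) qs = ?ys" by simp
  show ?case using nz Comp.IH(1)[OF eq] unfolding crun.simps Let_def eq2 by simp
next
  case (PrimRec p q)
  obtain n zs where xs: "xs = n # zs" using PrimRec.prems by (cases xs) auto
  show ?case using PrimRec.prems unfolding xs
  proof (induction n arbitrary: v)
    case 0
    then show ?case using PrimRec.IH(1) by simp
  next
    case (Suc n)
    from Suc.prems obtain w where w: "crun (PrimRec p q) f s (n # zs) = Suc w"
      by (cases "crun (PrimRec p q) f s (n # zs)") auto
    have "crun q f s (n # w # zs) = Suc v"
      using Suc.prems w by simp
    with PrimRec.IH(2) Suc.IH[OF w] show ?case by simp
  qed
next
  case (Mu p)
  have *: "crun p g t (y # xs) = crun p f s (y # xs)" if nz: "crun p f s (y # xs) \<noteq> 0" for y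
  proof -
    obtain w where w: "crun p f s (y # xs) = Suc w"
      using nz by (cases "crun p f s (y # xs)") simp_all
    show ?thesis unfolding w by (rule Mu.IH[OF w])
  qed
  have v: "v < s" "crun p f s (v # xs) = 1" "\<And>y. y < v \<Longrightarrow> 1 < crun p f s (y # xs)"
    using Mu.prems unfolding crun_Mu_eq_Suc by blast+
  have "1 < crun p g t (y # xs)" if "y < v" for y
    using v(3)[OF that] *[of y] by simp
  moreover have "crun p g t (v # xs) = 1" using v(2) *[of v] by simp
  ultimately show ?case unfolding crun_Mu_eq_Suc using v(1) assms(1) by simp
qed (use assms(1,2) in \<open>auto split: list.splits if_splits\<close>)

lemma crun_le: "crun p f s xs = Suc v \<Longrightarrow> s \<le> t \<Longrightarrow> crun p f t xs = Suc v"
  using crun_mono[of s t f f] by blast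

lemma crun_cong:
  assumes "\<And>x. x < s \<Longrightarrow> f x = g x" shows "crun p f s xs = crun p g s xs"
proof (cases "crun p f s xs")
  case (Suc v)
  then show ?thesis using crun_mono[of s s f g p xs v] assms by simp
next
  case 0
  show ?thesis
  proof (cases "crun p g s xs")
    case (Suc v)
    then show ?thesis using crun_mono[of s s g f p xs v] assms by simp
  qed (use 0 in simp)
qed

lemma run_if_crun: "crun p f s xs = Suc v \<Longrightarrow> run p f xs = Some v"
proof (induction p arbitrary: xs v)
  case (Comp p qs)
  let ?ys = "map (\<lambda>q. crun q f s xs) qs"
  have nz: "0 \<notin> set ?ys" and eq: "crun p f s (map (\<lambda>y. y - 1) ?ys) = Suc v"
    using Comp.prems unfolding crun_Comp_eq_Suc by blast+
  have *: "run q f xs = Some (crun q f s xs - 1)" if "q \<in> set qs" for q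
  proof -
    have "crun q f s xs \<in> set ?ys" using that by simp
    with nz have "crun q f s xs \<noteq> 0" by metis
    then show ?thesis using Comp.IH(2)[OF that] by (cases "crun q f s xs") auto
  qed
  have eq2: "map (\<lambda>q. run q f xs) qs = map Some (map (\<lambda>y. y - 1) ?ys)"
    using * by simp
  show ?case using Comp.IH(1)[OF eq] unfolding run.simps Let_def eq2 by (auto simp: comp_def)
next
  case (PrimRec p q)
  obtain n zs where xs: "xs = n # zs" using PrimRec.prems by (cases xs) auto
  show ?case using PrimRec.prems unfolding xs
  proof (induction n arbitrary: v)
    case 0
    then show ?case using PrimRec.IH(1) by simp
  next
    case (Suc n)
    from Suc.prems obtain w where w: "crun (PrimRec p q) f s (n # zs) = Suc w"
      by (cases "crun (PrimRec p q) f s (n # zs)") auto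
    have "crun q f s (n # w # zs) = Suc v"
      using Suc.prems w by simp
    with PrimRec.IH(2) Suc.IH[OF w] show ?case by simp
  qed
next
  case (Mu p)
  from Mu.prems have v: "crun p f s (v # xs) = Suc 0" "\<And>y. y < v \<Longrightarrow> 1 < crun p f s (y # xs)"
    unfolding crun_Mu_eq_Suc by auto
  have rv: "run p f (v # xs) = Some 0" using Mu.IH[OF v(1)] .
  have ry: "\<exists>w. run p f (y # xs) = Some (Suc w)" if "y < v" for y
    using v(2)[OF that] Mu.IH[of "y # xs" "crun p f s (y # xs) - 1"]
    by (intro exI[of _ "crun p f s (y # xs) - 2"]) auto
  have "(LEAST z. run p f (z # xs) = Some 0) = v"
  proof (intro Least_equality rv)
    show "v \<le> y" if "run p f (y # xs) = Some 0" for y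
      using ry[of y] that by (cases "y < v") auto
  qed
  moreover have "\<exists>z. run p f (z # xs) = Some 0 \<and> (\<forall>y<z. run p f (y # xs) \<noteq> None)"
    using rv ry by (intro exI[of _ v]) auto
  ultimately show ?case by simp
qed (auto split: list.splits if_splits)

lemma bounded_stage:
  assumes "\<And>i. i < (n::nat) \<Longrightarrow> \<exists>s. crun p f s (X i) = Suc (V i)"
  shows "\<exists>s. \<forall>i<n. crun p f s (X i) = Suc (V i)"
  using assms
proof (induction n)
  case (Suc n)
  then obtain s where s: "\<forall>i<n. crun p f s (X i) = Suc (V i)" by auto
  obtain t where t: "crun p f t (X n) = Suc (V n)" using Suc.prems by blast
  have "crun p f (max s t) (X i) = Suc (V i)" if "i < Suc n" for i
  proof (cases "i = n")
    case True
    then show ?thesis using crun_le[OF t, of "max s t"] by simp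
  next
    case False
    then have "crun p f s (X i) = Suc (V i)" using that s by simp
    from crun_le[OF this, of "max s t"] show ?thesis by simp
  qed
  then show ?case by blast
qed simp

lemma crun_if_run: "run p f xs = Some v \<Longrightarrow> \<exists>s. crun p f s xs = Suc v"
proof (induction p arbitrary: xs v)
  case Query
  then obtain x where "xs = [x]" "v = f x" by (auto split: list.splits)
  then show ?case by (intro exI[of _ "Suc x"]) simp
next
  case (Comp p qs)
  let ?ys = "map (\<lambda>q. run q f xs) qs"
  have nz: "None \<notin> set ?ys" and eq: "run p f (map the ?ys) = Some v"
    using Comp.prems by (auto simp: Let_def split: if_splits)
  have ex: "\<exists>s. crun q f s xs = Suc (the (run q f xs))" if "q \<in> set qs" for q
  proof -
    have "run q f xs \<in> set ?ys" using that by simp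
    with nz have "run q f xs \<noteq> None" by metis
    then show ?thesis using Comp.IH(2)[OF that] by (cases "run q f xs") auto
  qed
  have "\<exists>s. \<forall>q\<in>set rs. crun q f s xs = Suc (the (run q f xs))" if "set rs \<subseteq> set qs" for rs
    using that
  proof (induction rs)
    case (Cons r rs)
    then obtain s where s: "\<forall>q\<in>set rs. crun q f s xs = Suc (the (run q f xs))" by auto
    obtain t where t: "crun r f t xs = Suc (the (run r f xs))" using ex[of r] Cons.prems by auto
    have "crun q f (max s t) xs = Suc (the (run q f xs))" if "q \<in> set (r # rs)" for q
    proof (cases "q = r")
      case True
      then show ?thesis using crun_le[OF t, of "max s t"] by simp
    next
      case False
      then have "crun q f s xs = Suc (the (run q f xs))" using that s by simp
      from crun_le[OF this, of "max s t"] show ?thesis by simp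
    qed
    then show ?case by blast
  qed simp
  then obtain s where s: "\<And>q. q \<in> set qs \<Longrightarrow> crun q f s xs = Suc (the (run q f xs))" by blast
  obtain t where t: "crun p f t (map the ?ys) = Suc v" using Comp.IH(1)[OF eq] by blast
  let ?m = "max s t"
  have m: "crun q f ?m xs = Suc (the (run q f xs))" if "q \<in> set qs" for q
    using crun_le[OF s[OF that]] by simp
  have eq: "map (\<lambda>q. crun q f ?m xs) qs = map Suc (map the ?ys)" using m by simp
  have "crun p f ?m (map the ?ys) = Suc v" using crun_le[OF t] by simp
  then have "crun (Comp p qs) f ?m xs = Suc v"
    unfolding crun.simps eq Let_def by (auto simp: comp_def)
  then show ?case by blast
next
  case (PrimRec p q)
  obtain n zs where xs: "xs = n # zs" using PrimRec.prems by (cases xs) auto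
  show ?case using PrimRec.prems unfolding xs
  proof (induction n arbitrary: v)
    case 0
    then show ?case using PrimRec.IH(1) by simp
  next
    case (Suc n)
    from Suc.prems obtain w where w: "run (PrimRec p q) f (n # zs) = Some w"
      by (cases "run (PrimRec p q) f (n # zs)") auto
    have "run q f (n # w # zs) = Some v"
      using Suc.prems w by simp
    then obtain s where s: "crun q f s (n # w # zs) = Suc v" using PrimRec.IH(2) by blast
    obtain t where t: "crun (PrimRec p q) f t (n # zs) = Suc w" using Suc.IH[OF w] by blast
    have "crun (PrimRec p q) f (max s t) (n # zs) = Suc w" "crun q f (max s t) (n # w # zs) = Suc v"
      using crun_le[OF t] crun_le[OF s] by simp_all
    then have "crun (PrimRec p q) f (max s t) (Suc n # zs) = Suc v" by simp
    then show ?case by blast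
  qed
next
  case (Mu p)
  let ?Q = "\<lambda>z. run p f (z # xs) = Some 0"
  from Mu.prems obtain z0 where z0: "?Q z0" "\<forall>y<z0. run p f (y # xs) \<noteq> None"
    and v: "v = (LEAST z. ?Q z)" by (auto split: if_splits)
  have Qv: "?Q v" unfolding v using z0(1) by (rule LeastI)
  have "v \<le> z0" unfolding v using z0(1) by (rule Least_le)
  have ex: "\<exists>w. run p f (y # xs) = Some (Suc w)" if "y < v" for y
  proof -
    have "\<not> ?Q y" using that not_less_Least unfolding v by blast
    moreover have "run p f (y # xs) \<noteq> None" using z0(2) that \<open>v \<le> z0\<close> by simp
    ultimately show ?thesis by (metis not0_implies_Suc option.exhaust)
  qed
  then obtain w where w: "\<And>y. y < v \<Longrightarrow> run p f (y # xs) = Some (Suc (w y))" by metis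
  have "\<exists>s. \<forall>y<v. crun p f s (y # xs) = Suc (Suc (w y))"
    using bounded_stage[of v p f "\<lambda>y. y # xs" "\<lambda>y. Suc (w y)"] Mu.IH w by blast
  then obtain s where s: "\<And>y. y < v \<Longrightarrow> crun p f s (y # xs) = Suc (Suc (w y))" by blast
  obtain t where t: "crun p f t (v # xs) = Suc 0" using Mu.IH[OF Qv] by blast
  \<comment> \<open>\<open>Suc v\<close> is included because the clocked search looks only below its
    clock.\<close>
  let ?m = "max (Suc v) (max s t)"
  have "crun p f ?m (v # xs) = Suc 0" using crun_le[OF t] by simp
  moreover have "crun p f ?m (y # xs) = Suc (Suc (w y))" if "y < v" for y
    using crun_le[OF s[OF that]] by simp
  ultimately have "crun (Mu p) f ?m xs = Suc v" unfolding crun_Mu_eq_Suc by simp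
  then show ?case by blast
qed (auto split: list.splits if_splits)

lemma crec_tl: "crec k A \<Longrightarrow> crec (Suc k) (\<lambda>xs f. A (tl xs) f)"
  using crec_weaken[of k A 1 "Suc k"] by simp

lemma crecl_zero_mem:
  assumes "\<And>A. A \<in> set As \<Longrightarrow> crec k A"
  shows "cdec k (\<lambda>xs f. 0 \<in> set (map (\<lambda>A. A xs f) As))"
  using assms
proof (induction As)
  case (Cons A As)
  then have "cdec k (\<lambda>xs f. 0 = A xs f \<or> 0 \<in> set (map (\<lambda>A. A xs f) As))"
    by (intro cdec_disj cdec_eq crec_const) auto
  then show ?case by simp
qed (simp add: cdec_const)

text \<open>For a fixed program clocked evaluation unfolds into finitely many recursions and bounded
  sums, hence induction on \<open>p\<close>. The oracle may depend on the arguments; this survives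
  the argument shifts in the cases \<open>PrimRec\<close> and \<open>Mu\<close> and is what
  substitution of oracles rests on.\<close>

lemma crec_crun_map:
  assumes "crec (Suc k) (\<lambda>xs f. Or (xs ! 0) (tl xs) f)" "crec k S" "\<And>A. A \<in> set As \<Longrightarrow> crec k A"
  shows "crec k (\<lambda>xs f. crun p (\<lambda>x. Or x xs f) (S xs f) (map (\<lambda>A. A xs f) As))"
  using assms
proof (induction p arbitrary: k Or S As)
  case Zero
  show ?case by (simp add: crec_const)
next
  case Succ
  then show ?case by (cases As; cases "tl As") (auto intro: crec_const crec_Suc)
next
  case Query
  show ?case
  proof (cases "length As = 1")
    case True
    then obtain A where As: "As = [A]" by (auto simp: length_Suc_conv)
    have A: "crec k A" using Query.prems(3) As by simp
    have "crec k (\<lambda>xs f. Or (A xs f) xs f)"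
      using crec_app[OF Query.prems(1) crecl_cons[OF A crecl_funpow_tl[of 0 k]]] by simp
    then show ?thesis unfolding As
      by (simp, intro crec_if cdec_less A Query.prems(2) crec_Suc crec_const) auto
  qed (cases As; cases "tl As"; auto intro: crec_const)
next
  case (Proj i)
  then show ?case by (cases "i < length As") (auto intro: crec_const crec_Suc)
next
  case (Comp g hs)
  let ?B = "\<lambda>h xs f. crun h (\<lambda>x. Or x xs f) (S xs f) (map (\<lambda>A. A xs f) As)"
  have B: "crec k (?B h)" if "h \<in> set hs" for h
    using Comp.IH(2)[OF that Comp.prems] by simp
  have z: "cdec k (\<lambda>xs f. 0 \<in> set (map (\<lambda>A. A xs f) (map ?B hs)))"
    by (rule crecl_zero_mem) (use B in auto)
  have "crec k (\<lambda>xs f. crun g (\<lambda>x. Or x xs f) (S xs f)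
      (map (\<lambda>A. A xs f) (map (\<lambda>h xs f. ?B h xs f - 1) hs)))"
    by (rule Comp.IH(1)[OF Comp.prems(1,2)]) (use B in \<open>auto intro!: crec_diff crec_const\<close>)
  from crec_if[OF z crec_const[of k 0] this] show ?case by (simp add: Let_def comp_def cong: if_cong)
next
  case (PrimRec g h)
  show ?case
  proof (cases As)
    case Nil
    then show ?thesis by (simp add: crec_const)
  next
    case (Cons N Bs)
    let ?O = "\<lambda>x xs f. Or x (tl (tl xs)) f"
    let ?Bs = "(\<lambda>xs f. xs ! 0) # (\<lambda>xs f. xs ! 1 - 1) # map (\<lambda>A xs f. A (tl (tl xs)) f) Bs"
    have N: "crec k N" and Bs: "\<And>A. A \<in> set Bs \<Longrightarrow> crec k A" using PrimRec.prems(3) Cons by auto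
    have G: "crec k (\<lambda>xs f. crun g (\<lambda>x. Or x xs f) (S xs f) (map (\<lambda>A. A xs f) Bs))"
      using PrimRec.IH(1)[OF PrimRec.prems(1,2) Bs] .
    have S2: "crec (Suc (Suc k)) (\<lambda>xs f. S (tl (tl xs)) f)"
      by (rule crec_tl[OF crec_tl[OF PrimRec.prems(2)]])
    have "crecl (Suc (Suc (Suc k))) (\<lambda>xs f. xs ! 0 # tl (tl (tl xs)))"
      by (rule crec_intros | simp; fail)+
    from crec_app[OF PrimRec.prems(1) this]
    have O2: "crec (Suc (Suc (Suc k))) (\<lambda>xs f. ?O (xs ! 0) (tl xs) f)" by simp
    have B2: "crec (Suc (Suc k)) A" if "A \<in> set ?Bs" for A
      using that crec_tl[OF crec_tl[OF Bs]] by (auto intro!: crec_nth crec_diff crec_const)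
    have "crec (Suc (Suc k)) (\<lambda>xs f. if xs ! 1 = 0 then 0 else
        crun h (\<lambda>x. ?O x xs f) (S (tl (tl xs)) f) (map (\<lambda>A. A xs f) ?Bs))"
      by (intro crec_if cdec_eq crec_const crec_nth PrimRec.IH(2)[OF O2 S2 B2]) auto
    then have H: "crec (Suc (Suc k)) (\<lambda>xs f. if xs ! 1 = 0 then 0 else
        crun h (\<lambda>x. Or x (tl (tl xs)) f) (S (tl (tl xs)) f)
          (xs ! 0 # (xs ! 1 - 1) # map (\<lambda>A. A (tl (tl xs)) f) Bs))"
      by (simp add: comp_def cong: if_cong)
    show ?thesis unfolding Cons using crec_rec[where H = "\<lambda>i v xs f. if v = 0 then 0 else
        crun h (\<lambda>x. Or x xs f) (S xs f) (i # (v - 1) # map (\<lambda>A. A xs f) Bs)", OF G H N]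
      by simp
  qed
next
  case (Mu g)
  let ?O = "\<lambda>x xs f. Or x (tl xs) f"
  let ?Bs = "(\<lambda>xs f. xs ! 0) # map (\<lambda>A xs f. A (tl xs) f) As"
  have S2: "crec (Suc k) (\<lambda>xs f. S (tl xs) f)"
    by (rule crec_tl[OF Mu.prems(2)])
  have "crecl (Suc (Suc k)) (\<lambda>xs f. xs ! 0 # tl (tl xs))"
    by (rule crec_intros | simp; fail)+
  from crec_app[OF Mu.prems(1) this]
  have O2: "crec (Suc (Suc k)) (\<lambda>xs f. ?O (xs ! 0) (tl xs) f)" by simp
  have B2: "crec (Suc k) A" if "A \<in> set ?Bs" for A
    using that crec_tl[OF Mu.prems(3)] by (auto intro!: crec_nth)
  have "crec (Suc k) (\<lambda>xs f. crun g (\<lambda>x. ?O x xs f) (S (tl xs) f) (map (\<lambda>A. A xs f) ?Bs))"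
    by (rule Mu.IH[OF O2 S2 B2])
  then have C: "crec (Suc k) (\<lambda>xs f. crun g (\<lambda>x. Or x (tl xs) f) (S (tl xs) f)
      (xs ! 0 # map (\<lambda>A. A (tl xs) f) As))"
    by (simp add: comp_def)
  have "crecl (Suc (Suc k)) (\<lambda>xs f. xs ! 0 # tl (tl xs))"
    by (rule crec_intros | simp; fail)+
  from crec_app[OF C this]
  have C2: "crec (Suc (Suc k)) (\<lambda>xs f. crun g (\<lambda>x. Or x (tl (tl xs)) f) (S (tl (tl xs)) f)
      (xs ! 0 # map (\<lambda>A. A (tl (tl xs)) f) As))"
    by simp
  show ?case unfolding crun.simps
    by (intro crec_sum crec_if cdec_conj cdec_eq cdec_ball cdec_less C C2 crec_const crec_Suc crec_nth
        Mu.prems(2)) auto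
qed

lemma crec_crun [crec_intros]:
  assumes "crec (Suc k) (\<lambda>xs f. Or (xs ! 0) (tl xs) f)" "crec k S" "crecl k L"
  shows "crec k (\<lambda>xs f. crun p (\<lambda>x. Or x xs f) (S xs f) (L xs f))"
proof -
  obtain As where As: "\<forall>A\<in>set As. crec k A" "\<And>xs f. length xs = k \<Longrightarrow> L xs f = map (\<lambda>A. A xs f) As"
    using assms(3) unfolding crecl_def by blast
  have "crec k (\<lambda>xs f. crun p (\<lambda>x. Or x xs f) (S xs f) (map (\<lambda>A. A xs f) As))"
    using As(1) by (intro crec_crun_map assms(1,2)) auto
  then show ?thesis using As(2) by (subst crec_cong) auto
qed

section \<open>Pairs and finite sequences\<close>

definition pfst :: "nat \<Rightarrow> nat" where "pfst u = fst (prod_decode u)"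
definition psnd :: "nat \<Rightarrow> nat" where "psnd u = snd (prod_decode u)"

lemma pfst_prod_encode [simp]: "pfst (prod_encode (a, b)) = a"
  and psnd_prod_encode [simp]: "psnd (prod_encode (a, b)) = b"
  and prod_encode_pfst_psnd [simp]: "prod_encode (pfst u, psnd u) = u"
  by (simp_all add: pfst_def psnd_def)

lemma crec_prod_encode [crec_intros]:
  assumes "crec k A" "crec k B" shows "crec k (\<lambda>xs f. prod_encode (A xs f, B xs f))"
  unfolding prod_encode_def triangle_def by (simp, intro crec_intros assms)

lemma pfst_le: "pfst u \<le> u" and psnd_le: "psnd u \<le> u"
  using le_prod_encode_1[of "pfst u" "psnd u"] le_prod_encode_2[of "psnd u" "pfst u"] by simp_all

text \<open>Decoding is a bounded search: exactly one \<open>m \<le> u\<close> is the first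
  component of \<open>u\<close>, and the sum picks it out.\<close>

lemma crec_pfst [crec_intros]:
  assumes A: "crec k A" shows "crec k (\<lambda>xs f. pfst (A xs f))"
proof -
  have eq: "(\<Sum>m<Suc u. if \<exists>n<Suc u. prod_encode (m, n) = u then m else 0) = pfst u" for u
  proof (rule sum_unique_if)
    show "\<exists>n<Suc u. prod_encode (pfst u, n) = u"
      using psnd_le[of u] by (intro exI[of _ "psnd u"]) auto
  qed (use pfst_le[of u] in auto)
  have "crec 1 (\<lambda>xs f. \<Sum>m<Suc (xs ! 0). if \<exists>n<Suc (xs ! 0). prod_encode (m, n) = xs ! 0 then m else 0)"
    by (rule crec_intros | simp; fail)+
  from crec_app[OF this[unfolded eq] crecl_cons[OF A crecl_nil]] show ?thesis by simp
qed

lemma crec_psnd [crec_intros]: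
  assumes A: "crec k A" shows "crec k (\<lambda>xs f. psnd (A xs f))"
proof -
  have eq: "(\<Sum>n<Suc u. if prod_encode (pfst u, n) = u then n else 0) = psnd u" for u
  proof (rule sum_unique_if)
    show "y = psnd u" if "prod_encode (pfst u, y) = u" for y
      using that by (metis psnd_prod_encode)
  qed (use psnd_le[of u] in auto)
  have "crec 1 (\<lambda>xs f. \<Sum>n<Suc (xs ! 0). if prod_encode (pfst (xs ! 0), n) = xs ! 0 then n else 0)"
    by (rule crec_intros | simp; fail)+
  from crec_app[OF this[unfolded eq] crecl_cons[OF A crecl_nil]] show ?thesis by simp
qed

text \<open>Tail, entry and length for the codes of \<open>list_encode\<close>, where a nonempty
  list is the successor of the pair of its head and tail. The code bounds the length, and entries
  beyond the end are \<open>0\<close>.\<close>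

definition ltl :: "nat \<Rightarrow> nat" where "ltl z = psnd (z - 1)"
definition ent :: "nat \<Rightarrow> nat \<Rightarrow> nat" where "ent z i = pfst ((ltl ^^ i) z - 1)"
definition len :: "nat \<Rightarrow> nat" where "len z = (\<Sum>k<z. if (ltl ^^ k) z \<noteq> 0 then 1 else 0)"

lemma ltl_funpow_list_encode: "(ltl ^^ i) (list_encode xs) = list_encode (drop i xs)"
proof (induction i arbitrary: xs)
  case (Suc i)
  have "ltl (list_encode xs) = list_encode (tl xs)"
    using psnd_le[of 0] by (cases xs) (auto simp: ltl_def)
  then show ?case using Suc by (simp add: funpow_Suc_right drop_Suc del: funpow.simps)
qed simp

lemma ent_list_encode: "ent (list_encode xs) i = (if i < length xs then xs ! i else 0)"
proof (cases "i < length xs")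
  case True
  then have "drop i xs = xs ! i # drop (Suc i) xs" by (rule Cons_nth_drop_Suc[symmetric])
  then show ?thesis using True by (simp add: ent_def ltl_funpow_list_encode)
qed (use pfst_le[of 0] in \<open>simp add: ent_def ltl_funpow_list_encode\<close>)

lemma length_le_list_encode: "length xs \<le> list_encode xs"
  by (induction xs) (auto intro: order_trans[OF _ le_prod_encode_2])

lemma len_list_encode [simp]: "len (list_encode xs) = length xs"
proof -
  have nz: "list_encode ys \<noteq> 0 \<longleftrightarrow> ys \<noteq> []" "0 < list_encode ys \<longleftrightarrow> ys \<noteq> []" for ys
    by (cases ys; simp)+
  have "{k. k < list_encode xs \<and> (ltl ^^ k) (list_encode xs) \<noteq> 0} = {..<length xs}"
    using length_le_list_encode[of xs] by (auto simp: ltl_funpow_list_encode nz)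
  then show ?thesis unfolding len_def sum_if_eq_card by simp
qed

lemma len_eq: "len z = length (list_decode z)"
  using len_list_encode[of "list_decode z"] by simp

lemma ent_eq: "ent z i = (if i < len z then list_decode z ! i else 0)"
  using ent_list_encode[of "list_decode z" i] by (simp add: len_eq)

lemma len_le: "len z \<le> z"
  using length_le_list_encode[of "list_decode z"] by (simp add: len_eq)

lemma ex_ent: "\<exists>z. len z = n \<and> (\<forall>i<n. ent z i = Z i)"
  by (rule exI[of _ "list_encode (map Z [0..<n])"]) (simp add: ent_list_encode)

lemma code_eqI:
  assumes "len u = len v" "\<And>i. i < len u \<Longrightarrow> ent u i = ent v i" shows "u = v"
proof -
  have "list_decode u = list_decode v"
    using assms by (intro nth_equalityI) (auto simp: len_eq ent_eq)
  then show ?thesis by (metis list_decode_inverse)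
qed

lemma len_0 [simp]: "len 0 = 0"
  by (simp add: len_def)

lemma crec_ltl [crec_intros]: "crec k A \<Longrightarrow> crec k (\<lambda>xs f. ltl (A xs f))"
  unfolding ltl_def by (intro crec_intros)

lemma crec_ltl_funpow [crec_intros]:
  assumes "crec k A" "crec k B" shows "crec k (\<lambda>xs f. (ltl ^^ B xs f) (A xs f))"
proof -
  have "(ltl ^^ n) z = rec_nat z (\<lambda>i v. ltl v) n" for n z by (induction n) auto
  then show ?thesis by (simp only:) (rule crec_intros assms | simp; fail)+
qed

lemma crec_ent [crec_intros]:
  assumes "crec k A" "crec k B" shows "crec k (\<lambda>xs f. ent (A xs f) (B xs f))"
  unfolding ent_def by (intro crec_intros assms)

lemma crec_len [crec_intros]:
  assumes "crec k A" shows "crec k (\<lambda>xs f. len (A xs f))"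
proof -
  have "crec 1 (\<lambda>xs f. len (xs ! 0))" unfolding len_def by (rule crec_intros | simp; fail)+
  from crec_app[OF this crecl_cons[OF assms crecl_nil]] show ?thesis by simp
qed


section \<open>Unbounded search and substitution of oracles\<close>

lemma crec_Least:
  assumes P: "cdec (Suc k) (\<lambda>xs f. P (xs ! 0) (tl xs) f)"
    and ex: "\<And>xs f. length xs = k \<Longrightarrow> \<exists>n. P n xs f"
  shows "crec k (\<lambda>xs f. LEAST n. P n xs f)"
proof -
  have "crec (Suc k) (\<lambda>xs f. if P (xs ! 0) (tl xs) f then 0 else 1)"
    by (intro crec_if P crec_const)
  then obtain p where p: "\<And>xs f. length xs = Suc k \<Longrightarrow>
      run p f xs = Some (if P (xs ! 0) (tl xs) f then 0 else 1)"
    unfolding crec_def by blast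
  have "run (Mu p) f xs = Some (LEAST n. P n xs f)" if len: "length xs = k" for xs f
  proof -
    have "run p f (z # xs) = Some 0 \<longleftrightarrow> P z xs f" "run p f (z # xs) \<noteq> None" for z
      using p[of "z # xs" f] len by auto
    then show ?thesis using ex[OF len, of f] by simp
  qed
  then show ?thesis unfolding crec_def by blast
qed

text \<open>Search for the first clock at which the program for \<open>F\<close> succeeds with the
  substituted oracle; the program halts on every oracle, so the search ends.\<close>

lemma crec_osubst:
  assumes F: "crec n F" and L: "crecl k L" "\<And>xs f. length xs = k \<Longrightarrow> length (L xs f) = n"
    and Or: "crec (Suc k) (\<lambda>xs f. Or (xs ! 0) (tl xs) f)"
  shows "crec k (\<lambda>xs f. F (L xs f) (\<lambda>x. Or x xs f))"
proof -
  obtain p where p: "\<And>xs f. length xs = n \<Longrightarrow> run p f xs = Some (F xs f)"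
    using F unfolding crec_def by blast
  let ?C = "\<lambda>s xs f. crun p (\<lambda>x. Or x xs f) s (L xs f)"
  have L1: "crecl (Suc k) (\<lambda>xs f. L (tl xs) f)"
    using crecl_weaken[OF L(1), of 1 "Suc k"] by simp
  have "crecl (Suc (Suc k)) (\<lambda>xs f. xs ! 0 # tl (tl xs))"
    by (rule crec_intros | simp; fail)+
  from crec_app[OF Or this]
  have O1: "crec (Suc (Suc k)) (\<lambda>xs f. Or (xs ! 0) (tl (tl xs)) f)" by simp
  have C1: "crec (Suc k) (\<lambda>xs f. ?C (xs ! 0) (tl xs) f)"
    by (intro crec_crun O1 L1 crec_nth) simp
  have val: "\<exists>s. ?C s xs f = Suc (F (L xs f) (\<lambda>x. Or x xs f))" if "length xs = k" for xs f
    by (rule crun_if_run[OF p[OF L(2)[OF that]]])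
  have S: "crec k (\<lambda>xs f. LEAST s. ?C s xs f \<noteq> 0)"
  proof (rule crec_Least)
    show "\<exists>s. ?C s xs f \<noteq> 0" if "length xs = k" for xs f
      using val[OF that, of f] by (metis nat.distinct(1))
  qed (intro cdec_not cdec_eq C1 crec_const)
  have "crec k (\<lambda>xs f. ?C (LEAST s. ?C s xs f \<noteq> 0) xs f - 1)"
    by (intro crec_diff crec_const crec_crun Or S L(1))
  moreover have "?C (LEAST s. ?C s xs f \<noteq> 0) xs f - 1 = F (L xs f) (\<lambda>x. Or x xs f)"
    if len: "length xs = k" for xs f
  proof -
    let ?s = "LEAST s. ?C s xs f \<noteq> 0"
    have "\<exists>s. ?C s xs f \<noteq> 0" using val[OF len, of f] by (metis nat.distinct(1))
    then have "?C ?s xs f \<noteq> 0" by (rule LeastI_ex)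
    then obtain v where v: "?C ?s xs f = Suc v" using not0_implies_Suc by blast
    from run_if_crun[OF this] p[OF L(2)[OF len]] have "v = F (L xs f) (\<lambda>x. Or x xs f)" by simp
    with v show ?thesis by simp
  qed
  ultimately show ?thesis by (subst crec_cong) auto
qed

lemma cdec_osubst:
  assumes "cdec n P" "crecl k L" "\<And>xs f. length xs = k \<Longrightarrow> length (L xs f) = n"
    "crec (Suc k) (\<lambda>xs f. Or (xs ! 0) (tl xs) f)"
  shows "cdec k (\<lambda>xs f. P (L xs f) (\<lambda>x. Or x xs f))"
  using crec_osubst[OF assms(1)[unfolded cdec_def] assms(2-)] unfolding cdec_def .


section \<open>Analytic predicates\<close>

definition ev :: "(nat \<Rightarrow> nat) \<Rightarrow> nat \<Rightarrow> nat" where "ev g x = g (2 * x)"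
definition od :: "(nat \<Rightarrow> nat) \<Rightarrow> nat \<Rightarrow> nat" where "od g x = g (Suc (2 * x))"

lemma ev_join [simp]: "ev (join f g) = f" and od_join [simp]: "od (join f g) = g"
  by (auto simp: ev_def od_def join_def)

text \<open>This and the next rules reduce a compound oracle to the computation of one of its
  values, the form in which oracle substitution leaves its goals.\<close>

lemma crec_ev [crec_intros]:
  "crec k (\<lambda>xs f. F xs f (2 * A xs f)) \<Longrightarrow> crec k (\<lambda>xs f. ev (F xs f) (A xs f))"
  by (simp add: ev_def)

lemma crec_od [crec_intros]:
  "crec k (\<lambda>xs f. F xs f (Suc (2 * A xs f))) \<Longrightarrow> crec k (\<lambda>xs f. od (F xs f) (A xs f))"
  by (simp add: od_def)

lemma crec_join [crec_intros]:
  "crec k (\<lambda>xs f. if A xs f mod 2 = 0 then F xs f (A xs f div 2) else G xs f (A xs f div 2))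
   \<Longrightarrow> crec k (\<lambda>xs f. join (F xs f) (G xs f) (A xs f))"
  by (simp add: join_def even_iff_mod_2_eq_zero)

text \<open>Reads an arbitrary function as a point of Cantor space, so that predicates of reals can
  be handled as predicates of functions.\<close>

definition tb :: "(nat \<Rightarrow> nat) \<Rightarrow> cantor" where "tb f i \<longleftrightarrow> f i \<noteq> 0"

lemma tb_char_fun [simp]: "tb (char_fun X) = X"
  by (rule ext) (simp add: tb_def char_fun_def)

lemma cdec_tb [crec_intros]:
  "crec k (\<lambda>xs f. F xs f (A xs f)) \<Longrightarrow> cdec k (\<lambda>xs f. tb (F xs f) (A xs f))"
  unfolding tb_def by (intro crec_intros)

lemma crec_char_fun [crec_intros]:
  "cdec k (\<lambda>xs f. F xs f (A xs f)) \<Longrightarrow> crec k (\<lambda>xs f. char_fun (F xs f) (A xs f))"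
  unfolding char_fun_def by (rule crec_if_cdec)

text \<open>The counterpart of \<open>Sigma11\<close> with a Baire space argument: function
  quantifiers are then absorbed by joins.\<close>

definition Sig :: "nat \<Rightarrow> (nat list \<Rightarrow> (nat \<Rightarrow> nat) \<Rightarrow> bool) \<Rightarrow> bool" where
  "Sig k A \<longleftrightarrow> (\<exists>R. cdec (Suc k) R \<and>
     (\<forall>ns f. length ns = k \<longrightarrow> (A ns f \<longleftrightarrow> (\<exists>Z. \<forall>m. R (m # ns) (join f Z)))))"

text \<open>
  Every \<open>\<Sigma>\<^sup>1\<^sub>1\<close> predicate has the form \<open>\<exists>Z. \<forall>s. nf p s ns (join f Z)\<close>, where
  \<open>nf p s\<close> is antitone in \<open>s\<close> and looks at the oracle only below \<open>s\<close>.
\<close>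

definition nf :: "prog \<Rightarrow> nat \<Rightarrow> nat list \<Rightarrow> (nat \<Rightarrow> nat) \<Rightarrow> bool" where
  "nf p s ns g \<longleftrightarrow> (\<forall>m<s. crun p g s (m # ns) \<noteq> 1)"

lemma nf_0 [simp]: "nf p 0 ns g"
  by (simp add: nf_def)

lemma nf_mono:
  assumes "nf p t ns h" "s \<le> t" "\<And>x. x < s \<Longrightarrow> g x = h x" shows "nf p s ns g"
  unfolding nf_def
proof (intro allI impI notI)
  fix m assume "m < s" "crun p g s (m # ns) = 1"
  with crun_mono[of s t g h p "m # ns" 0] assms show False by (auto simp: nf_def)
qed

lemma nf_cong: "(\<And>x. x < s \<Longrightarrow> g x = h x) \<Longrightarrow> nf p s ns g \<longleftrightarrow> nf p s ns h"
  by (rule iffI; erule nf_mono[OF _ order_refl]) simp_all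

lemma cdec_nf [crec_intros]:
  assumes "crec (Suc k) (\<lambda>xs f. Or (xs ! 0) (tl xs) f)" "crec k S" "crecl k L"
  shows "cdec k (\<lambda>xs f. nf p (S xs f) (L xs f) (\<lambda>x. Or x xs f))"
proof -
  obtain As where As: "\<forall>A\<in>set As. crec k A" "\<And>xs f. length xs = k \<Longrightarrow> L xs f = map (\<lambda>A. A xs f) As"
    using assms(3) unfolding crecl_def by blast
  have L: "crecl (Suc k) (\<lambda>xs f. L (tl xs) f)"
    using crecl_weaken[OF assms(3), of 1 "Suc k"] by simp
  have "crecl (Suc (Suc k)) (\<lambda>xs f. xs ! 0 # tl (tl xs))"
    by (rule crec_intros | simp; fail)+
  from crec_app[OF assms(1) this]
  have "crec (Suc (Suc k)) (\<lambda>xs f. Or (xs ! 0) (tl (tl xs)) f)" by simp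
  then show ?thesis unfolding nf_def
    by (intro crec_intros assms(2) L crec_tl[OF assms(2)]) auto
qed

lemma SigI:
  assumes "cdec (Suc k) (\<lambda>xs g. P (xs ! 0) (tl xs) (ev g) (od g))"
    and "\<And>ns f. length ns = k \<Longrightarrow> A ns f \<longleftrightarrow> (\<exists>Z. \<forall>m. P m ns f Z)"
  shows "Sig k A"
  unfolding Sig_def using assms
  by (intro exI[of _ "\<lambda>xs g. P (xs ! 0) (tl xs) (ev g) (od g)"]) auto

text \<open>The value \<open>1\<close> of \<open>crun\<close> is the output \<open>0\<close>, a
  refutation of \<open>R\<close>. A refutation for \<open>m\<close> found at stage \<open>s\<close>
  is visible to \<open>nf\<close> from stage \<open>max s (Suc m)\<close> on.\<close>

lemma all_iff_nf:
  assumes p: "\<And>ns f. length ns = Suc k \<Longrightarrow> run p f ns = Some (if R ns f then 1 else 0)"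
    and len: "length ns = k"
  shows "(\<forall>m. R (m # ns) g) \<longleftrightarrow> (\<forall>s. nf p s ns g)"
proof
  assume R: "\<forall>m. R (m # ns) g"
  show "\<forall>s. nf p s ns g" unfolding nf_def
  proof (intro allI impI notI)
    fix s m assume "crun p g s (m # ns) = 1"
    then have "run p g (m # ns) = Some 0" using run_if_crun[of p g s "m # ns" 0] by simp
    then show False using R p[of "m # ns" g] len by simp
  qed
next
  assume *: "\<forall>s. nf p s ns g"
  show "\<forall>m. R (m # ns) g"
  proof (rule allI, rule ccontr)
    fix m assume "\<not> R (m # ns) g"
    then have "run p g (m # ns) = Some 0" using p[of "m # ns" g] len by simp
    then obtain s where s: "crun p g s (m # ns) = Suc 0" using crun_if_run by blast
    have "crun p g (max s (Suc m)) (m # ns) = Suc 0" by (rule crun_le[OF s]) simp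
    moreover have "nf p (max s (Suc m)) ns g" using * by blast
    ultimately show False by (auto simp: nf_def)
  qed
qed

lemma Sig_nf:
  assumes "Sig k A"
  obtains p where "\<And>ns f. length ns = k \<Longrightarrow> A ns f \<longleftrightarrow> (\<exists>Z. \<forall>s. nf p s ns (join f Z))"
proof -
  obtain R where R: "cdec (Suc k) R"
    "\<And>ns f. length ns = k \<Longrightarrow> A ns f \<longleftrightarrow> (\<exists>Z. \<forall>m. R (m # ns) (join f Z))"
    using assms unfolding Sig_def by blast
  obtain p where p: "\<And>ns f. length ns = Suc k \<Longrightarrow> run p f ns = Some (if R ns f then 1 else 0)"
    using R(1) unfolding cdec_def crec_def by blast
  show ?thesis
  proof (rule that)
    show "A ns f \<longleftrightarrow> (\<exists>Z. \<forall>s. nf p s ns (join f Z))" if "length ns = k" for ns f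
      using R(2)[OF that] all_iff_nf[of k p R, OF p that] by simp
  qed
qed

text \<open>From left to right the oracle is first normalised to the characteristic function of its
  support; conversely \<open>tb\<close> undoes \<open>char_fun\<close>.\<close>

lemma Sigma11_iff_Sig: "Sigma11 k A \<longleftrightarrow> Sig k (\<lambda>ns f. A ns (tb f))"
proof
  assume "Sigma11 k A"
  then obtain R where R: "cdec (Suc k) R" and
    A: "\<And>ns X. length ns = k \<Longrightarrow> A ns X \<longleftrightarrow> (\<exists>Z. \<forall>m. R (m # ns) (join (char_fun X) Z))"
    unfolding Sigma11_def recursive_rel_iff_cdec by blast
  show "Sig k (\<lambda>ns f. A ns (tb f))"
  proof (rule SigI[where P = "\<lambda>s ns f Z. R (s # ns) (join (char_fun (tb f)) Z)"])
    show "cdec (Suc k) (\<lambda>xs g. R (xs ! 0 # tl xs) (join (char_fun (tb (ev g))) (od g)))"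
      by (rule cdec_osubst[OF R] crec_intros | simp; fail)+
  qed (rule A)
next
  assume "Sig k (\<lambda>ns f. A ns (tb f))"
  then obtain R where R: "cdec (Suc k) R"
    "\<And>ns f. length ns = k \<Longrightarrow> (A ns (tb f) \<longleftrightarrow> (\<exists>Z. \<forall>m. R (m # ns) (join f Z)))"
    unfolding Sig_def by blast
  have "A ns X \<longleftrightarrow> (\<exists>Z. \<forall>m. R (m # ns) (join (char_fun X) Z))" if "length ns = k" for ns X
    using R(2)[OF that, of "char_fun X"] by simp
  with R(1) show "Sigma11 k A"
    unfolding Sigma11_def recursive_rel_iff_cdec by blast
qed

named_theorems sig_intros

lemma Sig_cong: "(\<And>ns f. length ns = k \<Longrightarrow> A ns f = B ns f) \<Longrightarrow> Sig k A = Sig k B"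
  unfolding Sig_def by (simp cong: conj_cong)

lemma Sig_cdec:
  assumes "cdec k P" shows "Sig k P"
proof (rule SigI[where P = "\<lambda>s ns f Z. P ns f"])
  show "cdec (Suc k) (\<lambda>xs g. P (tl xs) (ev g))"
    by (rule cdec_osubst[OF assms] crec_intros | simp; fail)+
qed simp

lemma Sig_osubst:
  assumes A: "Sig n A" and L: "crecl k L" "\<And>xs f. length xs = k \<Longrightarrow> length (L xs f) = n"
    and Or: "crec (Suc k) (\<lambda>xs f. Or (xs ! 0) (tl xs) f)"
  shows "Sig k (\<lambda>xs f. A (L xs f) (\<lambda>x. Or x xs f))"
proof -
  obtain R where R: "cdec (Suc n) R"
    "\<And>ns f. length ns = n \<Longrightarrow> A ns f \<longleftrightarrow> (\<exists>Z. \<forall>m. R (m # ns) (join f Z))"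
    using A unfolding Sig_def by blast
  obtain As where As: "\<forall>A\<in>set As. crec k A" "\<And>xs f. length xs = k \<Longrightarrow> L xs f = map (\<lambda>A. A xs f) As"
    using L(1) unfolding crecl_def by blast
  have Lev: "crecl (Suc k) (\<lambda>xs g. L (tl xs) (ev g))"
    unfolding crecl_def
  proof (intro exI[of _ "map (\<lambda>A xs g. A (tl xs) (ev g)) As"] conjI allI impI ballI)
    fix B assume "B \<in> set (map (\<lambda>A xs g. A (tl xs) (ev g)) As)"
    then obtain A where A: "crec k A" "B = (\<lambda>xs g. A (tl xs) (ev g))" using As(1) by auto
    show "crec (Suc k) B" unfolding A(2)
      by (rule crec_osubst[OF A(1)] crec_intros | simp; fail)+
  qed (simp add: As(2))
  have Oev: "crec (Suc (Suc k)) (\<lambda>xs g. Or (xs ! 0) (tl (tl xs)) (ev g))"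
  proof -
    have "crec (Suc (Suc k)) (\<lambda>xs g. Or ((xs ! 0 # tl (tl xs)) ! 0) (tl (xs ! 0 # tl (tl xs))) (ev g))"
      by (rule crec_osubst[OF Or] crec_intros | simp; fail)+
    then show ?thesis by simp
  qed
  show ?thesis
  proof (rule SigI[where P = "\<lambda>s ns f Z. R (s # L ns f) (join (\<lambda>x. Or x ns f) Z)"])
    have "crec (Suc (Suc k)) (\<lambda>xs g. join (\<lambda>x. Or x (tl (tl xs)) (ev g)) (od g) (xs ! 0))"
    proof -
      have "crecl (Suc (Suc k)) (\<lambda>xs g. xs ! 0 div 2 # tl xs)"
        by (rule crec_intros | simp; fail)+
      from crec_app[OF Oev this] have "crec (Suc (Suc k)) (\<lambda>xs g. Or (xs ! 0 div 2) (tl (tl xs)) (ev g))"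
        by simp
      then show ?thesis by (intro crec_intros) auto
    qed
    then show "cdec (Suc k) (\<lambda>xs g. R (xs ! 0 # L (tl xs) (ev g)) (join (\<lambda>x. Or x (tl xs) (ev g)) (od g)))"
      using L(2) by (intro cdec_osubst[OF R(1)] crecl_cons crec_nth Lev) auto
    show "A (L ns f) (\<lambda>x. Or x ns f) \<longleftrightarrow> (\<exists>Z. \<forall>m. R (m # L ns f) (join (\<lambda>x. Or x ns f) Z))"
      if "length ns = k" for ns f
      by (rule R(2)[OF L(2)[OF that]])
  qed
qed

text \<open>By choice, witnesses for all \<open>n\<close> become the columns of one function; a
  stage \<open>s\<close> codes the pair of \<open>n\<close> and a stage for
  \<open>n\<close>.\<close>

lemma Sig_all [sig_intros]:
  assumes "Sig (Suc k) (\<lambda>xs f. A (xs ! 0) (tl xs) f)"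
  shows "Sig k (\<lambda>xs f. \<forall>n. A n xs f)"
proof -
  obtain R where R: "cdec (Suc (Suc k)) R"
    "\<And>ns f. length ns = Suc k \<Longrightarrow> A (ns ! 0) (tl ns) f \<longleftrightarrow> (\<exists>Z. \<forall>m. R (m # ns) (join f Z))"
    using assms unfolding Sig_def by blast
  show ?thesis
  proof (rule SigI[where P = "\<lambda>s ns f Z. R (psnd s # pfst s # ns) (join f (\<lambda>x. Z (prod_encode (pfst s, x))))"])
    show "cdec (Suc k) (\<lambda>xs g. R (psnd (xs ! 0) # pfst (xs ! 0) # tl xs)
        (join (ev g) (\<lambda>x. od g (prod_encode (pfst (xs ! 0), x)))))"
      by (rule cdec_osubst[OF R(1)] crec_intros | simp; fail)+
    fix ns f assume len: "length (ns :: nat list) = k"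
    have A: "A n ns f \<longleftrightarrow> (\<exists>Z. \<forall>m. R (m # n # ns) (join f Z))" for n
      using R(2)[of "n # ns" f] len by simp
    show "(\<forall>n. A n ns f) \<longleftrightarrow>
      (\<exists>Z. \<forall>s. R (psnd s # pfst s # ns) (join f (\<lambda>x. Z (prod_encode (pfst s, x)))))" (is "_ = ?rhs")
    proof
      assume "\<forall>n. A n ns f"
      then obtain Z where Z: "\<And>n m. R (m # n # ns) (join f (Z n))" using A by metis
      show ?rhs
        by (rule exI[of _ "\<lambda>u. Z (pfst u) (psnd u)"]) (simp add: Z)
    next
      assume ?rhs
      then obtain Z where Z: "\<And>s. R (psnd s # pfst s # ns) (join f (\<lambda>x. Z (prod_encode (pfst s, x))))"
        by blast
      have "R (m # n # ns) (join f (\<lambda>x. Z (prod_encode (n, x))))" for m n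
        using Z[of "prod_encode (n, m)"] by simp
      then show "\<forall>n. A n ns f" using A by blast
    qed
  qed
qed

lemma Sig_exf [sig_intros]:
  assumes "Sig k (\<lambda>xs g. A xs (ev g) (od g))"
  shows "Sig k (\<lambda>xs f. \<exists>W. A xs f W)"
proof -
  obtain R where R: "cdec (Suc k) R"
    "\<And>ns f. length ns = k \<Longrightarrow> A ns (ev f) (od f) \<longleftrightarrow> (\<exists>Z. \<forall>m. R (m # ns) (join f Z))"
    using assms unfolding Sig_def by blast
  show ?thesis
  proof (rule SigI[where P = "\<lambda>s ns f Z. R (s # ns) (join (join f (ev Z)) (od Z))"])
    show "cdec (Suc k) (\<lambda>xs g. R (xs ! 0 # tl xs) (join (join (ev g) (ev (od g))) (od (od g))))"
      by (rule cdec_osubst[OF R(1)] crec_intros | simp; fail)+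
    fix ns f assume len: "length (ns :: nat list) = k"
    have "A ns f W \<longleftrightarrow> (\<exists>Z. \<forall>m. R (m # ns) (join (join f W) Z))" for W
      using R(2)[OF len, of "join f W"] by simp
    then show "(\<exists>W. A ns f W) \<longleftrightarrow> (\<exists>Z. \<forall>s. R (s # ns) (join (join f (ev Z)) (od Z)))"
      by (metis ev_join od_join)
  qed
qed

lemma Sig_ex [sig_intros]:
  assumes "Sig (Suc k) (\<lambda>xs f. A (xs ! 0) (tl xs) f)"
  shows "Sig k (\<lambda>xs f. \<exists>n. A n xs f)"
proof -
  have "Sig k (\<lambda>xs f. A ((od f 0 # xs) ! 0) (tl (od f 0 # xs)) (ev f))"
    by (rule Sig_osubst[OF assms] crec_intros | simp; fail)+
  then have "Sig k (\<lambda>xs f. A (od f 0) xs (ev f))" by simp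
  then have "Sig k (\<lambda>xs f. \<exists>W :: nat \<Rightarrow> nat. A (W 0) xs f)" by (rule Sig_exf)
  moreover have "(\<exists>W :: nat \<Rightarrow> nat. A (W 0) xs f) \<longleftrightarrow> (\<exists>n. A n xs f)" for xs f
    using exI[of "\<lambda>W :: nat \<Rightarrow> nat. A (W 0) xs f" "\<lambda>_. n" for n] by auto
  ultimately show ?thesis by simp
qed

lemma Sig_conj [sig_intros]:
  assumes "Sig k A" "Sig k B" shows "Sig k (\<lambda>xs f. A xs f \<and> B xs f)"
proof -
  obtain R where R: "cdec (Suc k) R"
    "\<And>ns f. length ns = k \<Longrightarrow> A ns f \<longleftrightarrow> (\<exists>Z. \<forall>m. R (m # ns) (join f Z))"
    using assms(1) unfolding Sig_def by blast
  obtain S where S: "cdec (Suc k) S"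
    "\<And>ns f. length ns = k \<Longrightarrow> B ns f \<longleftrightarrow> (\<exists>Z. \<forall>m. S (m # ns) (join f Z))"
    using assms(2) unfolding Sig_def by blast
  show ?thesis
  proof (rule SigI[where P = "\<lambda>s ns f Z. R (s # ns) (join f (ev Z)) \<and> S (s # ns) (join f (od Z))"])
    show "cdec (Suc k) (\<lambda>xs g. R (xs ! 0 # tl xs) (join (ev g) (ev (od g))) \<and>
        S (xs ! 0 # tl xs) (join (ev g) (od (od g))))"
      by (rule cdec_conj cdec_osubst[OF R(1)] cdec_osubst[OF S(1)] crec_intros | simp; fail)+
    fix ns f assume len: "length (ns :: nat list) = k"
    show "A ns f \<and> B ns f \<longleftrightarrow>
      (\<exists>Z. \<forall>s. R (s # ns) (join f (ev Z)) \<and> S (s # ns) (join f (od Z)))"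
      unfolding R(2)[OF len] S(2)[OF len] by (metis ev_join od_join)
  qed
qed

text \<open>The value \<open>Z 0\<close> selects the disjunct, and the rest of \<open>Z\<close> is
  its witness.\<close>

lemma Sig_disj [sig_intros]:
  assumes "Sig k A" "Sig k B" shows "Sig k (\<lambda>xs f. A xs f \<or> B xs f)"
proof -
  obtain R where R: "cdec (Suc k) R"
    "\<And>ns f. length ns = k \<Longrightarrow> A ns f \<longleftrightarrow> (\<exists>Z. \<forall>m. R (m # ns) (join f Z))"
    using assms(1) unfolding Sig_def by blast
  obtain S where S: "cdec (Suc k) S"
    "\<And>ns f. length ns = k \<Longrightarrow> B ns f \<longleftrightarrow> (\<exists>Z. \<forall>m. S (m # ns) (join f Z))"
    using assms(2) unfolding Sig_def by blast
  show ?thesis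
  proof (rule SigI[where P = "\<lambda>s ns f Z. (Z 0 = 0 \<longrightarrow> R (s # ns) (join f (\<lambda>x. Z (Suc x)))) \<and>
      (Z 0 \<noteq> 0 \<longrightarrow> S (s # ns) (join f (\<lambda>x. Z (Suc x))))"])
    show "cdec (Suc k) (\<lambda>xs g. (od g 0 = 0 \<longrightarrow> R (xs ! 0 # tl xs) (join (ev g) (\<lambda>x. od g (Suc x)))) \<and>
        (od g 0 \<noteq> 0 \<longrightarrow> S (xs ! 0 # tl xs) (join (ev g) (\<lambda>x. od g (Suc x)))))"
      by (rule cdec_conj cdec_imp cdec_osubst[OF R(1)] cdec_osubst[OF S(1)] crec_intros | simp; fail)+
    fix ns f assume len: "length (ns :: nat list) = k"
    show "A ns f \<or> B ns f \<longleftrightarrow>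
      (\<exists>Z. \<forall>s. (Z 0 = 0 \<longrightarrow> R (s # ns) (join f (\<lambda>x. Z (Suc x)))) \<and>
      (Z 0 \<noteq> 0 \<longrightarrow> S (s # ns) (join f (\<lambda>x. Z (Suc x)))))" (is "_ = ?rhs")
    proof
      assume "A ns f \<or> B ns f"
      then show ?rhs
      proof
        assume "A ns f"
        then obtain Z where "\<forall>m. R (m # ns) (join f Z)" unfolding R(2)[OF len] by blast
        then show ?rhs by (intro exI[of _ "case_nat 0 Z"]) simp
      next
        assume "B ns f"
        then obtain Z where "\<forall>m. S (m # ns) (join f Z)" unfolding S(2)[OF len] by blast
        then show ?rhs by (intro exI[of _ "case_nat 1 Z"]) simp
      qed
    next
      assume ?rhs
      then show "A ns f \<or> B ns f" unfolding R(2)[OF len] S(2)[OF len] by metis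
    qed
  qed
qed

lemma Sig_imp [sig_intros]:
  "cdec k P \<Longrightarrow> Sig k A \<Longrightarrow> Sig k (\<lambda>xs f. P xs f \<longrightarrow> A xs f)"
  unfolding imp_conv_disj by (rule Sig_disj[OF Sig_cdec[OF cdec_not]])

section \<open>Measure on Cantor space\<close>

abbreviation lam :: "cantor set \<Rightarrow> real" where "lam \<equiv> measure cantor_measure"

definition om :: "cantor set \<Rightarrow> real" where "om A = enn2real (outer_measure_of cantor_measure A)"

interpretation cantor: product_prob_space "\<lambda>_ :: nat. measure_pmf (bernoulli_pmf (1 / 2))" UNIV
  by unfold_locales

lemma prob_space_cantor: "prob_space cantor_measure"
  unfolding cantor_measure_def by (rule cantor.P.prob_space_axioms)

interpretation lam: prob_space cantor_measure
  by (rule prob_space_cantor)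

lemma space_cantor [simp]: "space cantor_measure = UNIV"
  unfolding cantor_measure_def by (simp add: space_PiM)

lemma outer_measure_of_le_1: "outer_measure_of cantor_measure A \<le> 1"
  using outer_measure_of_mono[of A UNIV cantor_measure] lam.emeasure_space_1 sets.top[of cantor_measure]
  by simp

lemma ennreal_om: "ennreal (om A) = outer_measure_of cantor_measure A"
  unfolding om_def using outer_measure_of_le_1[of A]
  by (intro ennreal_enn2real) (auto intro: le_less_trans)

lemma om_mono: "A \<subseteq> B \<Longrightarrow> om A \<le> om B"
  using outer_measure_of_mono[of A B cantor_measure] outer_measure_of_le_1[of B]
  unfolding om_def by (intro enn2real_mono) (auto intro: le_less_trans)

lemma om_nonneg [simp]: "0 \<le> om A"
  by (simp add: om_def)

lemma om_eq: "A \<in> sets cantor_measure \<Longrightarrow> om A = lam A"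
  by (simp add: om_def measure_def)

text \<open>Through the envelope the traces of \<open>A\<close> on measurable sets are sized by a
  genuine measure, which gives additivity and limits.\<close>

lemma om_envelope:
  obtains E where "E \<in> sets cantor_measure" "A \<subseteq> E"
    "\<And>F. F \<in> sets cantor_measure \<Longrightarrow> lam (F \<inter> E) = om (F \<inter> A)"
proof -
  obtain E where E: "E \<in> sets cantor_measure" "A \<subseteq> E"
      "outer_measure_of cantor_measure A = emeasure cantor_measure E"
    using outer_measure_of_attain[of A cantor_measure] by auto
  then have "measurable_envelope cantor_measure A E"
    by (subst measurable_envelope_eq2) (auto simp: less_top[symmetric])
  then have "lam (F \<inter> E) = om (F \<inter> A)" if "F \<in> sets cantor_measure" for F
    using that unfolding measurable_envelope_def om_def measure_def by auto
  with that E show ?thesis by blast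
qed

lemma om_Un: "om (A \<union> B) \<le> om A + om B"
proof -
  obtain E where E: "E \<in> sets cantor_measure" "A \<subseteq> E"
    "\<And>F. F \<in> sets cantor_measure \<Longrightarrow> lam (F \<inter> E) = om (F \<inter> A)" using om_envelope[of A] by metis
  obtain D where D: "D \<in> sets cantor_measure" "B \<subseteq> D"
    "\<And>F. F \<in> sets cantor_measure \<Longrightarrow> lam (F \<inter> D) = om (F \<inter> B)" using om_envelope[of B] by metis
  have "om (A \<union> B) \<le> om (E \<union> D)" using E(2) D(2) by (intro om_mono) auto
  also have "\<dots> = lam (E \<union> D)" using E(1) D(1) by (intro om_eq) auto
  also have "\<dots> \<le> lam E + lam D" using E(1) D(1) by (intro measure_Un_le) auto
  finally show ?thesis using E(3)[of UNIV] D(3)[of UNIV] by (simp add: sets.top[of cantor_measure, simplified])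
qed

text \<open>Outer measure is continuous along increasing unions of arbitrary sets; inner regularity
  below depends on it.\<close>

lemma less_om_UN:
  assumes "incseq A" "0 \<le> q" "q < om (\<Union>n. A n)" shows "\<exists>n. q < om (A n :: cantor set)"
proof -
  have "ennreal q < outer_measure_of cantor_measure (\<Union>n. A n)"
    using assms(2,3) unfolding ennreal_om[symmetric] by (simp add: ennreal_lessI)
  then have "ennreal q < (SUP n. outer_measure_of cantor_measure (A n))"
    using assms(1) by (subst SUP_outer_measure_of_incseq) auto
  then obtain n where "ennreal q < outer_measure_of cantor_measure (A n)"
    by (auto simp: less_SUP_iff)
  then have "ennreal q < ennreal (om (A n))" by (simp add: ennreal_om)
  then have "q < om (A n)" using assms(2) by (simp add: ennreal_less_iff)
  then show ?thesis ..
qed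

section \<open>Cylinders and sets decided at a finite level\<close>

definition cyl :: "nat \<Rightarrow> cantor \<Rightarrow> cantor set" where
  "cyl k X = {Y. \<forall>i<k. Y i = X i}"

text \<open>The first \<open>k\<close> bits as a binary number, lowest bit first: strings of length
  \<open>k\<close> are the numbers below \<open>2 ^ k\<close>, and \<open>bit\<close> decodes
  them.\<close>

definition pre :: "nat \<Rightarrow> cantor \<Rightarrow> nat" where
  "pre k X = horner_sum of_bool 2 (map X [0..<k])"

lemma bit_pre: "bit (pre k X) i \<longleftrightarrow> i < k \<and> X i"
  by (auto simp: pre_def bit_horner_sum_bit_iff)

lemma pre_less: "pre k X < 2 ^ k"
  using horner_sum_of_bool_2_less[of "map X [0..<k]"] by (simp add: pre_def)

lemma pre_bit: "x < 2 ^ k \<Longrightarrow> pre k (bit x) = x"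
  unfolding pre_def horner_sum_bit_eq_take_bit by (simp add: take_bit_nat_eq_self)

lemma pre_eq_iff: "pre k X = pre k Y \<longleftrightarrow> (\<forall>i<k. X i = Y i)"
proof
  assume "pre k X = pre k Y"
  then have "bit (pre k X) i = bit (pre k Y) i" for i by simp
  then show "\<forall>i<k. X i = Y i" unfolding bit_pre by blast
next
  assume "\<forall>i<k. X i = Y i"
  then show "pre k X = pre k Y" unfolding pre_def by (intro arg_cong[of _ _ "horner_sum _ _"]) auto
qed

lemma cyl_eq_pre: "cyl k X = {Y. pre k Y = pre k X}"
  by (auto simp: cyl_def pre_eq_iff)

lemma open_cyl: "open (cyl k X)"
  using product_topology_basis'[of "{..<k}" "\<lambda>i. {X i}" "\<lambda>i. i"]
  by (simp add: cyl_def discrete_topology_class.open_discrete Ball_def)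

lemma self_in_cyl [simp]: "X \<in> cyl k X"
  by (simp add: cyl_def)

lemma open_contains_cyl:
  assumes "open U" "X \<in> U" obtains k where "cyl k X \<subseteq> U"
proof -
  have "openin (product_topology (\<lambda>i. euclidean) UNIV) U"
    using assms(1) unfolding open_fun_def .
  from product_topology_open_contains_basis[OF this assms(2)]
  obtain V where V: "X \<in> (\<Pi>\<^sub>E i\<in>UNIV. V i)" "finite {i. V i \<noteq> (UNIV :: bool set)}" "(\<Pi>\<^sub>E i\<in>UNIV. V i) \<subseteq> U"
    by auto
  obtain k where k: "\<And>i. V i \<noteq> UNIV \<Longrightarrow> i < k"
    using finite_nat_set_iff_bounded[THEN iffD1, OF V(2)] by auto
  have "cyl k X \<subseteq> U"
  proof
    fix Y assume Y: "Y \<in> cyl k X"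
    have "Y i \<in> V i" for i
    proof (cases "i < k")
      case True
      then have "Y i = X i" using Y by (simp add: cyl_def)
      then show ?thesis using V(1) by auto
    next
      case False
      then have "V i = UNIV" using k by blast
      then show ?thesis by simp
    qed
    then show "Y \<in> U" using V(3) by auto
  qed
  with that show ?thesis .
qed

lemma closed_iff_cyl: "closed F \<longleftrightarrow> (\<forall>X. X \<notin> F \<longrightarrow> (\<exists>k. cyl k X \<inter> F = {}))"
proof
  assume "closed F"
  then show "\<forall>X. X \<notin> F \<longrightarrow> (\<exists>k. cyl k X \<inter> F = {})"
    by (metis Compl_iff closed_def disjoint_eq_subset_Compl open_contains_cyl)
next
  assume *: "\<forall>X. X \<notin> F \<longrightarrow> (\<exists>k. cyl k X \<inter> F = {})"
  have "\<exists>T. open T \<and> X \<in> T \<and> T \<subseteq> - F" if X: "X \<in> - F" for X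
  proof -
    obtain k where "cyl k X \<inter> F = {}" using * X by auto
    then show ?thesis using open_cyl[of k X] by (intro exI[of _ "cyl k X"]) auto
  qed
  then show "closed F" unfolding closed_def by (subst open_subopen) auto
qed

lemma sets_closed: "closed F \<Longrightarrow> F \<in> sets cantor_measure"
  by (simp add: sets_cantor_measure)

lemma sets_open: "open F \<Longrightarrow> F \<in> sets cantor_measure"
  by (simp add: sets_cantor_measure)

lemma level_eq_UN: "{X. P (pre k X)} = (\<Union>x\<in>{x. x < 2 ^ k \<and> P x}. cyl k (bit x))"
  using pre_less[of k] by (auto simp: cyl_eq_pre pre_bit)

lemma sets_level: "{X. P (pre k X)} \<in> sets cantor_measure"
  by (subst level_eq_UN) (intro sets.finite_UN sets_open open_cyl; simp)

lemma lam_cyl: "lam (cyl k X) = 1 / 2 ^ k"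
proof -
  have "emeasure cantor_measure {Y\<in>space (Pi\<^sub>M UNIV (\<lambda>_::nat. measure_pmf (bernoulli_pmf (1 / 2)))). \<forall>i\<in>{..<k}. Y i \<in> {X i}}
      = (\<Prod>i\<in>{..<k}. emeasure (measure_pmf (bernoulli_pmf (1 / 2))) {X i})"
    unfolding cantor_measure_def by (rule cantor.emeasure_PiM_Collect) auto
  also have "\<dots> = (\<Prod>i\<in>{..<k}. ennreal (1 / 2))"
  proof (rule prod.cong)
    show "emeasure (measure_pmf (bernoulli_pmf (1 / 2))) {X i} = ennreal (1 / 2)" for i
      by (cases "X i") (simp_all add: emeasure_pmf_single)
  qed simp
  also have "\<dots> = ennreal (1 / 2 ^ k)"
    by (simp add: prod_ennreal power_one_over ennreal_power del: ennreal_half)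
  finally have "emeasure cantor_measure (cyl k X) = ennreal (1 / 2 ^ k)"
    by (simp add: cyl_def space_PiM Ball_def)
  then show ?thesis by (simp add: measure_def)
qed

lemma disjoint_cyl: "disjoint_family_on (\<lambda>x :: nat. cyl k (bit x)) {x. x < 2 ^ k \<and> P x}"
  by (auto simp: disjoint_family_on_def cyl_eq_pre pre_bit)

lemma lam_Int_level:
  assumes "E \<in> sets cantor_measure"
  shows "lam (E \<inter> {X. P (pre k X)}) = (\<Sum>x | x < 2 ^ k \<and> P x. lam (E \<inter> cyl k (bit x)))"
proof -
  have "E \<inter> cyl k X \<in> sets cantor_measure" for X
    by (intro sets.Int assms sets_open open_cyl)
  then have "lam (\<Union>x\<in>{x. x < 2 ^ k \<and> P x}. E \<inter> cyl k (bit x)) = (\<Sum>x | x < 2 ^ k \<and> P x. lam (E \<inter> cyl k (bit x)))"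
    using disjoint_cyl[of k P]
    by (intro lam.finite_measure_finite_Union) (auto simp: disjoint_family_on_def)
  then show ?thesis by (simp only: level_eq_UN[of P k] Int_UN_distrib)
qed

lemma lam_level: "lam {X. P (pre k X)} = card {x. x < 2 ^ k \<and> P x} / 2 ^ k"
  using lam_Int_level[of UNIV P k] by (simp add: lam_cyl sets.top[of cantor_measure, simplified])

lemma lam_INT_ge:
  assumes "decseq A" "\<And>i. A i \<in> sets cantor_measure" "\<And>i. q \<le> lam (A i)"
  shows "q \<le> lam (\<Inter>i. A i)"
proof -
  have "(\<lambda>i. lam (A i)) \<longlonglongrightarrow> lam (\<Inter>i. A i)"
    using assms(1,2) by (intro lam.finite_Lim_measure_decseq) auto
  then show ?thesis using assms(3) by (intro LIMSEQ_le_const) auto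
qed

text \<open>
  The part of \<open>A\<close> outside the following set has measure at most \<open>\<delta>\<close>: it is covered by the
  disjoint family of the maximal cylinders on which \<open>A\<close> has relative measure at most \<open>\<delta>\<close>.
\<close>

definition dense_core :: "real \<Rightarrow> cantor set \<Rightarrow> cantor set" where
  "dense_core \<delta> A = {X. \<forall>k. \<delta> / 2 ^ k < om (A \<inter> cyl k X)}"

lemma closed_dense_core: "closed (dense_core \<delta> A)"
  unfolding closed_iff_cyl
proof (intro allI impI)
  fix X assume "X \<notin> dense_core \<delta> A"
  then obtain k where k: "\<not> \<delta> / 2 ^ k < om (A \<inter> cyl k X)" by (auto simp: dense_core_def)
  have "Y \<notin> dense_core \<delta> A" if "Y \<in> cyl k X" for Y
  proof -
    have "cyl k Y = cyl k X" using that by (simp add: cyl_eq_pre)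
    then have "\<not> \<delta> / 2 ^ k < om (A \<inter> cyl k Y)" using k by simp
    then show ?thesis by (auto simp: dense_core_def)
  qed
  then show "\<exists>k. cyl k X \<inter> dense_core \<delta> A = {}" by blast
qed

lemma dense_core_mono: "A \<subseteq> B \<Longrightarrow> dense_core \<delta> A \<subseteq> dense_core \<delta> B"
  unfolding dense_core_def using om_mono[of "A \<inter> cyl k X" "B \<inter> cyl k X" for k X]
  by (blast intro: less_le_trans)

lemma om_Diff_dense_core:
  assumes "0 \<le> \<delta>" shows "om (A - dense_core \<delta> A) \<le> \<delta>"
proof -
  obtain E where E: "E \<in> sets cantor_measure" "A \<subseteq> E"
    "\<And>F. F \<in> sets cantor_measure \<Longrightarrow> lam (F \<inter> E) = om (F \<inter> A)" using om_envelope[of A] by metis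
  define bad where "bad k X \<longleftrightarrow> om (A \<inter> cyl k X) \<le> \<delta> / 2 ^ k" for k X
  \<comment> \<open>\<open>U k\<close> is the union of the maximal bad cylinders of level
    \<open>k\<close>: the points whose first bad level is \<open>k\<close>.\<close>
  define U where "U k = {X. bad k X \<and> (\<forall>j<k. \<not> bad j X)}" for k
  have bad_cong: "bad j X \<longleftrightarrow> bad j Y" if "pre k X = pre k Y" "j \<le> k" for j k X Y
  proof -
    have "pre j X = pre j Y" using that by (simp add: pre_eq_iff)
    then show ?thesis by (simp add: bad_def cyl_eq_pre)
  qed
  have U_eq: "U k = {X. bit (pre k X) \<in> U k}" for k
  proof -
    have "pre k X = pre k (bit (pre k X))" for X using pre_bit[OF pre_less] by simp
    then have "bad j X \<longleftrightarrow> bad j (bit (pre k X))" if "j \<le> k" for j X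
      using bad_cong that by blast
    then have "X \<in> U k \<longleftrightarrow> bit (pre k X) \<in> U k" for X
      unfolding U_def mem_Collect_eq by (metis less_imp_le_nat order_refl)
    then show ?thesis by blast
  qed
  have sU: "U k \<in> sets cantor_measure" for k
    by (subst U_eq) (rule sets_level)
  have disj: "disjoint_family U"
    unfolding disjoint_family_on_def U_def by (auto, metis linorder_neqE_nat)
  have le: "lam (E \<inter> U k) \<le> \<delta> * lam (U k)" for k
  proof -
    have "lam (E \<inter> U k) = (\<Sum>x :: nat | x < 2 ^ k \<and> bit x \<in> U k. lam (E \<inter> cyl k (bit x)))"
      by (subst U_eq) (rule lam_Int_level[OF E(1)])
    also have "\<dots> \<le> (\<Sum>x :: nat | x < 2 ^ k \<and> bit x \<in> U k. \<delta> / 2 ^ k)"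
    proof (rule sum_mono)
      fix x :: nat assume "x \<in> {x. x < 2 ^ k \<and> bit x \<in> U k}"
      then have "bad k (bit x)" by (simp add: U_def)
      moreover have "lam (E \<inter> cyl k (bit x)) = om (A \<inter> cyl k (bit x))"
        using E(3)[OF sets_open[OF open_cyl]] by (simp add: Int_commute)
      ultimately show "lam (E \<inter> cyl k (bit x)) \<le> \<delta> / 2 ^ k" by (simp add: bad_def)
    qed
    also have "\<dots> = \<delta> * lam (U k)" by (subst (2) U_eq, subst lam_level) simp
    finally show ?thesis .
  qed
  have "A - dense_core \<delta> A \<subseteq> E \<inter> (\<Union>k. U k)"
  proof
    fix X assume X: "X \<in> A - dense_core \<delta> A"
    then obtain k where "bad k X" by (auto simp: dense_core_def bad_def not_less)
    then have "bad (LEAST k. bad k X) X" "\<forall>j<(LEAST k. bad k X). \<not> bad j X"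
      by (auto intro: LeastI dest: not_less_Least)
    then have "X \<in> U (LEAST k. bad k X)" unfolding U_def by blast
    then show "X \<in> E \<inter> (\<Union>k. U k)" using X E(2) by blast
  qed
  then have "om (A - dense_core \<delta> A) \<le> om (E \<inter> (\<Union>k. U k))" by (rule om_mono)
  also have "\<dots> = lam (\<Union>k. E \<inter> U k)" using E(1) sU by (subst om_eq) auto
  also have "\<dots> \<le> \<delta> * lam (\<Union>k. U k)"
  proof (rule sums_le[OF le])
    show "(\<lambda>k. lam (E \<inter> U k)) sums lam (\<Union>k. E \<inter> U k)"
      using E(1) sU disj by (intro lam.finite_measure_UNION) (auto simp: disjoint_family_on_def)
    have "(\<lambda>k. lam (U k)) sums lam (\<Union>k. U k)"
      using sU disj by (intro lam.finite_measure_UNION) auto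
    then show "(\<lambda>k. \<delta> * lam (U k)) sums (\<delta> * lam (\<Union>k. U k))" by (rule sums_mult)
  qed
  also have "\<dots> \<le> \<delta>" using assms by (intro mult_left_le) auto
  finally show ?thesis .
qed

text \<open>The cylinders of level \<open>k\<close> meeting \<open>K\<close> form a clopen hull
  \<open>V k\<close>. On each of them the envelope of \<open>A\<close> has relative measure above
  \<open>\<delta>\<close>, and the hulls shrink to \<open>K\<close> because \<open>K\<close> is
  closed.\<close>

lemma dense_closed_meets:
  assumes K: "closed K" and \<delta>: "0 \<le> \<delta>" and sub: "K \<subseteq> dense_core \<delta> A"
  shows "\<delta> * lam K \<le> om (A \<inter> K)"
proof -
  obtain E where E: "E \<in> sets cantor_measure" "A \<subseteq> E"
    "\<And>F. F \<in> sets cantor_measure \<Longrightarrow> lam (F \<inter> E) = om (F \<inter> A)" using om_envelope[of A] by metis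
  define V where "V k = {X. pre k X \<in> pre k ` K}" for k
  have sV: "V k \<in> sets cantor_measure" for k unfolding V_def by (rule sets_level)
  have "decseq V"
    unfolding decseq_def V_def by (auto simp: pre_eq_iff image_iff)
  have KV: "K \<subseteq> V k" for k by (auto simp: V_def)
  have INT: "(\<Inter>k. V k) = K"
  proof
    show "(\<Inter>k. V k) \<subseteq> K"
    proof (rule ccontr)
      assume "\<not> ?thesis"
      then obtain X where X: "X \<in> (\<Inter>k. V k)" "X \<notin> K" by blast
      then obtain k where "cyl k X \<inter> K = {}" using K unfolding closed_iff_cyl by blast
      moreover have "X \<in> V k" using X by blast
      then obtain Y where "Y \<in> K" "pre k X = pre k Y" by (auto simp: V_def)
      ultimately show False by (auto simp: cyl_eq_pre)
    qed
  qed (use KV in blast)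
  have "\<delta> * lam K \<le> lam (\<Inter>k. E \<inter> V k)"
  proof (rule lam_INT_ge)
    show "decseq (\<lambda>k. E \<inter> V k)" using \<open>decseq V\<close> by (auto simp: decseq_def)
    show "E \<inter> V k \<in> sets cantor_measure" for k using E(1) sV by auto
    fix k
    have "\<delta> * lam K \<le> \<delta> * lam (V k)"
      using \<delta> KV sV by (intro mult_left_mono lam.finite_measure_mono) auto
    also have "\<dots> = (\<Sum>x | x < 2 ^ k \<and> x \<in> pre k ` K. \<delta> / 2 ^ k)"
      unfolding V_def by (subst lam_level) simp
    also have "\<dots> \<le> (\<Sum>x | x < 2 ^ k \<and> x \<in> pre k ` K. lam (E \<inter> cyl k (bit x)))"
    proof (rule sum_mono)
      fix x assume x: "x \<in> {x. x < 2 ^ k \<and> x \<in> pre k ` K}"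
      then obtain X where X: "X \<in> K" "x = pre k X" by blast
      have "pre k (bit x) = pre k X" using X(2) pre_bit[of x k] x by simp
      then have "cyl k (bit x) = cyl k X" by (simp add: cyl_eq_pre)
      moreover have "\<delta> / 2 ^ k < om (A \<inter> cyl k X)" using sub X(1) by (auto simp: dense_core_def)
      moreover have "lam (E \<inter> cyl k X) = om (A \<inter> cyl k X)"
        using E(3)[OF sets_open[OF open_cyl]] by (simp add: Int_commute)
      ultimately show "\<delta> / 2 ^ k \<le> lam (E \<inter> cyl k (bit x))" by simp
    qed
    also have "\<dots> = lam (E \<inter> V k)" unfolding V_def by (rule lam_Int_level[OF E(1), symmetric])
    finally show "\<delta> * lam K \<le> lam (E \<inter> V k)" .
  qed
  also have "(\<Inter>k. E \<inter> V k) = K \<inter> E" using INT by auto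
  also have "lam (K \<inter> E) = om (A \<inter> K)" using E(3)[OF sets_closed[OF K]] by (simp add: Int_commute)
  finally show ?thesis .
qed


section \<open>The outer measure of analytic sets\<close>

text \<open>A prefix is good if it extends to bounded attempts of all lengths. A good prefix has a
  good extension by one value, since only finitely many values are allowed; the good prefixes
  converge to \<open>Z\<close>.\<close>

lemma koenig:
  fixes \<Phi> :: "nat \<Rightarrow> (nat \<Rightarrow> nat) \<Rightarrow> bool"
  assumes ex: "\<And>s. \<exists>Z. (\<forall>i<s. Z i \<le> H i) \<and> \<Phi> s Z"
    and mono: "\<And>s t Z Z'. s \<le> t \<Longrightarrow> \<Phi> t Z \<Longrightarrow> (\<And>i. i < s \<Longrightarrow> Z' i = Z i) \<Longrightarrow> \<Phi> s Z'"
  shows "\<exists>Z. \<forall>s. \<Phi> s Z"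
proof -
  define good where "good n h \<longleftrightarrow>
    (\<forall>s\<ge>n. \<exists>Z. (\<forall>i<n. Z i = h i) \<and> (\<forall>i<s. Z i \<le> H i) \<and> \<Phi> s Z)" for n and h :: "nat \<Rightarrow> nat"
  have step: "\<exists>h'. good (Suc n) h' \<and> (\<forall>i<n. h' i = h i)" if g: "good n h" for n h
  proof (rule ccontr)
    assume no: "\<not> ?thesis"
    have "\<not> good (Suc n) (h(n := j))" for j using no by auto
    then obtain s where s: "\<And>j. Suc n \<le> s j"
      "\<And>j. \<not> (\<exists>Z. (\<forall>i<Suc n. Z i = (h(n := j)) i) \<and> (\<forall>i<s j. Z i \<le> H i) \<and> \<Phi> (s j) Z)"
      unfolding good_def by metis
    \<comment> \<open>A length beyond the failure stages of all candidates
      \<open>j \<le> H n\<close> at once.\<close>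
    define t where "t = Suc n + (\<Sum>j\<le>H n. s j)"
    have st: "s j \<le> t" if "j \<le> H n" for j
      using that member_le_sum[of j "{..H n}" s] by (auto simp: t_def)
    have "n \<le> t" by (simp add: t_def)
    then obtain Z where Z: "\<forall>i<n. Z i = h i" "\<forall>i<t. Z i \<le> H i" "\<Phi> t Z"
      using g unfolding good_def by blast
    have le: "Z n \<le> H n" using Z(2) by (simp add: t_def)
    have "\<Phi> (s (Z n)) Z" using mono[OF st[OF le] Z(3)] by simp
    moreover have "\<forall>i<s (Z n). Z i \<le> H i" using Z(2) st[OF le] by simp
    moreover have "\<forall>i<Suc n. Z i = (h(n := Z n)) i" using Z(1) by (simp add: less_Suc_eq)
    ultimately show False using s(2)[of "Z n"] by blast
  qed
  have "\<exists>f. \<forall>n. good n (f n) \<and> (\<forall>i<n. f (Suc n) i = f n i)"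
  proof (rule dependent_nat_choice)
    show "\<exists>h. good 0 h" using ex by (auto simp: good_def)
  qed (use step in blast)
  then obtain h where h: "\<And>n. good n (h n)" "\<And>n i. i < n \<Longrightarrow> h (Suc n) i = h n i" by blast
  define Z where "Z i = h (Suc i) i" for i
  have "h n i = Z i" if "i < n" for n i
    using that by (induction n) (auto simp: Z_def less_Suc_eq h(2))
  then have "\<Phi> s Z" for s
    using h(1)[of s] mono[of s s _ Z] unfolding good_def by (metis order_refl)
  then show ?thesis by blast
qed

text \<open>The witness is bounded one value at a time: by continuity from below some bound for the
  next value keeps the outer measure above \<open>q\<close>. At stage \<open>s\<close> only the
  first \<open>s\<close> bounds matter, so the diagonal \<open>H\<close> serves all stages.\<close>

lemma om_inner_regular:
  fixes \<Phi> :: "nat \<Rightarrow> cantor \<Rightarrow> (nat \<Rightarrow> nat) \<Rightarrow> bool"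
  assumes q: "0 \<le> q" "q < om {X. \<exists>Z. \<forall>s. \<Phi> s X Z}"
  shows "\<exists>H. \<forall>s. q < om {X. \<exists>Z. (\<forall>i<s. Z i \<le> H i) \<and> \<Phi> s X Z}"
proof -
  define B where "B n h = {X. \<exists>Z. (\<forall>i<n. Z i \<le> h i) \<and> (\<forall>s. \<Phi> s X Z)}" for n and h :: "nat \<Rightarrow> nat"
  have step: "\<exists>h'. q < om (B (Suc n) h') \<and> (\<forall>i<n. h' i = h i)" if g: "q < om (B n h)" for n h
  proof -
    have "B n h = (\<Union>j. B (Suc n) (h(n := j)))"
      unfolding B_def by (auto simp: less_Suc_eq)
    moreover have "incseq (\<lambda>j. B (Suc n) (h(n := j)))"
    proof (rule incseq_SucI)
      fix j
      have "(h(n := j)) i \<le> (h(n := Suc j)) i" for i by simp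
      then show "B (Suc n) (h(n := j)) \<subseteq> B (Suc n) (h(n := Suc j))"
        unfolding B_def by (blast intro: order_trans)
    qed
    ultimately obtain j where "q < om (B (Suc n) (h(n := j)))"
      using less_om_UN[of "\<lambda>j. B (Suc n) (h(n := j))" q] q(1) g by metis
    then show ?thesis by (intro exI[of _ "h(n := j)"]) auto
  qed
  have "\<exists>f. \<forall>n. q < om (B n (f n)) \<and> (\<forall>i<n. f (Suc n) i = f n i)"
  proof (rule dependent_nat_choice)
    show "\<exists>h. q < om (B 0 h)" using q by (auto simp: B_def)
  qed (use step in blast)
  then obtain h where h: "\<And>n. q < om (B n (h n))" "\<And>n i. i < n \<Longrightarrow> h (Suc n) i = h n i" by blast
  define H where "H i = h (Suc i) i" for i
  have hH: "h n i = H i" if "i < n" for n i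
    using that by (induction n) (auto simp: H_def less_Suc_eq h(2))
  have "q < om {X. \<exists>Z. (\<forall>i<s. Z i \<le> H i) \<and> \<Phi> s X Z}" for s
  proof -
    have "B s (h s) \<subseteq> {X. \<exists>Z. (\<forall>i<s. Z i \<le> H i) \<and> \<Phi> s X Z}"
      unfolding B_def using hH by auto
    then show ?thesis using h(1)[of s] om_mono by (meson less_le_trans)
  qed
  then show ?thesis by blast
qed

text \<open>Passing to the limit over all levels weakens a strict inequality; a slightly larger
  fraction compensates for this.\<close>

lemma ex_fraction_between:
  assumes "b \<noteq> 0" "real a / real b < w"
  shows "\<exists>a' b'. b' \<noteq> 0 \<and> a * b' < a' * b \<and> real a' / real b' < w"
proof -
  obtain N where N: "N \<noteq> 0" "1 / real N < w - real a / real b"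
    using reals_Archimedean[of "w - real a / real b"] assms(2)
    by (metis diff_gt_0_iff_gt inverse_eq_divide nat.distinct(1))
  let ?a = "a * N + 1" let ?b = "b * N"
  have "real ?a / real ?b = real a / real b + 1 / (real b * real N)"
    using assms(1) N(1) by (simp add: field_simps)
  also have "1 / (real b * real N) \<le> 1 / real N"
    using assms(1) N(1) by (simp add: field_simps)
  finally have "real ?a / real ?b < w" using N(2) by linarith
  moreover have "a * ?b < ?a * b" using assms(1) by simp
  ultimately show ?thesis using assms(1) N(1) by (intro exI[of _ ?a] exI[of _ ?b]) auto
qed

text \<open>Left to right is inner regularity. Right to left, the level sets decrease, so their
  intersection keeps the bound, and \<open>koenig\<close> turns a point of the intersection into one
  with a full witness.\<close>

lemma less_om_iff_count:
  fixes \<Phi> :: "nat \<Rightarrow> cantor \<Rightarrow> (nat \<Rightarrow> nat) \<Rightarrow> bool"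
  assumes mono: "\<And>s t X X' Z Z'. s \<le> t \<Longrightarrow> \<Phi> t X Z \<Longrightarrow> (\<And>i. i < s \<Longrightarrow> X' i = X i) \<Longrightarrow>
      (\<And>i. i < s \<Longrightarrow> Z' i = Z i) \<Longrightarrow> \<Phi> s X' Z'"
    and b: "b \<noteq> 0"
  shows "real a / real b < om {X. \<exists>Z. \<forall>s. \<Phi> s X Z} \<longleftrightarrow>
    (\<exists>a' b'. b' \<noteq> 0 \<and> a * b' < a' * b \<and> (\<exists>H V. \<forall>s. a' * 2 ^ s \<le>
        b' * card {x :: nat. x < 2 ^ s \<and> (\<exists>z\<le>V s. (\<forall>i<s. ent z i \<le> H i) \<and> \<Phi> s (bit x) (ent z))}))"
proof -
  define D where "D H s = {X. \<exists>Z. (\<forall>i<s. Z i \<le> H i) \<and> \<Phi> s X Z}" for H s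
  define C where "C H s = {x :: nat. x < 2 ^ s \<and> bit x \<in> D H s}" for H :: "nat \<Rightarrow> nat" and s
  have cong: "\<Phi> s X Z \<longleftrightarrow> \<Phi> s X' Z'" if "\<And>i. i < s \<Longrightarrow> X' i = X i" "\<And>i. i < s \<Longrightarrow> Z' i = Z i" for s X X' Z Z'
    using mono[of s s X Z X' Z'] mono[of s s X' Z' X Z] that by auto
  have D_eq: "D H s = {X. bit (pre s X) \<in> D H s}" for H s
  proof -
    have "\<Phi> s X Z \<longleftrightarrow> \<Phi> s (bit (pre s X)) Z" for X Z
      by (rule cong) (simp_all add: bit_pre)
    then show ?thesis unfolding D_def by auto
  qed
  have sD: "D H s \<in> sets cantor_measure" for H s by (subst D_eq) (rule sets_level)
  have lamD: "lam (D H s) = card (C H s) / 2 ^ s" for H s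
    unfolding C_def by (subst D_eq) (rule lam_level)
  have decD: "decseq (D H)" for H
    unfolding decseq_def D_def
  proof (intro allI impI subsetI CollectI; elim CollectE exE conjE)
    fix s t X Z assume "s \<le> t" "\<forall>i<t. Z i \<le> H i" "\<Phi> t X Z"
    then show "\<exists>Z. (\<forall>i<s. Z i \<le> H i) \<and> \<Phi> s X Z"
      using mono[of s t X Z X Z] by (intro exI[of _ Z]) auto
  qed
  have INT_D: "(\<Inter>s. D H s) \<subseteq> {X. \<exists>Z. \<forall>s. \<Phi> s X Z}" for H
  proof
    fix X assume "X \<in> (\<Inter>s. D H s)"
    then have "\<And>s. \<exists>Z. (\<forall>i<s. Z i \<le> H i) \<and> \<Phi> s X Z" by (auto simp: D_def)
    then show "X \<in> {X. \<exists>Z. \<forall>s. \<Phi> s X Z}"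
      using koenig[of H "\<lambda>s. \<Phi> s X"] mono by auto
  qed
  let ?E = "\<lambda>H V s. {x :: nat. x < 2 ^ s \<and> (\<exists>z\<le>V s. (\<forall>i<s. ent z i \<le> H i) \<and> \<Phi> s (bit x) (ent z))}"
  have fin: "finite (C H s)" for H s by (rule finite_subset[of _ "{..<2 ^ s}"]) (auto simp: C_def)
  have E_sub: "?E H V s \<subseteq> C H s" for H V s by (auto simp: C_def D_def)
  \<comment> \<open>Level \<open>s\<close> involves finitely many strings, so codes of finite
    witnesses for them have a common bound \<open>V s\<close>; this bound makes the count
    decidable.\<close>
  have ex_V: "\<exists>V. \<forall>s. ?E H V s = C H s" for H
  proof -
    have "\<exists>v. \<forall>x\<in>C H s. \<exists>z\<le>v. (\<forall>i<s. ent z i \<le> H i) \<and> \<Phi> s (bit x) (ent z)" for s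
    proof -
      have "\<exists>z. (\<forall>i<s. ent z i \<le> H i) \<and> \<Phi> s (bit x) (ent z)" if x: "x \<in> C H s" for x
      proof -
        obtain Z where Z: "\<forall>i<s. Z i \<le> H i" "\<Phi> s (bit x) Z" using x by (auto simp: C_def D_def)
        obtain z where z: "\<forall>i<s. ent z i = Z i" using ex_ent by blast
        show ?thesis using z Z cong[of s "bit x" "bit x" "ent z" Z] by (intro exI[of _ z]) auto
      qed
      then obtain z where z: "\<And>x. x \<in> C H s \<Longrightarrow> (\<forall>i<s. ent (z x) i \<le> H i) \<and> \<Phi> s (bit x) (ent (z x))"
        by metis
      have "z x \<le> (\<Sum>x\<in>C H s. z x)" if "x \<in> C H s" for x
        using that member_le_sum[OF that _ fin, of z] by simp
      with z show ?thesis by blast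
    qed
    then obtain V where V: "\<And>s. \<forall>x\<in>C H s. \<exists>z\<le>V s. (\<forall>i<s. ent z i \<le> H i) \<and> \<Phi> s (bit x) (ent z)"
      by metis
    have "?E H V s = C H s" for s
      using E_sub[of s V H] V[of s] by (auto simp: C_def)
    then show ?thesis by blast
  qed
  have le_iff: "real a' / real b' \<le> lam (D H s) \<longleftrightarrow> a' * 2 ^ s \<le> b' * card (C H s)" if "b' \<noteq> 0" for a' b' H s
  proof -
    have "real a' / real b' \<le> real (card (C H s)) / 2 ^ s \<longleftrightarrow> real (a' * 2 ^ s) \<le> real (b' * card (C H s))"
      using that by (simp add: field_simps)
    then show ?thesis unfolding lamD of_nat_le_iff .
  qed
  show ?thesis
  proof
    assume "real a / real b < om {X. \<exists>Z. \<forall>s. \<Phi> s X Z}"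
    from ex_fraction_between[OF b this]
    obtain a' b' where ab: "b' \<noteq> 0" "a * b' < a' * b" "real a' / real b' < om {X. \<exists>Z. \<forall>s. \<Phi> s X Z}"
      by blast
    from om_inner_regular[OF _ ab(3)]
    obtain H where H: "\<And>s. real a' / real b' < om (D H s)" unfolding D_def by auto
    obtain V where V: "\<And>s. ?E H V s = C H s" using ex_V by blast
    have "a' * 2 ^ s \<le> b' * card (?E H V s)" for s
      unfolding V using H[of s] le_iff[OF ab(1), of a' H s] om_eq[OF sD] by simp
    then show "\<exists>a' b'. b' \<noteq> 0 \<and> a * b' < a' * b \<and> (\<exists>H V. \<forall>s. a' * 2 ^ s \<le> b' * card (?E H V s))"
      using ab(1,2) by blast
  next
    assume "\<exists>a' b'. b' \<noteq> 0 \<and> a * b' < a' * b \<and> (\<exists>H V. \<forall>s. a' * 2 ^ s \<le> b' * card (?E H V s))"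
    then obtain a' b' H V where ab: "b' \<noteq> 0" "a * b' < a' * b"
      and le: "\<And>s. a' * 2 ^ s \<le> b' * card (?E H V s)" by blast
    have "real a / real b < real a' / real b'"
    proof -
      have "real (a * b') < real (a' * b)" using ab(2) by (simp only: of_nat_less_iff)
      then show ?thesis using ab(1) b by (simp add: field_simps)
    qed
    also have "real a' / real b' \<le> lam (\<Inter>s. D H s)"
    proof (rule lam_INT_ge)
      show "decseq (D H)" by (rule decD)
      show "D H s \<in> sets cantor_measure" for s by (rule sD)
      fix s
      have "a' * 2 ^ s \<le> b' * card (C H s)"
        using le[of s] card_mono[OF fin E_sub[of s V H]] by (meson le_trans mult_le_mono2)
      then show "real a' / real b' \<le> lam (D H s)" using le_iff[OF ab(1)] by blast
    qed
    also have "\<dots> = om (\<Inter>s. D H s)" using sD by (intro om_eq[symmetric]) auto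
    also have "\<dots> \<le> om {X. \<exists>Z. \<forall>s. \<Phi> s X Z}" by (rule om_mono[OF INT_D])
    finally show "real a / real b < om {X. \<exists>Z. \<forall>s. \<Phi> s X Z}" .
  qed
qed

lemma cdec_bit [crec_intros]:
  assumes "crec k A" "crec k B" shows "cdec k (\<lambda>xs f. bit (A xs f) (B xs f))"
proof -
  have "cdec k (\<lambda>xs f. A xs f div 2 ^ B xs f mod 2 \<noteq> 0)" by (intro crec_intros assms)
  then show ?thesis by (simp add: bit_iff_odd even_iff_mod_2_eq_zero)
qed

lemma crec_card [crec_intros]:
  assumes "cdec (Suc k) (\<lambda>xs f. P (xs ! 0) (tl xs) f)" "crec k N"
  shows "crec k (\<lambda>xs f. card {x. x < N xs f \<and> P x xs f})"
  unfolding sum_if_eq_card[symmetric] by (intro crec_sum crec_if assms crec_const)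

text \<open>In the counting criterion existential number and function quantifiers and one universal
  number quantifier precede a decidable matrix.\<close>

lemma Sig_less_om:
  assumes A: "Sig k (\<lambda>xs g. A xs (ev g) (tb (od g)))"
    and a: "crec k a" and b: "crec k b" and b0: "\<And>xs f. b xs f \<noteq> 0"
  shows "Sig k (\<lambda>xs f. real (a xs f) / real (b xs f) < om {X. A xs f X})"
proof -
  obtain p where p: "\<And>ns g. length ns = k \<Longrightarrow> A ns (ev g) (tb (od g)) \<longleftrightarrow> (\<exists>Z. \<forall>s. nf p s ns (join g Z))"
    using Sig_nf[OF A] by blast
  define \<Phi> where "\<Phi> ns f s X Z = nf p s ns (join (join f (char_fun X)) Z)" for ns f s X Z
  have mono: "\<Phi> ns f s X' Z'" if "s \<le> t" "\<Phi> ns f t X Z" "\<And>i. i < s \<Longrightarrow> X' i = X i" "\<And>i. i < s \<Longrightarrow> Z' i = Z i"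
    for ns f s t X X' Z Z'
    unfolding \<Phi>_def
  proof (rule nf_mono[OF that(2)[unfolded \<Phi>_def] that(1)])
    fix x assume "x < s"
    then have "x div 2 < s" "x div 2 div 2 < s" by auto
    then show "join (join f (char_fun X')) Z' x = join (join f (char_fun X)) Z x"
      using that(3,4) by (simp add: join_def char_fun_def)
  qed
  have eq: "(real (a xs f) / real (b xs f) < om {X. A xs f X}) \<longleftrightarrow>
    (\<exists>a' b'. b' \<noteq> 0 \<and> a xs f * b' < a' * b xs f \<and> (\<exists>H V. \<forall>s. a' * 2 ^ s \<le>
        b' * card {x :: nat. x < 2 ^ s \<and> (\<exists>z\<le>V s. (\<forall>i<s. ent z i \<le> H i) \<and>
          nf p s xs (join (join f (char_fun (bit x))) (ent z)))}))"
    if "length xs = k" for xs f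
  proof -
    have "{X. A xs f X} = {X. \<exists>Z. \<forall>s. \<Phi> xs f s X Z}"
      using p[OF that, of "join f (char_fun X)" for X] by (simp add: \<Phi>_def)
    then show ?thesis using less_om_iff_count[of "\<Phi> xs f" "b xs f" "a xs f", OF mono b0] unfolding \<Phi>_def by simp
  qed
  have ab: "crec (Suc (Suc k)) (\<lambda>xs f. a (tl (tl xs)) f)" "crec (Suc (Suc k)) (\<lambda>xs f. b (tl (tl xs)) f)"
    by (intro crec_tl a b)+
  have "Sig k (\<lambda>xs f. \<exists>a' b'. b' \<noteq> 0 \<and> a xs f * b' < a' * b xs f \<and> (\<exists>H V. \<forall>s. a' * 2 ^ s \<le>
        b' * card {x :: nat. x < 2 ^ s \<and> (\<exists>z\<le>V s. (\<forall>i<s. ent z i \<le> H i) \<and>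
          nf p s xs (join (join f (char_fun (bit x))) (ent z)))}))"
    by (rule ab sig_intros crec_intros Sig_cdec | simp; fail)+
  then show ?thesis using eq by (subst Sig_cong) auto
qed

section \<open>Comparison of ranks\<close>

text \<open>
  \<open>Sim e l a n\<close> says that the rank of \<open>a\<close> in \<open>e\<close> is at most that of \<open>n\<close> in \<open>l\<close>, ill-founded
  elements having rank \<open>\<infinity>\<close>; \<open>Opp\<close> is a winning strategy for the opponent in the
  corresponding game, and covers all cases where \<open>Sim\<close> fails.
\<close>

definition Sim :: "(nat \<Rightarrow> nat \<Rightarrow> bool) \<Rightarrow> (nat \<Rightarrow> nat \<Rightarrow> bool) \<Rightarrow> nat \<Rightarrow> nat \<Rightarrow> bool" where
  "Sim e l a n \<longleftrightarrow> (\<exists>Q. Q a n \<and> (\<forall>b m b'. Q b m \<and> e b' b \<longrightarrow> (\<exists>m'. l m' m \<and> Q b' m')))"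

definition Opp :: "(nat \<Rightarrow> nat \<Rightarrow> bool) \<Rightarrow> (nat \<Rightarrow> nat \<Rightarrow> bool) \<Rightarrow> nat \<Rightarrow> nat \<Rightarrow> bool" where
  "Opp e l a n \<longleftrightarrow> (\<exists>Q. Q a n \<and> (\<forall>b m. Q b m \<longrightarrow> (\<exists>b'. e b' b \<and> (\<forall>m'. l m' m \<longrightarrow> Q b' m'))))"

lemma SimI:
  "Q a n \<Longrightarrow> (\<And>b m b'. Q b m \<Longrightarrow> e b' b \<Longrightarrow> \<exists>m'. l m' m \<and> Q b' m') \<Longrightarrow> Sim e l a n"
  unfolding Sim_def by blast

lemma Sim_step: "Sim e l a n \<Longrightarrow> e b a \<Longrightarrow> \<exists>m. l m n \<and> Sim e l b m"
proof -
  assume "Sim e l a n" "e b a"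
  then obtain Q m where Q: "\<forall>b m b'. Q b m \<and> e b' b \<longrightarrow> (\<exists>m'. l m' m \<and> Q b' m')" and m: "l m n" "Q b m"
    unfolding Sim_def by blast
  have "Sim e l b m" unfolding Sim_def using Q m(2) by (intro exI[of _ Q] conjI)
  with m(1) show ?thesis by blast
qed

text \<open>\<open>Sim\<close> is a greatest fixed point: the pair in question may be added to a
  simulation once all its moves are answered.\<close>

lemma Sim_iff: "Sim e l a n \<longleftrightarrow> (\<forall>b. e b a \<longrightarrow> (\<exists>m. l m n \<and> Sim e l b m))"
proof
  show "\<forall>b. e b a \<longrightarrow> (\<exists>m. l m n \<and> Sim e l b m)" if "Sim e l a n"
    using Sim_step[of e l a n] that by blast
next
  assume *: "\<forall>b. e b a \<longrightarrow> (\<exists>m. l m n \<and> Sim e l b m)"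
  show "Sim e l a n"
  proof (rule SimI[of "\<lambda>b m. Sim e l b m \<or> b = a \<and> m = n"])
    fix b m b' assume "Sim e l b m \<or> b = a \<and> m = n" "e b' b"
    then have "\<exists>m'. l m' m \<and> Sim e l b' m'"
      using Sim_step[of e l b m b'] * by blast
    then show "\<exists>m'. l m' m \<and> (Sim e l b' m' \<or> b' = a \<and> m' = n)" by blast
  qed simp
qed

lemma Opp_step: "Opp e l a n \<Longrightarrow> \<exists>b. e b a \<and> (\<forall>m. l m n \<longrightarrow> Opp e l b m)"
proof -
  assume "Opp e l a n"
  then obtain Q b where Q: "\<forall>b m. Q b m \<longrightarrow> (\<exists>b'. e b' b \<and> (\<forall>m'. l m' m \<longrightarrow> Q b' m'))"
    and b: "e b a" "\<forall>m. l m n \<longrightarrow> Q b m"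
    unfolding Opp_def by blast
  have "Opp e l b m" if "l m n" for m
    unfolding Opp_def using Q b(2) that by (intro exI[of _ Q] conjI) blast+
  with b(1) show ?thesis by blast
qed

text \<open>Unfolding a failure of \<open>Sim\<close> yields a move after which every answer fails
  again, so the failures themselves form a strategy.\<close>

lemma Opp_if_not_Sim: "\<not> Sim e l a n \<Longrightarrow> Opp e l a n"
  unfolding Opp_def
proof (intro exI[of _ "\<lambda>b m. \<not> Sim e l b m"] conjI allI impI)
  show "\<exists>b'. e b' b \<and> (\<forall>m'. l m' m \<longrightarrow> \<not> Sim e l b' m')" if "\<not> Sim e l b m" for b m
    using that Sim_iff[of e l b m] by blast
qed

lemma not_accp_step: "\<not> Wellfounded.accp l n \<Longrightarrow> \<exists>m. l m n \<and> \<not> Wellfounded.accp l m"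
  using accp.accI by metis

text \<open>Staying among the ill-founded elements, one can answer moves forever.\<close>

lemma Sim_if_not_accp: "\<not> Wellfounded.accp l n \<Longrightarrow> Sim e l a n"
  using not_accp_step[of l] by (intro SimI[of "\<lambda>_ m. \<not> Wellfounded.accp l m"]) auto

lemma accp_if_Sim:
  assumes "Wellfounded.accp l n" "Sim e l a n" shows "Wellfounded.accp e a"
  using assms
proof (induction n arbitrary: a rule: accp.induct)
  case (accI n)
  show ?case
  proof (rule accp.accI)
    fix b assume "e b a"
    then obtain m where "l m n" "Sim e l b m" using accI.prems Sim_iff[of e l a n] by blast
    then show "Wellfounded.accp e b" using accI.IH by blast
  qed
qed

lemma not_accp_iff_chain:
  "\<not> Wellfounded.accp l n \<longleftrightarrow> (\<exists>Z :: nat \<Rightarrow> 'a. Z 0 = n \<and> (\<forall>i. l (Z (Suc i)) (Z i)))"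
proof
  assume n: "\<not> Wellfounded.accp l n"
  obtain g where g: "\<And>x. \<not> Wellfounded.accp l x \<Longrightarrow> l (g x) x \<and> \<not> Wellfounded.accp l (g x)"
    using not_accp_step[of l] by metis
  have "\<not> Wellfounded.accp l ((g ^^ i) n)" for i by (induction i) (use n g in auto)
  then show "\<exists>Z :: nat \<Rightarrow> 'a. Z 0 = n \<and> (\<forall>i. l (Z (Suc i)) (Z i))"
    using g by (intro exI[of _ "\<lambda>i. (g ^^ i) n"]) auto
next
  assume "\<exists>Z :: nat \<Rightarrow> 'a. Z 0 = n \<and> (\<forall>i. l (Z (Suc i)) (Z i))"
  then obtain Z where Z: "Z 0 = n" "\<And>i. l (Z (Suc i)) (Z i)" by blast
  have "\<forall>i. Z i \<noteq> x" if "Wellfounded.accp l x" for x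
    using that by (induction rule: accp.induct) (use Z(2) in metis)
  then show "\<not> Wellfounded.accp l n" using Z(1) by blast
qed

section \<open>Comparability and least ranks\<close>

lemma Sim_trans: "Sim e l a n \<Longrightarrow> Sim l k n x \<Longrightarrow> Sim e k a x"
proof (rule SimI[of "\<lambda>b y. \<exists>m. Sim e l b m \<and> Sim l k m y"])
  fix b y b' assume *: "\<exists>m. Sim e l b m \<and> Sim l k m y" "e b' b"
  then obtain m where "Sim e l b m" "Sim l k m y" by blast
  then obtain m' y' where "l m' m" "Sim e l b' m'" "k y' y" "Sim l k m' y'"
    using *(2) Sim_iff[of e l b m] Sim_iff[of l k m y] by blast
  then show "\<exists>y'. k y' y \<and> (\<exists>m. Sim e l b' m \<and> Sim l k m y')" by blast
qed blast

text \<open>Comparability of ranks: a rank below that of \<open>a\<close> is at most the rank of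
  some element below \<open>a\<close>. The induction applies the claim to the unanswerable move
  \<open>b\<close>.\<close>

lemma Sim_linear:
  assumes "Wellfounded.accp e a" "\<not> Sim e l a n" shows "\<exists>b. e b a \<and> Sim l e n b"
  using assms
proof (induction a arbitrary: n rule: accp.induct)
  case (accI a)
  obtain b where b: "e b a" "\<forall>m. l m n \<longrightarrow> \<not> Sim e l b m"
    using accI.prems Sim_iff[of e l a n] by blast
  have "\<exists>c. e c b \<and> Sim l e m c" if "l m n" for m
    using accI.IH[OF b(1)] b(2) that by blast
  then have "Sim l e n b" unfolding Sim_iff[of l e n b] by blast
  with b(1) show ?case by blast
qed

lemma not_Sim_below: "Wellfounded.accp e a \<Longrightarrow> e b a \<Longrightarrow> \<not> Sim e e a b"
proof (induction a arbitrary: b rule: accp.induct)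
  case (accI a)
  show ?case
  proof
    assume "Sim e e a b"
    then obtain c where "e c b" "Sim e e b c"
      using accI.prems Sim_iff[of e e a b] by blast
    then show False using accI.IH[OF accI.prems] by blast
  qed
qed

text \<open>The first index of least rank at the root \<open>0\<close>, written with positive
  occurrences of \<open>Sim\<close> only and hence analytic: strict inequality with an earlier tree
  is comparison with an element below its root.\<close>

definition min_rank :: "(nat \<Rightarrow> nat \<Rightarrow> nat \<Rightarrow> bool) \<Rightarrow> nat \<Rightarrow> bool" where
  "min_rank T s \<longleftrightarrow> (\<forall>s'. Sim (T s) (T s') 0 0) \<and> (\<forall>s'<s. \<exists>m. T s' m 0 \<and> Sim (T s) (T s') 0 m)"

lemma accp_if_min_rank:
  "Wellfounded.accp (T s) 0 \<Longrightarrow> min_rank T s' \<Longrightarrow> Wellfounded.accp (T s') 0"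
  unfolding min_rank_def using accp_if_Sim by blast

lemma ex_min_rank:
  assumes "Wellfounded.accp (T s) 0" shows "\<exists>s. min_rank T s"
proof -
  \<comment> \<open>Induction on a rank bound \<open>a\<close> for \<open>T s\<close>: if
    \<open>T s\<close> is not least, some other tree has rank at most that of an element below the
    root of \<open>T s\<close>, and is therefore bounded by an element below
    \<open>a\<close>.\<close>
  have "\<exists>s'. \<forall>s''. Sim (T s') (T s'') 0 0"
    if "Wellfounded.accp (T t) a" "Sim (T s) (T t) 0 a" for s t a
    using that
  proof (induction a arbitrary: s rule: accp.induct)
    case (accI a)
    show ?case
    proof (rule ccontr)
      assume no: "\<not> ?thesis"
      then obtain s' where s': "\<not> Sim (T s) (T s') 0 0" by blast
      have "Wellfounded.accp (T t) a" using accI.hyps by (rule accp.accI)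
      then have "Wellfounded.accp (T s) 0" using accp_if_Sim accI.prems by blast
      from Sim_linear[OF this s'] obtain b where b: "T s b 0" "Sim (T s') (T s) 0 b" by blast
      obtain m where m: "T t m a" "Sim (T s) (T t) b m"
        using accI.prems b(1) Sim_iff[of "T s" "T t" 0 a] by blast
      show False using accI.IH[OF m(1) Sim_trans[OF b(2) m(2)]] no by blast
    qed
  qed
  moreover have "Sim (T s) (T s) 0 0" by (rule SimI[of "(=)"]) auto
  ultimately have ex: "\<exists>s'. \<forall>s''. Sim (T s') (T s'') 0 0" using assms by blast
  define s0 where "s0 = (LEAST s'. \<forall>s''. Sim (T s') (T s'') 0 0)"
  have s0: "Sim (T s0) (T s'') 0 0" for s''
    using LeastI_ex[OF ex] unfolding s0_def by blast
  have "\<exists>m. T s' m 0 \<and> Sim (T s0) (T s') 0 m" if less: "s' < s0" for s'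
  proof (cases "Wellfounded.accp (T s') 0")
    case False
    then obtain m where "T s' m 0" "\<not> Wellfounded.accp (T s') m" using not_accp_step by metis
    then show ?thesis using Sim_if_not_accp by metis
  next
    case True
    obtain s'' where "\<not> Sim (T s') (T s'') 0 0"
      using not_less_Least[OF less[unfolded s0_def]] by blast
    from Sim_linear[OF True this] obtain m where m: "T s' m 0" "Sim (T s'') (T s') 0 m" by blast
    show ?thesis using m(1) Sim_trans[OF s0 m(2)] by blast
  qed
  with s0 show ?thesis unfolding min_rank_def by blast
qed

lemma min_rank_unique:
  assumes "Wellfounded.accp (T s0) 0" "min_rank T s" "min_rank T s'" shows "s = s'"
proof -
  have "\<not> s' < s" if s: "min_rank T s" and s': "min_rank T s'" for s s'
  proof
    assume "s' < s"
    then obtain m where m: "T s' m 0" "Sim (T s) (T s') 0 m" using s unfolding min_rank_def by blast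
    have "Sim (T s') (T s) 0 0" using s' unfolding min_rank_def by blast
    from Sim_trans[OF this m(2)] not_Sim_below[OF accp_if_min_rank[OF assms(1) s'] m(1)]
    show False by blast
  qed
  with assms(2,3) show ?thesis by (metis linorder_neqE_nat)
qed

text \<open>The simulation is coded by a function on pairs, so that quantifying over it is a
  function quantifier.\<close>

lemma Sim_eq_fun: "Sim e l a n \<longleftrightarrow> (\<exists>W :: nat \<Rightarrow> nat. W (prod_encode (a, n)) \<noteq> 0 \<and>
    (\<forall>b m b'. W (prod_encode (b, m)) \<noteq> 0 \<and> e b' b \<longrightarrow> (\<exists>m'. l m' m \<and> W (prod_encode (b', m')) \<noteq> 0)))"
  (is "_ \<longleftrightarrow> (\<exists>W. ?P W)")
proof
  assume "Sim e l a n"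
  then obtain Q where Q: "Q a n" "\<forall>b m b'. Q b m \<and> e b' b \<longrightarrow> (\<exists>m'. l m' m \<and> Q b' m')"
    unfolding Sim_def by blast
  define W where "W u = (if Q (pfst u) (psnd u) then 1 else 0 :: nat)" for u
  have W: "W (prod_encode (b, m)) \<noteq> 0 \<longleftrightarrow> Q b m" for b m by (simp add: W_def)
  have "?P W" unfolding W using Q by blast
  then show "\<exists>W. ?P W" by blast
next
  assume "\<exists>W. ?P W"
  then obtain W where W: "?P W" by blast
  show "Sim e l a n"
    by (rule SimI[of "\<lambda>b m. W (prod_encode (b, m)) \<noteq> 0"]) (use W in blast)+
qed

lemma Opp_eq_fun: "Opp e l a n \<longleftrightarrow> (\<exists>W :: nat \<Rightarrow> nat. W (prod_encode (a, n)) \<noteq> 0 \<and>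
    (\<forall>b m. W (prod_encode (b, m)) \<noteq> 0 \<longrightarrow> (\<exists>b'. e b' b \<and> (\<forall>m'. l m' m \<longrightarrow> W (prod_encode (b', m')) \<noteq> 0))))"
  (is "_ \<longleftrightarrow> (\<exists>W. ?P W)")
proof
  assume "Opp e l a n"
  then obtain Q where Q: "Q a n" "\<forall>b m. Q b m \<longrightarrow> (\<exists>b'. e b' b \<and> (\<forall>m'. l m' m \<longrightarrow> Q b' m'))"
    unfolding Opp_def by blast
  define W where "W u = (if Q (pfst u) (psnd u) then 1 else 0 :: nat)" for u
  have W: "W (prod_encode (b, m)) \<noteq> 0 \<longleftrightarrow> Q b m" for b m by (simp add: W_def)
  have "?P W" unfolding W using Q by blast
  then show "\<exists>W. ?P W" by blast
next
  assume "\<exists>W. ?P W"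
  then obtain W where W: "?P W" by blast
  show "Opp e l a n" unfolding Opp_def
    by (rule exI[of _ "\<lambda>b m. W (prod_encode (b, m)) \<noteq> 0"]) (use W in blast)
qed

lemma cdec_rel_osubst:
  assumes "cdec (Suc (Suc k)) (\<lambda>xs f. e (xs ! 0) (xs ! 1) (tl (tl xs)) f)"
    and "crec K A" "crec K B" "crecl K L" "\<And>xs f. length xs = K \<Longrightarrow> length (L xs f) = k"
    and "crec (Suc K) (\<lambda>xs f. Or (xs ! 0) (tl xs) f)"
  shows "cdec K (\<lambda>xs f. e (A xs f) (B xs f) (L xs f) (\<lambda>x. Or x xs f))"
proof -
  have "cdec K (\<lambda>xs f. e ((A xs f # B xs f # L xs f) ! 0) ((A xs f # B xs f # L xs f) ! 1)
      (tl (tl (A xs f # B xs f # L xs f))) (\<lambda>x. Or x xs f))"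
    using assms(2-) by (intro cdec_osubst[OF assms(1)] crecl_cons) auto
  then show ?thesis by simp
qed

lemma Sig_Sim [sig_intros]:
  assumes e: "cdec (Suc (Suc k)) (\<lambda>xs f. e (xs ! 0) (xs ! 1) (tl (tl xs)) f)"
    and l: "cdec (Suc (Suc k)) (\<lambda>xs f. l (xs ! 0) (xs ! 1) (tl (tl xs)) f)"
    and a: "crec k a" and n: "crec k n"
  shows "Sig k (\<lambda>xs f. Sim (\<lambda>x y. e x y xs f) (\<lambda>x y. l x y xs f) (a xs f) (n xs f))"
proof -
  have "crec k (\<lambda>xs f. a xs (ev f))" "crec k (\<lambda>xs f. n xs (ev f))"
    by (rule crec_osubst[OF a] crec_osubst[OF n] crec_intros | simp; fail)+
  then show ?thesis unfolding Sim_eq_fun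
    by - (assumption | rule cdec_rel_osubst[OF e] cdec_rel_osubst[OF l] sig_intros crec_intros Sig_cdec | simp; fail)+
qed

lemma Sig_Opp [sig_intros]:
  assumes e: "cdec (Suc (Suc k)) (\<lambda>xs f. e (xs ! 0) (xs ! 1) (tl (tl xs)) f)"
    and l: "cdec (Suc (Suc k)) (\<lambda>xs f. l (xs ! 0) (xs ! 1) (tl (tl xs)) f)"
    and a: "crec k a" and n: "crec k n"
  shows "Sig k (\<lambda>xs f. Opp (\<lambda>x y. e x y xs f) (\<lambda>x y. l x y xs f) (a xs f) (n xs f))"
proof -
  have "crec k (\<lambda>xs f. a xs (ev f))" "crec k (\<lambda>xs f. n xs (ev f))"
    by (rule crec_osubst[OF a] crec_osubst[OF n] crec_intros | simp; fail)+
  then show ?thesis unfolding Opp_eq_fun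
    by - (assumption | rule cdec_rel_osubst[OF e] cdec_rel_osubst[OF l] sig_intros crec_intros Sig_cdec | simp; fail)+
qed

lemma Sig_not_accp [sig_intros]:
  assumes l: "cdec (Suc (Suc k)) (\<lambda>xs f. l (xs ! 0) (xs ! 1) (tl (tl xs)) f)" and n: "crec k n"
  shows "Sig k (\<lambda>xs f. \<not> Wellfounded.accp (\<lambda>x y. l x y xs f) (n xs f))"
proof -
  have "crec k (\<lambda>xs f. n xs (ev f))"
    by (rule crec_osubst[OF n] crec_intros | simp; fail)+
  then show ?thesis unfolding not_accp_iff_chain
    by - (assumption | rule cdec_rel_osubst[OF l] sig_intros crec_intros Sig_cdec | simp; fail)+
qed


section \<open>Trees of attempts\<close>

definition child :: "prog \<Rightarrow> nat list \<Rightarrow> (nat \<Rightarrow> nat) \<Rightarrow> nat \<Rightarrow> nat \<Rightarrow> bool" where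
  "child p ns g v u \<longleftrightarrow> len v = Suc (len u) \<and> (\<forall>i<len u. ent v i = ent u i) \<and>
     nf p (len v) ns (join g (ent v))"

lemma join_agree: "(\<And>i. i < s \<Longrightarrow> Z i = W i) \<Longrightarrow> x < s \<Longrightarrow> join g Z x = join g W x"
  by (simp add: join_def)

text \<open>Descents from the root \<open>0\<close>, the code of the empty sequence, are the
  sequences of initial segments of a witness.\<close>

lemma accp_child_iff:
  "Wellfounded.accp (child p ns g) 0 \<longleftrightarrow> \<not> (\<exists>Z. \<forall>s. nf p s ns (join g Z))"
proof -
  have "(\<exists>u. u 0 = 0 \<and> (\<forall>i. child p ns g (u (Suc i)) (u i))) \<longleftrightarrow> (\<exists>Z. \<forall>s. nf p s ns (join g Z))"
  proof
    assume "\<exists>u. u 0 = 0 \<and> (\<forall>i. child p ns g (u (Suc i)) (u i))"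
    then obtain u where u: "u 0 = 0" "\<And>i. child p ns g (u (Suc i)) (u i)" by blast
    have len: "len (u i) = i" for i by (induction i) (use u in \<open>auto simp: child_def\<close>)
    define Z where "Z i = ent (u (Suc i)) i" for i
    have Z: "ent (u k) i = Z i" if "i < k" for k i
      using that
    proof (induction k)
      case (Suc k)
      then show ?case using u(2)[of k] len by (cases "i = k") (auto simp: Z_def child_def)
    qed simp
    have "nf p s ns (join g Z)" for s
    proof (cases s)
      case (Suc i)
      have "nf p s ns (join g (ent (u s)))" using u(2)[of i] len Suc by (auto simp: child_def)
      then show ?thesis using nf_cong[of s "join g (ent (u s))" "join g Z" p ns] join_agree[of s "ent (u s)" Z] Z by simp
    qed simp
    then show "\<exists>Z. \<forall>s. nf p s ns (join g Z)" by blast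
  next
    assume "\<exists>Z. \<forall>s. nf p s ns (join g Z)"
    then obtain Z where Z: "\<And>s. nf p s ns (join g Z)" by blast
    obtain u where u: "\<And>n. len (u n) = n" "\<And>n i. i < n \<Longrightarrow> ent (u n) i = Z i"
      using ex_ent[of _ Z] by metis
    have "u 0 = 0" by (rule code_eqI) (simp_all add: u(1))
    moreover have "child p ns g (u (Suc i)) (u i)" for i
      unfolding child_def
      using u nf_cong[of "Suc i" "join g (ent (u (Suc i)))" "join g Z" p ns]
        join_agree[of "Suc i" "ent (u (Suc i))" Z] Z by simp
    ultimately show "\<exists>u. u 0 = 0 \<and> (\<forall>i. child p ns g (u (Suc i)) (u i))" by blast
  qed
  then show ?thesis using not_accp_iff_chain[of "child p ns g" 0] by metis
qed

lemma cdec_child [crec_intros]: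
  assumes "crec k V" "crec k U" "crecl k L" "crec (Suc k) (\<lambda>xs f. Or (xs ! 0) (tl xs) f)"
  shows "cdec k (\<lambda>xs f. child p (L xs f) (\<lambda>x. Or x xs f) (V xs f) (U xs f))"
proof -
  have "crecl (Suc k) (\<lambda>xs f. xs ! 0 div 2 # tl xs)" by (rule crec_intros | simp; fail)+
  from crec_app[OF assms(4) this]
  have "crec (Suc k) (\<lambda>xs f. Or (xs ! 0 div 2) (tl xs) f)" by simp
  then show ?thesis unfolding child_def
    by - (rule assms crec_tl[OF assms(1)] crec_tl[OF assms(2)] crec_intros | assumption | simp; fail)+
qed

text \<open>
  Number uniformization for co-analytic relations: among the witnesses \<open>s\<close> with \<open>\<not> B n s\<close> one
  takes the first whose tree of attempts has minimal rank.
\<close>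

lemma coanalytic_uniformization:
  assumes B: "Sig 2 (\<lambda>ns f. B (ns ! 0) (ns ! 1))" and ex: "\<And>n. \<exists>s. \<not> B n s"
  obtains \<sigma> where "Sig 2 (\<lambda>ns f. ns ! 1 = \<sigma> (ns ! 0))" "\<And>n. \<not> B n (\<sigma> n)"
proof -
  obtain p where p: "\<And>ns f. length ns = 2 \<Longrightarrow> B (ns ! 0) (ns ! 1) \<longleftrightarrow> (\<exists>Z. \<forall>s. nf p s ns (join f Z))"
    using Sig_nf[OF B] by blast
  \<comment> \<open>\<open>B\<close> has no function argument, so the oracle can be fixed as
    \<open>0\<close>.\<close>
  define T where "T n s = child p [n, s] (\<lambda>_. 0)" for n s
  have acc: "Wellfounded.accp (T n s) 0 \<longleftrightarrow> \<not> B n s" for n s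
    unfolding T_def accp_child_iff using p[of "[n, s]"] by simp
  have ex1: "\<exists>!s. min_rank (T n) s" for n
  proof -
    obtain s where s: "Wellfounded.accp (T n s) 0" using ex[of n] acc by blast
    show ?thesis using ex_min_rank[of "T n", OF s] min_rank_unique[of "T n", OF s] by blast
  qed
  define \<sigma> where "\<sigma> n = (THE s. min_rank (T n) s)" for n
  have \<sigma>: "min_rank (T n) s \<longleftrightarrow> s = \<sigma> n" for n s
    using theI'[OF ex1[of n]] ex1[of n] unfolding \<sigma>_def by blast
  have "\<not> B n (\<sigma> n)" for n
  proof -
    obtain s where s: "Wellfounded.accp (T n s) 0" using ex[of n] acc by blast
    show ?thesis using accp_if_min_rank[of "T n", OF s] \<sigma> acc by blast
  qed
  \<comment> \<open>Since exactly one index has least rank, this analytic predicate is the graph of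
    \<open>\<sigma>\<close>.\<close>
  moreover have "Sig 2 (\<lambda>ns f. min_rank (T (ns ! 0)) (ns ! 1))"
    unfolding min_rank_def T_def
    by (rule sig_intros crec_intros Sig_cdec | simp; fail)+
  ultimately show ?thesis using that \<sigma> by simp
qed

section \<open>Consequences of genericity\<close>

lemma Sigma11_set_iff: "Sigma11_set G \<longleftrightarrow> Sig 0 (\<lambda>xs f. tb f \<in> G)"
  by (simp add: Sigma11_set_def Sigma11_iff_Sig)

lemma uniformly_Sigma11_iff: "uniformly_Sigma11 F \<longleftrightarrow> Sig 1 (\<lambda>xs f. tb f \<in> F (xs ! 0))"
  by (simp add: uniformly_Sigma11_def Sigma11_iff_Sig)

lemma Sig_mem:
  assumes "Sigma11_set G" "crec (Suc k) (\<lambda>xs f. Or (xs ! 0) (tl xs) f)"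
  shows "Sig k (\<lambda>xs f. tb (\<lambda>x. Or x xs f) \<in> G)"
  by (rule Sig_osubst[OF assms(1)[unfolded Sigma11_set_iff] crecl_nil _ assms(2)]) simp

lemma Sig_mem_uniform:
  assumes "uniformly_Sigma11 F" "crec k A" "crec (Suc k) (\<lambda>xs f. Or (xs ! 0) (tl xs) f)"
  shows "Sig k (\<lambda>xs f. tb (\<lambda>x. Or x xs f) \<in> F (A xs f))"
proof -
  have "Sig k (\<lambda>xs f. tb (\<lambda>x. Or x xs f) \<in> F ([A xs f] ! 0))"
    by (rule Sig_osubst[OF assms(1)[unfolded uniformly_Sigma11_iff] _ _ assms(3)])
      (use assms(2) in \<open>auto intro: crec_intros\<close>)
  then show ?thesis by simp
qed

lemma cdec_iff [crec_intros]: "cdec k P \<Longrightarrow> cdec k Q \<Longrightarrow> cdec k (\<lambda>xs f. P xs f = Q xs f)"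
  unfolding iff_conv_conj_imp by (intro cdec_conj cdec_imp)

lemma Sig_ex_cantor:
  assumes "Sig k (\<lambda>xs g. A xs (ev g) (tb (od g)))"
  shows "Sig k (\<lambda>xs f. \<exists>X. A xs f X)"
proof -
  have "Sig k (\<lambda>xs f. \<exists>W. A xs f (tb W))" by (rule Sig_exf) (rule assms)
  moreover have "(\<exists>W. A xs f (tb W)) \<longleftrightarrow> (\<exists>X. A xs f X)" for xs f
    by (metis tb_char_fun)
  ultimately show ?thesis by simp
qed

text \<open>The clopen set coded by \<open>s\<close>: entry \<open>0\<close> is a level, the other entries mark strings of that length.\<close>

definition clopen_of :: "nat \<Rightarrow> cantor set" where
  "clopen_of s = {X. ent s (Suc (pre (ent s 0) X)) \<noteq> 0}"

lemma closed_clopen_of: "closed (clopen_of s)"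
  unfolding closed_iff_cyl clopen_of_def cyl_eq_pre by (auto intro!: exI[of _ "ent s 0"])

text \<open>A form with bounded quantifiers and finitely many queries to \<open>X\<close>, to which
  the closure rules for decidability apply.\<close>

lemma mem_clopen_of:
  "X \<in> clopen_of s \<longleftrightarrow> (\<exists>x<2 ^ ent s 0. (\<forall>i<ent s 0. bit x i = X i) \<and> ent s (Suc x) \<noteq> 0)"
proof
  assume "X \<in> clopen_of s"
  then show "\<exists>x<2 ^ ent s 0. (\<forall>i<ent s 0. bit x i = X i) \<and> ent s (Suc x) \<noteq> 0"
    by (intro exI[of _ "pre (ent s 0) X"]) (auto simp: pre_less bit_pre clopen_of_def)
next
  assume "\<exists>x<2 ^ ent s 0. (\<forall>i<ent s 0. bit x i = X i) \<and> ent s (Suc x) \<noteq> 0"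
  then obtain x where x: "x < 2 ^ ent s 0" "\<forall>i<ent s 0. bit x i = X i" "ent s (Suc x) \<noteq> 0" by blast
  have "pre (ent s 0) X = pre (ent s 0) (bit x)" using x(2) by (simp add: pre_eq_iff)
  then show "X \<in> clopen_of s" using x pre_bit[OF x(1)] by (simp add: clopen_of_def)
qed

lemma lam_clopen_of_compl:
  "lam (- clopen_of s) = card {x. x < 2 ^ ent s 0 \<and> ent s (Suc x) = 0} / 2 ^ ent s 0"
proof -
  have "- clopen_of s = {X. ent s (Suc (pre (ent s 0) X)) = 0}" by (auto simp: clopen_of_def)
  then show ?thesis using lam_level[of "\<lambda>x. ent s (Suc x) = 0" "ent s 0"] by simp
qed

text \<open>The clopen hulls of \<open>N\<close> shrink to \<open>N\<close>, so some hull has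
  measure below \<open>\<epsilon>\<close>; \<open>s\<close> codes its complement.\<close>

lemma null_closed_avoided_by_clopen:
  assumes N: "closed N" "lam N = 0" and \<epsilon>: "0 < \<epsilon>"
  obtains s where "N \<inter> clopen_of s = {}" "lam (- clopen_of s) < \<epsilon>"
proof -
  define V where "V k = {X. pre k X \<in> pre k ` N}" for k
  have sV: "V k \<in> sets cantor_measure" for k unfolding V_def by (rule sets_level)
  have decV: "decseq V"
    unfolding decseq_def V_def by (auto simp: pre_eq_iff image_iff)
  have INT: "(\<Inter>k. V k) \<subseteq> N"
  proof
    fix X assume X: "X \<in> (\<Inter>k. V k)"
    show "X \<in> N"
    proof (rule ccontr)
      assume "X \<notin> N"
      then obtain k where k: "cyl k X \<inter> N = {}" using N(1) unfolding closed_iff_cyl by blast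
      have "X \<in> V k" using X by blast
      then obtain Y where "Y \<in> N" "pre k X = pre k Y" by (auto simp: V_def)
      then show False using k by (auto simp: cyl_eq_pre)
    qed
  qed
  have "\<exists>k. lam (V k) < \<epsilon>"
  proof (rule ccontr)
    assume "\<not> ?thesis"
    then have "\<epsilon> \<le> lam (\<Inter>k. V k)" by (intro lam_INT_ge decV sV) (simp add: not_less)
    also have "\<dots> \<le> lam N" using INT sets_closed[OF N(1)] by (intro lam.finite_measure_mono) auto
    finally show False using N(2) \<epsilon> by simp
  qed
  then obtain k where k: "lam (V k) < \<epsilon>" by blast
  obtain s where s: "\<forall>i<Suc (2 ^ k). ent s i = case_nat k (\<lambda>x. if x \<in> pre k ` N then 0 else 1) i"
    using ex_ent by blast
  have s0: "ent s 0 = k" using s[rule_format, of 0] by simp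
  have sS: "ent s (Suc x) = (if x \<in> pre k ` N then 0 else 1)" if "x < 2 ^ k" for x
    using s[rule_format, of "Suc x"] that by simp
  have eq: "clopen_of s = - V k"
    unfolding clopen_of_def s0 V_def using sS[OF pre_less] by auto
  show ?thesis
  proof
    show "N \<inter> clopen_of s = {}" unfolding eq V_def by auto
    show "lam (- clopen_of s) < \<epsilon>" unfolding eq using k by simp
  qed
qed

lemma generic_not_in_null_closed:
  assumes Y: "solovay_Sigma11_generic Y" and N: "Sigma11_set N" "closed N" "Y \<in> N"
  shows "0 < lam N"
proof (rule ccontr)
  assume "\<not> 0 < lam N"
  then have null: "lam N = 0" using measure_nonneg[of cantor_measure N] by linarith
  \<comment> \<open>The negation of what is wanted of a code \<open>s\<close>; being analytic, it
    has the form that uniformization requires.\<close>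
  define B where "B n s \<longleftrightarrow>
      2 ^ ent s 0 \<le> Suc n * card {x. x < 2 ^ ent s 0 \<and> ent s (Suc x) = 0} \<or>
      (\<exists>X. X \<in> N \<and> (\<exists>x<2 ^ ent s 0. (\<forall>i<ent s 0. bit x i = X i) \<and> ent s (Suc x) \<noteq> 0))" for n s
  have B_iff: "\<not> B n s \<longleftrightarrow> lam (- clopen_of s) < 1 / Suc n \<and> N \<inter> clopen_of s = {}" for n s
  proof -
    let ?c = "card {x. x < 2 ^ ent s 0 \<and> ent s (Suc x) = 0}"
    have "real ?c / 2 ^ ent s 0 < 1 / Suc n \<longleftrightarrow> real (Suc n * ?c) < real (2 ^ ent s 0)"
      by (simp add: field_simps)
    then show ?thesis unfolding B_def lam_clopen_of_compl of_nat_less_iff mem_clopen_of[symmetric]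
      by (auto simp: not_le)
  qed
  have "Sig 2 (\<lambda>ns f. B (ns ! 0) (ns ! 1))"
    unfolding B_def
    by (rule Sig_disj[OF Sig_cdec] Sig_ex_cantor Sig_conj[OF Sig_mem[OF N(1)]] crec_intros Sig_cdec | simp; fail)+
  moreover have "\<exists>s. \<not> B n s" for n
    using null_closed_avoided_by_clopen[OF N(2) null, of "1 / Suc n"] unfolding B_iff by auto
  ultimately obtain \<sigma> where \<sigma>: "Sig 2 (\<lambda>ns f. ns ! 1 = \<sigma> (ns ! 0))" "\<And>n. \<not> B n (\<sigma> n)"
    using coanalytic_uniformization[of B] by blast
  define F where "F n = clopen_of (\<sigma> n)" for n
  have small: "lam (- F n) < 1 / Suc n" and disj: "N \<inter> F n = {}" for n
    using \<sigma>(2)[of n] unfolding B_iff F_def by auto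
  have sF: "F n \<in> sets cantor_measure" for n unfolding F_def by (rule sets_closed[OF closed_clopen_of])
  have "uniformly_Sigma11 F"
  proof -
    \<comment> \<open>The quantifier over the value of \<open>\<sigma>\<close> puts that value
      first, hence the exchanged arguments.\<close>
    have S: "Sig (Suc (Suc 0)) (\<lambda>xs f. xs ! 0 = \<sigma> (xs ! 1))"
    proof -
      have "Sig (Suc (Suc 0)) (\<lambda>xs f. [xs ! 1, xs ! 0] ! 1 = \<sigma> ([xs ! 1, xs ! 0] ! 0))"
        by (rule Sig_osubst[OF \<sigma>(1), where Or = "\<lambda>x xs f. f x"] crec_intros | simp; fail)+
      then show ?thesis by simp
    qed
    have "Sig (Suc 0) (\<lambda>xs f. \<exists>s. (s = \<sigma> (xs ! 0)) \<and> (\<exists>x<2 ^ ent s 0. (\<forall>i<ent s 0. bit x i = tb f i) \<and> ent s (Suc x) \<noteq> 0))"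
    proof (rule Sig_ex, rule Sig_conj)
      show "Sig (Suc (Suc 0)) (\<lambda>xs f. xs ! 0 = \<sigma> (tl xs ! 0))"
        using S by (subst Sig_cong) (auto simp: nth_tl)
    qed (rule crec_intros Sig_cdec | simp; fail)+
    then show ?thesis unfolding uniformly_Sigma11_iff F_def mem_clopen_of by simp
  qed
  moreover have "closed (F n)" for n unfolding F_def by (rule closed_clopen_of)
  moreover have "emeasure cantor_measure (F n) > 0" for n
  proof -
    have "lam (F n) = 1 - lam (- F n)" using lam.prob_compl[OF sF[of n]] by (simp add: Compl_eq_Diff_UNIV)
    moreover have "1 / real (Suc n) \<le> 1" by simp
    ultimately have "0 < lam (F n)" using small[of n] by linarith
    then show ?thesis by (simp add: lam.emeasure_eq_measure)
  qed
  \<comment> \<open>The first alternative fails because \<open>Y \<in> N\<close>. In the second,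
    \<open>G\<close> lies in every complement of \<open>F n\<close> and would be null.\<close>
  ultimately have "(\<exists>n. Y \<in> F n) \<or> (\<exists>G. Sigma11_set G \<and> closed G \<and> emeasure cantor_measure G > 0 \<and>
      G \<inter> (\<Union>n. F n) = {} \<and> Y \<in> G)"
    using Y[unfolded solovay_Sigma11_generic_def, rule_format, of F] by blast
  moreover have "Y \<notin> F n" for n using disj[of n] N(3) by blast
  ultimately obtain G where G: "closed G" "emeasure cantor_measure G > 0" "G \<inter> (\<Union>n. F n) = {}"
    by metis
  have "lam G < 1 / Suc n" for n
  proof -
    have "- F n \<in> sets cantor_measure" using sets.compl_sets[OF sF[of n]] by (simp add: Compl_eq_Diff_UNIV)
    then have "lam G \<le> lam (- F n)" using G(3) by (intro lam.finite_measure_mono) auto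
    then show ?thesis using small[of n] by linarith
  qed
  moreover have "0 < lam G" using G(2) by (simp add: lam.emeasure_eq_measure)
  ultimately show False using reals_Archimedean[of "lam G"] by (metis inverse_eq_divide less_asym)
qed

lemma om_eq_0_if: "(\<And>d. om A \<le> 1 / real (Suc d)) \<Longrightarrow> om A = 0"
  using reals_Archimedean[of "om A"] om_nonneg[of A]
  by (metis inverse_eq_divide linorder_not_less order_le_less)

lemma om_UN_null:
  assumes "\<And>i :: nat. om (A i) = 0" shows "om (\<Union>i. A i) = 0"
proof -
  have "\<exists>E. E \<in> sets cantor_measure \<and> A i \<subseteq> E \<and> lam E = 0" for i
  proof -
    obtain E where E: "E \<in> sets cantor_measure" "A i \<subseteq> E"
      "\<And>F. F \<in> sets cantor_measure \<Longrightarrow> lam (F \<inter> E) = om (F \<inter> A i)" using om_envelope[of "A i"] by metis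
    have "lam E = 0" using E(3)[of UNIV] assms[of i] sets.top[of cantor_measure] by simp
    with E show ?thesis by blast
  qed
  then obtain E where E: "\<And>i. E i \<in> sets cantor_measure" "\<And>i. A i \<subseteq> E i" "\<And>i. lam (E i) = 0" by metis
  have "(\<Union>i. E i) \<in> null_sets cantor_measure"
    using E(1,3) by (intro null_sets_UN) (auto simp: null_sets_def lam.emeasure_eq_measure)
  then have "lam (\<Union>i. E i) = 0" by (simp add: null_sets_def lam.emeasure_eq_measure)
  moreover have "om (\<Union>i. A i) \<le> om (\<Union>i. E i)" using E(2) by (intro om_mono) blast
  moreover have "om (\<Union>i. E i) = lam (\<Union>i. E i)" using E(1) by (intro om_eq) auto
  ultimately show ?thesis using om_nonneg[of "\<Union>i. A i"] by linarith
qed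

section \<open>The dichotomy of big and small sets\<close>

definition big :: "cantor \<Rightarrow> cantor set \<Rightarrow> bool" where
  "big Y A \<longleftrightarrow> (\<exists>d. Y \<in> dense_core (1 / real (Suc d)) A)"

definition small :: "cantor \<Rightarrow> cantor set \<Rightarrow> bool" where
  "small Y A \<longleftrightarrow> (\<exists>G. Sigma11_set G \<and> closed G \<and> Y \<in> G \<and> om (G \<inter> A) = 0)"

lemma big_mono: "A \<subseteq> B \<Longrightarrow> big Y A \<Longrightarrow> big Y B"
  unfolding big_def using dense_core_mono by blast

lemma small_mono: "A \<subseteq> B \<Longrightarrow> small Y B \<Longrightarrow> small Y A"
  unfolding small_def using om_mono[of "G \<inter> A" "G \<inter> B" for G] om_nonneg
  by (metis Int_mono order_antisym order_refl)

text \<open>The index codes a member of the sequence together with a density bound, so a single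
  sequence lists all cores to which genericity is applied.\<close>

lemma Sig_dense_core:
  assumes "uniformly_Sigma11 A"
  shows "uniformly_Sigma11 (\<lambda>j. dense_core (1 / real (Suc (psnd j))) (A (pfst j)))"
proof -
  have eq: "tb f \<in> dense_core (1 / real (Suc d)) B \<longleftrightarrow>
    (\<forall>k. real 1 / real (Suc d * 2 ^ k) < om {X. X \<in> B \<and> (\<forall>i<k. X i = tb f i)})" for f d B
  proof -
    have "1 / real (Suc d) / 2 ^ k = real 1 / real (Suc d * 2 ^ k)" for k
      by (simp add: algebra_simps)
    then show ?thesis unfolding dense_core_def cyl_def Int_def by (simp only: mem_Collect_eq)
  qed
  show ?thesis
    unfolding uniformly_Sigma11_iff eq
    by (rule sig_intros Sig_less_om[where a = "\<lambda>_ _. 1"] Sig_mem_uniform[OF assms] crec_intros Sig_cdec | simp; fail)+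
qed

lemma Sigma11_set_Int: "Sigma11_set A \<Longrightarrow> Sigma11_set B \<Longrightarrow> Sigma11_set (A \<inter> B)"
  unfolding Sigma11_set_iff by (simp add: Sig_conj)

lemma Sigma11_set_dense_core:
  assumes "Sigma11_set A" shows "Sigma11_set (dense_core (1 / real (Suc d)) A)"
proof -
  have "uniformly_Sigma11 (\<lambda>_. A)"
    unfolding uniformly_Sigma11_iff by (rule Sig_mem[OF assms] crec_intros | simp; fail)+
  from Sig_dense_core[OF this]
  have "Sig 0 (\<lambda>xs f. tb f \<in> dense_core (1 / real (Suc (psnd (prod_encode (0, d))))) A)"
    by (rule Sig_mem_uniform) (rule crec_intros | simp; fail)+
  then show ?thesis unfolding Sigma11_set_iff by simp
qed

text \<open>Inside the core, a closed analytic set through \<open>Y\<close> has positive measure and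
  so meets \<open>A\<close> in positive outer measure, which smallness forbids.\<close>

lemma not_big_and_small:
  assumes Y: "solovay_Sigma11_generic Y" and A: "Sigma11_set A" and b: "big Y A" and s: "small Y A"
  shows False
proof -
  obtain d where d: "Y \<in> dense_core (1 / real (Suc d)) A" using b unfolding big_def by blast
  obtain G where G: "Sigma11_set G" "closed G" "Y \<in> G" "om (G \<inter> A) = 0" using s unfolding small_def by blast
  let ?K = "G \<inter> dense_core (1 / real (Suc d)) A"
  have cK: "closed ?K" using G(2) closed_dense_core by (intro closed_Int)
  have "0 < lam ?K"
    by (rule generic_not_in_null_closed[OF Y Sigma11_set_Int[OF G(1) Sigma11_set_dense_core[OF A]] cK])
      (use G(3) d in blast)
  then have "0 < 1 / real (Suc d) * lam ?K" by simp
  also have "\<dots> \<le> om (A \<inter> ?K)" by (rule dense_closed_meets[OF cK]) auto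
  also have "\<dots> \<le> om (G \<inter> A)" by (intro om_mono) auto
  finally show False using G(4) by simp
qed

lemma Sig_True: "Sig k (\<lambda>xs f. True)"
  by (intro Sig_cdec cdec_const)

lemma big_or_small:
  assumes Y: "solovay_Sigma11_generic Y" and A: "uniformly_Sigma11 A"
  shows "(\<exists>i. big Y (A i)) \<or> small Y (\<Union>i. A i)"
proof -
  define F where "F j = dense_core (1 / real (Suc (psnd j))) (A (pfst j))" for j
  have uF: "uniformly_Sigma11 F" unfolding F_def by (rule Sig_dense_core[OF A])
  have cF: "closed (F j)" for j unfolding F_def by (rule closed_dense_core)
  have diff: "om (A i - F (prod_encode (i, d))) \<le> 1 / real (Suc d)" for i d
    unfolding F_def using om_Diff_dense_core[of "1 / real (Suc d)" "A i"] by simp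
  show ?thesis
  proof (cases "\<exists>j. lam (F j) \<noteq> 0")
    case False
    have "om (A i) \<le> 1 / real (Suc d)" for i d
    proof -
      have "om (A i) \<le> om ((A i - F (prod_encode (i, d))) \<union> F (prod_encode (i, d)))"
        by (intro om_mono) blast
      also have "\<dots> \<le> om (A i - F (prod_encode (i, d))) + om (F (prod_encode (i, d)))" by (rule om_Un)
      finally show ?thesis using diff[of i d] False om_eq[OF sets_closed[OF cF]] by simp
    qed
    then have "om (\<Union>i. A i) = 0" by (intro om_UN_null om_eq_0_if)
    moreover have "Sigma11_set UNIV" unfolding Sigma11_set_iff using Sig_True by simp
    ultimately have "small Y (\<Union>i. A i)" unfolding small_def by (intro exI[of _ UNIV]) auto
    then show ?thesis ..
  next
    case True
    then obtain j0 where j0: "lam (F j0) \<noteq> 0" by blast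
    \<comment> \<open>Genericity asks for members of positive measure. Uniting all cores with one
      non-null core arranges this, and lying in that core also makes some \<open>A i\<close>
      big.\<close>
    define F' where "F' j = F j \<union> F j0" for j
    have "uniformly_Sigma11 F'"
      unfolding uniformly_Sigma11_iff F'_def Un_iff
      by (rule Sig_disj Sig_mem_uniform[OF uF] crec_intros | simp; fail)+
    moreover have "closed (F' j)" for j unfolding F'_def by (intro closed_Un cF)
    moreover have "emeasure cantor_measure (F' j) > 0" for j
    proof -
      have "0 < lam (F j0)" using j0 measure_nonneg[of cantor_measure "F j0"] by linarith
      also have "\<dots> \<le> lam (F' j)"
        unfolding F'_def using sets_closed[OF cF] by (intro lam.finite_measure_mono) auto
      finally show ?thesis by (simp add: lam.emeasure_eq_measure)
    qed
    ultimately have "(\<exists>j. Y \<in> F' j) \<or> (\<exists>G. Sigma11_set G \<and> closed G \<and> emeasure cantor_measure G > 0 \<and>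
        G \<inter> (\<Union>j. F' j) = {} \<and> Y \<in> G)"
      using Y[unfolded solovay_Sigma11_generic_def, rule_format, of F'] by blast
    then show ?thesis
    proof
      assume "\<exists>j. Y \<in> F' j"
      then obtain j where "Y \<in> F j" unfolding F'_def by blast
      then show ?thesis unfolding F_def big_def by blast
    next
      assume "\<exists>G. Sigma11_set G \<and> closed G \<and> emeasure cantor_measure G > 0 \<and> G \<inter> (\<Union>j. F' j) = {} \<and> Y \<in> G"
      then obtain G where G: "Sigma11_set G" "closed G" "G \<inter> (\<Union>j. F' j) = {}" "Y \<in> G" by blast
      \<comment> \<open>As \<open>G\<close> avoids every core, it meets \<open>A i\<close> only in
        the part that the core misses.\<close>
      have "om (G \<inter> A i) \<le> 1 / real (Suc d)" for i d
      proof -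
        have "om (G \<inter> A i) \<le> om (A i - F (prod_encode (i, d)))"
          using G(3) by (intro om_mono) (auto simp: F'_def)
        then show ?thesis using diff[of i d] by linarith
      qed
      then have "om (\<Union>i. G \<inter> A i) = 0" by (intro om_UN_null om_eq_0_if)
      then have "om (G \<inter> (\<Union>i. A i)) = 0" by (simp only: Int_UN_distrib)
      then have "small Y (\<Union>i. A i)" unfolding small_def using G by blast
      then show ?thesis ..
    qed
  qed
qed

section \<open>The Kleene--Brouwer order\<close>

text \<open>Sequences are continued by \<open>\<infinity>\<close>; lexicographic comparison then
  places an extension before its initial segments, as the Kleene-Brouwer order demands.\<close>

definition key :: "nat \<Rightarrow> nat \<Rightarrow> enat" where
  "key u i = (if i < len u then enat (ent u i) else \<infinity>)"

definition kb :: "nat \<Rightarrow> nat \<Rightarrow> bool" where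
  "kb u v \<longleftrightarrow> (\<exists>i. key u i < key v i \<and> (\<forall>j<i. key u j = key v j))"

lemma key_inject: "(\<And>i. key u i = key v i) \<Longrightarrow> u = v"
proof (rule code_eqI)
  assume eq: "\<And>i. key u i = key v i"
  have iff: "i < len u \<longleftrightarrow> i < len v" for i
    using eq[of i] by (auto simp: key_def split: if_splits)
  then show "len u = len v" by (metis less_irrefl linorder_neqE_nat)
  show "ent u i = ent v i" if "i < len u" for i
    using eq[of i] that iff by (auto simp: key_def)
qed

lemma kb_irrefl: "\<not> kb u u"
  by (simp add: kb_def)

lemma kb_trans:
  assumes "kb u v" "kb v w" shows "kb u w"
proof -
  obtain i where i: "key u i < key v i" "\<And>j. j < i \<Longrightarrow> key u j = key v j" using assms(1) kb_def by blast
  obtain k where k: "key v k < key w k" "\<And>j. j < k \<Longrightarrow> key v j = key w j" using assms(2) kb_def by blast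
  have "key u (min i k) < key w (min i k)"
  proof (cases i k rule: linorder_cases)
    case less
    then show ?thesis using i(1) k(2)[OF less] by (simp add: min_def)
  next
    case equal
    then show ?thesis using i(1) k(1) by simp
  next
    case greater
    then show ?thesis using i(2)[OF greater] k(1) by (simp add: min_def)
  qed
  then show ?thesis unfolding kb_def using i(2) k(2) by (intro exI[of _ "min i k"]) simp
qed

lemma kb_linear: "u \<noteq> v \<Longrightarrow> kb u v \<or> kb v u"
proof -
  assume "u \<noteq> v"
  then have ex: "\<exists>i. key u i \<noteq> key v i" using key_inject by blast
  define i where "i = (LEAST i. key u i \<noteq> key v i)"
  have "key u i \<noteq> key v i" unfolding i_def using ex by (rule LeastI_ex)
  moreover have "key u j = key v j" if "j < i" for j
    using not_less_Least[of j "\<lambda>i. key u i \<noteq> key v i"] that unfolding i_def by blast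
  ultimately show ?thesis unfolding kb_def by (metis neq_iff)
qed

lemma kb_iff:
  "kb u v \<longleftrightarrow> (\<exists>i<len u. (\<forall>j<i. j < len v \<and> ent u j = ent v j) \<and> (i < len v \<longrightarrow> ent u i < ent v i))"
proof
  assume "kb u v"
  then obtain i where i: "key u i < key v i" "\<And>j. j < i \<Longrightarrow> key u j = key v j" unfolding kb_def by blast
  have iu: "i < len u" using i(1) by (auto simp: key_def split: if_splits)
  have "j < len v \<and> ent u j = ent v j" if "j < i" for j
    using i(2)[OF that] iu that by (auto simp: key_def split: if_splits)
  moreover have "i < len v \<longrightarrow> ent u i < ent v i"
    using i(1) iu by (auto simp: key_def)
  ultimately show "\<exists>i<len u. (\<forall>j<i. j < len v \<and> ent u j = ent v j) \<and> (i < len v \<longrightarrow> ent u i < ent v i)"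
    using iu by blast
next
  assume "\<exists>i<len u. (\<forall>j<i. j < len v \<and> ent u j = ent v j) \<and> (i < len v \<longrightarrow> ent u i < ent v i)"
  then obtain i where i: "i < len u" "\<forall>j<i. j < len v \<and> ent u j = ent v j" "i < len v \<longrightarrow> ent u i < ent v i"
    by blast
  then show "kb u v" unfolding kb_def by (intro exI[of _ i]) (auto simp: key_def)
qed

lemma cdec_kb [crec_intros]:
  assumes "crec k A" "crec k B" shows "cdec k (\<lambda>xs f. kb (A xs f) (B xs f))"
proof -
  have "cdec 2 (\<lambda>xs f. kb (xs ! 0) (xs ! 1))"
    unfolding kb_iff by (rule crec_intros | simp; fail)+
  from cdec_app[OF this crecl_cons[OF assms(1) crecl_cons[OF assms(2) crecl_nil]]] show ?thesis by simp
qed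

text \<open>
  Along a descending chain the entries stabilise one after the other, and the limit is an infinite
  path: an entry \<open>\<infinity>\<close> in the limit would make the chain eventually constant.
\<close>

lemma kb_chain_limit:
  assumes desc: "\<And>i. kb (c (Suc i)) (c i)"
  obtains Z where "\<And>n. \<exists>i. n \<le> len (c i) \<and> (\<forall>j<n. ent (c i) j = Z j)"
proof -
  define stab where "stab n M \<longleftrightarrow> (\<forall>i\<ge>M. \<forall>j<n. key (c i) j = key (c M) j)" for n M
  have "\<exists>M. stab n M" for n
  proof (induction n)
    case (Suc n)
    then obtain M where M: "\<And>i j. M \<le> i \<Longrightarrow> j < n \<Longrightarrow> key (c i) j = key (c M) j" unfolding stab_def by blast
    \<comment> \<open>Once the first \<open>n\<close> entries are stable, the next one can only
      decrease, so it attains a minimum and stays there.\<close>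
    have step: "key (c (Suc i)) n \<le> key (c i) n" if "M \<le> i" for i
    proof -
      obtain k where k: "key (c (Suc i)) k < key (c i) k" "\<And>j. j < k \<Longrightarrow> key (c (Suc i)) j = key (c i) j"
        using desc[of i] unfolding kb_def by blast
      have "\<not> k < n" using M[of i k] M[of "Suc i" k] \<open>M \<le> i\<close> k(1) by auto
      then show ?thesis using k by (cases "k = n") auto
    qed
    have anti: "key (c (i + d)) n \<le> key (c i) n" if "M \<le> i" for i d
      using that by (induction d) (auto intro: order_trans[OF step])
    have "\<exists>y. y \<in> {key (c i) n |i. M \<le> i}" by blast
    then obtain y where y: "y \<in> {key (c i) n |i. M \<le> i}" "\<And>z. z < y \<Longrightarrow> z \<notin> {key (c i) n |i. M \<le> i}"
      using exists_least_iff[of "\<lambda>y. y \<in> {key (c i) n |i. M \<le> i}"] by blast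
    then obtain N where N: "M \<le> N" "y = key (c N) n" by blast
    have "key (c i) n = key (c N) n" if "N \<le> i" for i
    proof (rule antisym)
      show "key (c i) n \<le> key (c N) n" using anti[OF N(1), of "i - N"] that by simp
      have "key (c i) n \<in> {key (c i) n |i. M \<le> i}" using that N(1) by (auto intro: le_trans)
      then show "key (c N) n \<le> key (c i) n" using y(2) N(2) not_less by blast
    qed
    moreover have "key (c i) j = key (c N) j" if "N \<le> i" "j < n" for i j
      using M[of i j] M[of N j] that N(1) by simp
    ultimately have "stab (Suc n) N" unfolding stab_def less_Suc_eq by blast
    then show ?case ..
  qed (simp add: stab_def)
  then obtain N where "\<And>n. stab n (N n)" by metis
  then have N: "key (c i) j = key (c (N n)) j" if "N n \<le> i" "j < n" for n i j
    using that unfolding stab_def by blast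
  define x where "x j = key (c (N (Suc j))) j" for j
  have x: "key (c i) j = x j" if "N n \<le> i" "j < n" for n i j
  proof -
    have "key (c i) j = key (c (N n)) j" by (rule N[OF that])
    also have "\<dots> = key (c (max (N n) (N (Suc j)))) j" by (rule N[symmetric]) (use that in auto)
    also have "\<dots> = x j" unfolding x_def by (rule N) auto
    finally show ?thesis .
  qed
  have fin: "x j \<noteq> \<infinity>" for j
  proof
    assume inf: "x j = \<infinity>"
    let ?M = "N (Suc j)"
    have short: "len (c i) \<le> j" if "?M \<le> i" for i
      using x[OF that, of j] inf by (auto simp: key_def split: if_splits)
    have "key (c (Suc ?M)) k = key (c ?M) k" for k
    proof (cases "k < Suc j")
      case True
      then show ?thesis using x[of "Suc j" "Suc ?M" k] x[of "Suc j" ?M k] by simp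
    next
      case False
      then show ?thesis using short[of ?M] short[of "Suc ?M"] by (simp add: key_def)
    qed
    then show False using desc[of ?M] by (simp add: kb_def)
  qed
  define Z where "Z j = the_enat (x j)" for j
  have "n \<le> len (c (N n)) \<and> (\<forall>j<n. ent (c (N n)) j = Z j)" for n
  proof -
    have k: "key (c (N n)) j = enat (Z j)" if "j < n" for j
      using x[OF order_refl that] fin[of j] by (auto simp: Z_def)
    have "j < len (c (N n)) \<and> ent (c (N n)) j = Z j" if "j < n" for j
      using k[OF that] by (auto simp: key_def split: if_splits)
    then show ?thesis by (metis linorder_not_le less_irrefl)
  qed
  with that show ?thesis by blast
qed

definition kbt :: "(nat \<Rightarrow> nat) \<Rightarrow> nat \<Rightarrow> nat \<Rightarrow> bool" where
  "kbt E u v \<longleftrightarrow> E u \<noteq> 0 \<and> E v \<noteq> 0 \<and> kb u v"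

lemma cdec_kbt [crec_intros]:
  "crec k (\<lambda>xs f. E xs f (A xs f)) \<Longrightarrow> crec k (\<lambda>xs f. E xs f (B xs f)) \<Longrightarrow> crec k A \<Longrightarrow> crec k B \<Longrightarrow>
   cdec k (\<lambda>xs f. kbt (E xs f) (A xs f) (B xs f))"
  unfolding kbt_def by (intro crec_intros)

definition is_path :: "(nat \<Rightarrow> nat) \<Rightarrow> (nat \<Rightarrow> nat) \<Rightarrow> bool" where
  "is_path E Z \<longleftrightarrow> (\<forall>w. (\<forall>i<len w. ent w i = Z i) \<longrightarrow> E w \<noteq> 0)"

definition is_tree :: "(nat \<Rightarrow> nat) \<Rightarrow> bool" where
  "is_tree E \<longleftrightarrow> E 0 \<noteq> 0 \<and>
     (\<forall>u w. E u \<noteq> 0 \<longrightarrow> len w \<le> len u \<longrightarrow> (\<forall>i<len w. ent w i = ent u i) \<longrightarrow> E w \<noteq> 0)"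

text \<open>The initial segments of a path descend in the Kleene-Brouwer order, starting at the
  empty sequence.\<close>

lemma not_accp_kbt_if_path:
  assumes "is_path E Z" shows "\<not> Wellfounded.accp (kbt E) 0"
proof -
  obtain u where u: "\<And>n. len (u n) = n" "\<And>n i. i < n \<Longrightarrow> ent (u n) i = Z i"
    using ex_ent[of _ Z] by metis
  have "u 0 = 0" by (rule code_eqI) (simp_all add: u(1))
  moreover have "kbt E (u (Suc i)) (u i)" for i
    unfolding kbt_def
  proof (intro conjI)
    show "E (u (Suc i)) \<noteq> 0" "E (u i) \<noteq> 0" using assms u unfolding is_path_def by metis+
    show "kb (u (Suc i)) (u i)"
      unfolding kb_iff using u by (intro exI[of _ i]) auto
  qed
  ultimately show ?thesis unfolding not_accp_iff_chain by blast
qed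

text \<open>The limit of a descending chain is a path, because the tree is closed under initial
  segments.\<close>

lemma accp_kbt_if_no_path:
  assumes "is_tree E" "\<And>Z. \<not> is_path E Z" shows "Wellfounded.accp (kbt E) u"
proof (rule ccontr)
  assume "\<not> ?thesis"
  then obtain c where c: "\<And>i. kbt E (c (Suc i)) (c i)" unfolding not_accp_iff_chain by blast
  then have "kb (c (Suc i)) (c i)" for i by (simp add: kbt_def)
  then obtain Z where Z: "\<And>n. \<exists>i. n \<le> len (c i) \<and> (\<forall>j<n. ent (c i) j = Z j)"
    using kb_chain_limit[of c] by metis
  have "is_path E Z"
    unfolding is_path_def
  proof (intro allI impI)
    fix w assume w: "\<forall>i<len w. ent w i = Z i"
    obtain i where i: "len w \<le> len (c i)" "\<forall>j<len w. ent (c i) j = Z j" using Z by blast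
    have "E (c i) \<noteq> 0" using c[of i] by (simp add: kbt_def)
    then show "E w \<noteq> 0" using assms(1) i w unfolding is_tree_def by metis
  qed
  with assms(2) show False by blast
qed

definition kb_rel :: "(nat \<Rightarrow> nat) \<Rightarrow> nat rel" where
  "kb_rel E = {(u, v). E u \<noteq> 0 \<and> E v \<noteq> 0 \<and> (u = v \<or> kb u v)}"

lemma wf_if_accp: "(\<And>x. Wellfounded.accp l x) \<Longrightarrow> wf {(x, y). l x y}"
  using accp_wfpI[of l] by (simp add: wfp_def)

lemma Well_order_kb_rel:
  assumes "is_tree E" "\<And>Z. \<not> is_path E Z" shows "Well_order (kb_rel E)"
proof -
  have F: "Field (kb_rel E) = {u. E u \<noteq> 0}" unfolding Field_def kb_rel_def by auto
  have "wf {(u, v). kbt E u v}" by (rule wf_if_accp) (rule accp_kbt_if_no_path[OF assms])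
  moreover have "kb_rel E - Id \<subseteq> {(u, v). kbt E u v}" by (auto simp: kb_rel_def kbt_def)
  ultimately have "wf (kb_rel E - Id)" by (rule wf_subset)
  moreover have "refl_on {u. E u \<noteq> 0} (kb_rel E)" by (auto simp: refl_on_def kb_rel_def)
  moreover have "trans (kb_rel E)" by (auto simp: trans_def kb_rel_def intro: kb_trans)
  moreover have "antisym (kb_rel E)" using kb_trans kb_irrefl by (auto simp: antisym_def kb_rel_def)
  moreover have "total_on {u. E u \<noteq> 0} (kb_rel E)" using kb_linear by (auto simp: total_on_def kb_rel_def)
  moreover have "kb_rel E \<subseteq> {u. E u \<noteq> 0} \<times> {u. E u \<noteq> 0}" by (auto simp: kb_rel_def)
  ultimately show ?thesis unfolding F well_order_on_def linear_order_on_def partial_order_on_def preorder_on_def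
    by blast
qed


section \<open>Self-reference\<close>

text \<open>
  For every \<open>\<Sigma>\<^sup>1\<^sub>1\<close> property of trees some computable tree has an infinite path if and only if it
  has the property: a node of length \<open>s\<close> is an attempt of length \<open>s\<close> at verifying the property,
  which depends only on the tree below \<open>s\<close>. No recursion theorem is needed.
\<close>

lemma self_referential_tree:
  assumes "Sig 0 (\<lambda>xs g. \<Psi> g)"
  obtains E where "crec 1 (\<lambda>xs f. E (xs ! 0))" "is_tree E" "(\<exists>Z. is_path E Z) \<longleftrightarrow> \<Psi> E"
proof -
  obtain p where p: "\<And>g. \<Psi> g \<longleftrightarrow> (\<exists>Z. \<forall>s. nf p s [] (join g Z))"
    using Sig_nf[OF assms] by (metis list.size(3))
  define S where "S u h \<longleftrightarrow> nf p (len u) [] (join (\<lambda>x. if bit h x then 1 else 0) (ent u))" for u and h :: nat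
  \<comment> \<open>A bit mask of the tree below \<open>n\<close>: course-of-values recursion
    compressed into one number.\<close>
  define hist where "hist n = rec_nat 0 (\<lambda>u h. h + (if S u h then 2 ^ u else 0)) n" for n :: nat
  define E where "E u = (if S u (hist u) then 1 else 0 :: nat)" for u
  have bit_hist: "bit (hist n) x \<longleftrightarrow> x < n \<and> E x \<noteq> 0" for n x
  proof (induction n arbitrary: x)
    case (Suc n)
    have "\<not> bit (hist n) n" using Suc by simp
    then have "hist n + 2 ^ n = set_bit n (hist n)" by (simp add: set_bit_eq)
    then show ?case using Suc[of x] by (auto simp: hist_def E_def bit_set_bit_iff less_Suc_eq)
  qed (simp add: hist_def)
  have E: "E u \<noteq> 0 \<longleftrightarrow> nf p (len u) [] (join E (ent u))" for u
  proof -
    have "join (\<lambda>x. if bit (hist u) x then 1 else 0) (ent u) x = join E (ent u) x" if "x < len u" for x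
    proof -
      \<comment> \<open>A code is at least as large as its length, so testing the node
        \<open>u\<close> asks about the tree only at numbers below \<open>u\<close>; this makes the
        recursion well-defined.\<close>
      have "x div 2 < u" using that len_le[of u] by linarith
      then show ?thesis by (simp add: join_def bit_hist) (simp add: E_def)
    qed
    from nf_cong[OF this] have "S u (hist u) \<longleftrightarrow> nf p (len u) [] (join E (ent u))"
      unfolding S_def .
    then show ?thesis by (simp add: E_def)
  qed
  have "crec 1 (\<lambda>xs f. hist (xs ! 0))"
    unfolding hist_def S_def by (rule crec_intros | simp; fail)+
  then have H: "crec k A \<Longrightarrow> crec k (\<lambda>xs f. hist (A xs f))" for k A
    using crec_app[OF _ crecl_cons[OF _ crecl_nil], of 1 "\<lambda>xs f. hist (xs ! 0)" k A] by simp
  have cE: "crec 1 (\<lambda>xs f. E (xs ! 0))"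
    unfolding E_def S_def by (rule H crec_intros | simp; fail)+
  have "E w \<noteq> 0" if "E u \<noteq> 0" "len w \<le> len u" "\<forall>i<len w. ent w i = ent u i" for u w
    using that(1,2) unfolding E
    by (rule nf_mono) (use that(3) join_agree[of "len w" "ent w" "ent u"] in auto)
  moreover have "E 0 \<noteq> 0" unfolding E by simp
  ultimately have tree: "is_tree E" unfolding is_tree_def by blast
  have "is_path E Z \<longleftrightarrow> (\<forall>s. nf p s [] (join E Z))" for Z
  proof -
    have iff: "E w \<noteq> 0 \<longleftrightarrow> nf p (len w) [] (join E Z)" if "\<forall>i<len w. ent w i = Z i" for w
      unfolding E by (rule nf_cong) (use that join_agree[of "len w" "ent w" Z] in auto)
    show ?thesis
    proof
      assume path: "is_path E Z"
      show "\<forall>s. nf p s [] (join E Z)"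
      proof
        fix s
        obtain w where "len w = s" "\<forall>i<s. ent w i = Z i" using ex_ent by blast
        then show "nf p s [] (join E Z)" using iff[of w] path unfolding is_path_def by blast
      qed
    qed (use iff in \<open>auto simp: is_path_def\<close>)
  qed
  with p[of E] have "(\<exists>Z. is_path E Z) \<longleftrightarrow> \<Psi> E" by simp
  with cE tree that show ?thesis by blast
qed

section \<open>A well-order computed by a generic real\<close>

text \<open>By the use principle a negative decision depends on finitely many bits.\<close>

lemma closed_if_cdec:
  assumes "cdec 0 (\<lambda>xs f. P (tb f))" shows "closed {X. P X}"
proof -
  obtain p where p: "\<And>f. run p f [] = Some (if P (tb f) then 1 else 0)"
    using assms unfolding cdec_def crec_def by auto
  show ?thesis unfolding closed_iff_cyl
  proof (intro allI impI)
    fix X assume "X \<notin> {X. P X}"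
    then have "run p (char_fun X) [] = Some 0" using p[of "char_fun X"] by simp
    then obtain s where s: "crun p (char_fun X) s [] = Suc 0" using crun_if_run by blast
    have "\<not> P X'" if "X' \<in> cyl s X" for X'
    proof -
      have "crun p (char_fun X') s [] = crun p (char_fun X) s []"
        by (rule crun_cong) (use that in \<open>simp add: cyl_def char_fun_def\<close>)
      then have "run p (char_fun X') [] = Some 0" using s run_if_crun by metis
      then show ?thesis using p[of "char_fun X'"] by (auto split: if_splits)
    qed
    then show "\<exists>k. cyl k X \<inter> {X. P X} = {}" by blast
  qed
qed

text \<open>The closed set where \<open>P\<close> is refuted contains \<open>Y\<close> and is
  disjoint from the given set.\<close>

lemma small_if_cdec:
  assumes "cdec 0 (\<lambda>xs f. P (tb f))" "\<not> P Y" shows "small Y {X. P X \<and> Q X}"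
proof -
  have c: "cdec 0 (\<lambda>xs f. \<not> P (tb f))" using assms(1) by (rule cdec_not)
  have "Sigma11_set {X. \<not> P X}" unfolding Sigma11_set_iff using Sig_cdec[OF c] by simp
  moreover have "{X. \<not> P X} \<inter> {X. P X \<and> Q X} = {}" by blast
  moreover have "om {} = 0" using om_eq[of "{}"] by simp
  ultimately show ?thesis unfolding small_def using closed_if_cdec[OF c] assms(2)
    by (intro exI[of _ "{X. \<not> P X}"]) auto
qed

text \<open>
  The relation computed by \<open>q\<close> from \<open>X\<close>, with number pairs \<open>(a, s)\<close> as elements, where \<open>s\<close> bounds
  the time for the verification that \<open>a\<close> lies below another element: this makes the relation
  decidable for every \<open>X\<close>, even if \<open>q\<close> does not always halt.
\<close>

definition lt :: "prog \<Rightarrow> cantor \<Rightarrow> nat \<Rightarrow> nat \<Rightarrow> bool" where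
  "lt q X u v \<longleftrightarrow> crun q (char_fun X) (psnd u) [pfst u, pfst v] = 2 \<and> pfst u \<noteq> pfst v"

lemma cdec_lt [crec_intros]:
  assumes "cdec (Suc k) (\<lambda>xs f. X (tl xs) f (xs ! 0))" "crec k A" "crec k B"
  shows "cdec k (\<lambda>xs f. lt q (X xs f) (A xs f) (B xs f))"
  unfolding lt_def
  by (rule assms crec_char_fun crec_crun[where Or = "\<lambda>x xs f. char_fun (X xs f) x"] crec_intros | simp; fail)+

section \<open>Smallness at a fixed generic real\<close>

context
  fixes Y :: cantor and q :: prog
  assumes Y: "solovay_Sigma11_generic Y" and acc: "\<And>n. Wellfounded.accp (lt q Y) n"
begin

definition ill :: "nat \<Rightarrow> cantor set" where
  "ill n = {X. \<not> Wellfounded.accp (lt q X) n}"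

lemma Sigma11_ill: "uniformly_Sigma11 ill"
  unfolding uniformly_Sigma11_iff ill_def mem_Collect_eq
  by (rule sig_intros crec_intros Sig_cdec | simp; fail)+

lemma Sigma11_set_of_uniform: "uniformly_Sigma11 A \<Longrightarrow> Sigma11_set (A i)"
  unfolding Sigma11_set_iff by (erule Sig_mem_uniform) (rule crec_intros | simp; fail)+

lemma not_big_ill: "\<not> big Y (ill n)"
  using acc[of n]
proof (induction n rule: accp.induct)
  case (accI n)
  show ?case
  proof
    assume b: "big Y (ill n)"
    \<comment> \<open>An order ill-founded below \<open>n\<close> is ill-founded below some
      \<open>m\<close> under \<open>n\<close>; this splits \<open>ill n\<close> into a sequence to
      which the dichotomy applies.\<close>
    define V where "V m = {X. lt q X m n \<and> \<not> Wellfounded.accp (lt q X) m}" for m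
    have uV: "uniformly_Sigma11 V"
      unfolding uniformly_Sigma11_iff V_def mem_Collect_eq
      by (rule sig_intros crec_intros Sig_cdec | simp; fail)+
    have sub: "ill n \<subseteq> (\<Union>m. V m)"
    proof
      fix X assume "X \<in> ill n"
      then show "X \<in> (\<Union>m. V m)" using not_accp_step[of "lt q X" n] by (simp add: ill_def V_def)
    qed
    have "\<not> small Y (\<Union>m. V m)"
      using not_big_and_small[OF Y Sigma11_set_of_uniform[OF Sigma11_ill] b] small_mono[OF sub] by blast
    then obtain m where m: "big Y (V m)" using big_or_small[OF Y uV] by blast
    show False
    \<comment> \<open>If \<open>m\<close> is below \<open>n\<close> for \<open>Y\<close>, the
      induction hypothesis applies to \<open>m\<close>. Otherwise a decidable condition defining
      \<open>V m\<close> fails at \<open>Y\<close>, and \<open>V m\<close> is small.\<close>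
    proof (cases "lt q Y m n")
      case True
      have "big Y (ill m)" by (rule big_mono[OF _ m]) (auto simp: V_def ill_def)
      then show False using accI.IH[OF True] by blast
    next
      case False
      have "cdec 0 (\<lambda>xs f. lt q (tb f) m n)" by (rule crec_intros | simp; fail)+
      from small_if_cdec[OF this False] have "small Y (V m)" unfolding V_def .
      then show False using not_big_and_small[OF Y Sigma11_set_of_uniform[OF uV] m] by blast
    qed
  qed
qed

lemma small_ill: "small Y (\<Union>n. ill n)"
  using big_or_small[OF Y Sigma11_ill] not_big_ill by blast

lemma uniformly_Sigma11_const: "Sigma11_set A \<Longrightarrow> uniformly_Sigma11 (\<lambda>_. A)"
  unfolding uniformly_Sigma11_iff by (erule Sig_mem) (rule crec_intros | simp; fail)+

lemma small_if_not_big: "Sigma11_set A \<Longrightarrow> \<not> big Y A \<Longrightarrow> small Y A"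
  using big_or_small[OF Y uniformly_Sigma11_const] by auto

text \<open>Induction along \<open>e\<close>: if the set were big, so would be its part
  \<open>U c\<close> with a fixed first move \<open>c\<close> of the opponent. The answer that
  \<open>Y\<close> has to \<open>c\<close> is valid on a closed set around \<open>Y\<close>, where
  \<open>U c\<close> falls into the small set for the position after the answer.\<close>

lemma small_Opp:
  assumes e: "cdec 2 (\<lambda>xs f. e (xs ! 0) (xs ! 1))"
    and a: "Wellfounded.accp e a" and S: "Sim e (lt q Y) a n"
  shows "small Y {X. Opp e (lt q X) a n}"
proof -
  have e': "cdec k (\<lambda>xs f. e (A xs f) (B xs f))" if "crec k A" "crec k B" for k A B
    using cdec_app[OF e crecl_cons[OF that(1) crecl_cons[OF that(2) crecl_nil]]] by simp
  have SO: "Sigma11_set {X. Opp e (lt q X) a n}" for a n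
    unfolding Sigma11_set_iff mem_Collect_eq
    by (rule sig_intros e' crec_intros Sig_cdec | simp; fail)+
  have "\<not> big Y {X. Opp e (lt q X) a n}"
    using a S
  proof (induction a arbitrary: n rule: accp.induct)
    case (accI a)
    show ?case
    proof
      assume b: "big Y {X. Opp e (lt q X) a n}"
      define U where "U b = {X. e b a \<and> (\<forall>m. lt q X m n \<longrightarrow> Opp e (lt q X) b m)}" for b
      have uU: "uniformly_Sigma11 U"
        unfolding uniformly_Sigma11_iff U_def mem_Collect_eq
        by (rule sig_intros e' crec_intros Sig_cdec | simp; fail)+
      have sub: "{X. Opp e (lt q X) a n} \<subseteq> (\<Union>b. U b)"
      proof
        fix X assume "X \<in> {X. Opp e (lt q X) a n}"
        then show "X \<in> (\<Union>b. U b)" using Opp_step[of e "lt q X" a n] by (simp add: U_def)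
      qed
      have "\<not> small Y (\<Union>b. U b)"
        using not_big_and_small[OF Y SO b] small_mono[OF sub] by blast
      then obtain c where c: "big Y (U c)" using big_or_small[OF Y uU] by blast
      have "small Y (U c)"
      proof (cases "e c a")
        case False
        then have "U c = {X. \<not> True \<and> True}" by (auto simp: U_def)
        then show ?thesis using small_if_cdec[of "\<lambda>_. False" Y "\<lambda>_. True"] by (simp add: cdec_const)
      next
        case True
        then obtain m where m: "lt q Y m n" "Sim e (lt q Y) c m" using Sim_step[OF accI.prems] by blast
        obtain G where G: "Sigma11_set G" "closed G" "Y \<in> G" "om (G \<inter> {X. Opp e (lt q X) c m}) = 0"
          using small_if_not_big[OF SO accI.IH[OF True m(2)]] unfolding small_def by blast
        have C: "cdec 0 (\<lambda>xs f. lt q (tb f) m n)" by (rule crec_intros | simp; fail)+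
        \<comment> \<open>On this set the answer \<open>m\<close> is legal for every
          \<open>X\<close>, not only for \<open>Y\<close>.\<close>
        let ?G = "G \<inter> {X. lt q X m n}"
        have "Sigma11_set ?G"
          by (rule Sigma11_set_Int[OF G(1)]) (simp add: Sigma11_set_iff Sig_cdec[OF C])
        moreover have "closed ?G" by (intro closed_Int G(2) closed_if_cdec C)
        moreover have "om (?G \<inter> U c) \<le> om (G \<inter> {X. Opp e (lt q X) c m})"
          by (intro om_mono) (auto simp: U_def)
        then have "om (?G \<inter> U c) = 0" using G(4) om_nonneg[of "?G \<inter> U c"] by linarith
        ultimately show ?thesis unfolding small_def using G(3) m(1) by (intro exI[of _ ?G]) auto
      qed
      then show False using not_big_and_small[OF Y Sigma11_set_of_uniform[OF uU] c] by blast
    qed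
  qed
  then show ?thesis by (rule small_if_not_big[OF SO])
qed

lemma ex_well_founded_tree_not_Sim:
  "\<exists>E. crec 1 (\<lambda>xs f. E (xs ! 0)) \<and> is_tree E \<and> (\<forall>Z. \<not> is_path E Z) \<and> (\<forall>n. \<not> Sim (kbt E) (lt q Y) 0 n)"
proof -
  obtain G where G: "Sigma11_set G" "closed G" "Y \<in> G" "om (G \<inter> (\<Union>n. ill n)) = 0"
    using small_ill unfolding small_def by blast
  \<comment> \<open>Positive outer measure, with the bound \<open>0\<close> written as a fraction to
    match \<open>Sig_less_om\<close>.\<close>
  define \<Psi> where "\<Psi> E \<longleftrightarrow> (\<exists>n. real 0 / real 1 < om {X. X \<in> G \<and> Sim (kbt E) (lt q X) 0 n})" for E
  have "Sig 0 (\<lambda>xs g. \<Psi> g)"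
    unfolding \<Psi>_def
    by (rule sig_intros Sig_less_om[where a = "\<lambda>_ _. 0" and b = "\<lambda>_ _. 1"] Sig_mem[OF G(1)] crec_intros Sig_cdec | simp; fail)+
  then obtain E where E: "crec 1 (\<lambda>xs f. E (xs ! 0))" "is_tree E" "(\<exists>Z. is_path E Z) \<longleftrightarrow> \<Psi> E"
    by (rule self_referential_tree)
  have no_path: "\<not> is_path E Z" for Z
  proof
    assume path: "is_path E Z"
    then have "\<Psi> E" using E(3) by blast
    then obtain n where n: "0 < om {X. X \<in> G \<and> Sim (kbt E) (lt q X) 0 n}" unfolding \<Psi>_def by auto
    have "{X. X \<in> G \<and> Sim (kbt E) (lt q X) 0 n} \<subseteq> G \<inter> (\<Union>n. ill n)"
    proof
      fix X assume X: "X \<in> {X. X \<in> G \<and> Sim (kbt E) (lt q X) 0 n}"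
      then have "\<not> Wellfounded.accp (lt q X) n"
        using accp_if_Sim[of "lt q X" n "kbt E" 0] not_accp_kbt_if_path[OF path] by blast
      then show "X \<in> G \<inter> (\<Union>n. ill n)" using X unfolding ill_def by blast
    qed
    from om_mono[OF this] n G(4) show False by linarith
  qed
  have "\<not> Sim (kbt E) (lt q Y) 0 n" for n
  proof
    assume S: "Sim (kbt E) (lt q Y) 0 n"
    have E': "crec k (\<lambda>xs f. E (A xs f))" if "crec k A" for k A
      using crec_app[OF E(1) crecl_cons[OF that crecl_nil]] by simp
    have e: "cdec 2 (\<lambda>xs f. kbt E (xs ! 0) (xs ! 1))"
      by (rule E' crec_intros | simp; fail)+
    have a: "Wellfounded.accp (kbt E) 0" by (rule accp_kbt_if_no_path[OF E(2) no_path])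
    obtain G' where G': "Sigma11_set G'" "closed G'" "Y \<in> G'" "om (G' \<inter> {X. Opp (kbt E) (lt q X) 0 n}) = 0"
      using small_Opp[OF e a S] unfolding small_def by blast
    \<comment> \<open>Each \<open>X \<in> G \<inter> G'\<close> satisfies \<open>Sim\<close> or
      \<open>Opp\<close>, and the latter happens only on a null part of \<open>G'\<close>; hence
      \<open>Sim\<close> holds for positively many \<open>X \<in> G\<close>.\<close>
    have "0 < lam (G \<inter> G')"
      by (rule generic_not_in_null_closed[OF Y Sigma11_set_Int[OF G(1) G'(1)]])
        (use G G' in \<open>auto intro: closed_Int\<close>)
    also have "\<dots> = om (G \<inter> G')" using G(2) G'(2) by (intro om_eq[symmetric] sets_closed closed_Int)
    also have "\<dots> \<le> om ({X. X \<in> G \<and> Sim (kbt E) (lt q X) 0 n} \<union> (G' \<inter> {X. Opp (kbt E) (lt q X) 0 n}))"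
      using Opp_if_not_Sim by (intro om_mono) blast
    also have "\<dots> \<le> om {X. X \<in> G \<and> Sim (kbt E) (lt q X) 0 n}" by (rule order_trans[OF om_Un]) (simp add: G'(4))
    finally have "\<Psi> E" unfolding \<Psi>_def by auto
    then show False using E(3) no_path by blast
  qed
  with E(1,2) no_path show ?thesis by blast
qed

end

section \<open>Computable ordinals\<close>

text \<open>The program is known to halt only for the oracle \<open>0\<close>. Running it by the
  clock with that oracle fixed gives a decision that ignores the actual oracle.\<close>

lemma cdec_if_run_empty:
  assumes "\<And>m n. run p (char_fun (\<lambda>_. False)) [m, n] = Some (if (m, n) \<in> r then 1 else 0)"
  shows "cdec 2 (\<lambda>xs f. (xs ! 0, xs ! 1) \<in> r)"
proof -
  have c0: "char_fun (\<lambda>_. False) = (\<lambda>_. 0)" by (simp add: char_fun_def fun_eq_iff)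
  let ?C = "\<lambda>s xs. crun p (\<lambda>_. 0) s [xs ! 0, xs ! 1]"
  have val: "\<exists>s. ?C s xs = Suc (if (xs ! 0, xs ! 1) \<in> r then 1 else 0)" for xs
    by (rule crun_if_run) (use assms in \<open>simp add: c0\<close>)
  have ex: "\<exists>s. ?C s xs \<noteq> 0" for xs using val[of xs] by (metis nat.distinct(1))
  have "crec (Suc 2) (\<lambda>xs f. crun p (\<lambda>_. 0) (xs ! 0) [tl xs ! 0, tl xs ! 1])"
    by (rule crec_intros | simp; fail)+
  then have S: "crec 2 (\<lambda>xs f. LEAST s. ?C s xs \<noteq> 0)"
    by (intro crec_Least cdec_not cdec_eq crec_const ex)
  have "cdec 2 (\<lambda>xs f. ?C (LEAST s. ?C s xs \<noteq> 0) xs = 2)"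
    by (rule S crec_intros | simp; fail)+
  moreover have "?C (LEAST s. ?C s xs \<noteq> 0) xs = 2 \<longleftrightarrow> (xs ! 0, xs ! 1) \<in> r" for xs
  proof -
    let ?s = "LEAST s. ?C s xs \<noteq> 0"
    have "?C ?s xs \<noteq> 0" using ex[of xs] by (rule LeastI_ex)
    then obtain v where v: "?C ?s xs = Suc v" using not0_implies_Suc by blast
    from run_if_crun[OF this] assms have "v = (if (xs ! 0, xs ! 1) \<in> r then 1 else 0)" by (simp add: c0)
    with v show ?thesis by simp
  qed
  ultimately show ?thesis by simp
qed

lemma computable_ordinal_if_cdec:
  assumes "cdec 2 (\<lambda>xs f. (xs ! 0, xs ! 1) \<in> r)" "Well_order r"
  shows "computable_ordinal X (otype r)"
proof -
  obtain p where "\<And>xs f. length xs = 2 \<Longrightarrow> run p f xs = Some (if (xs ! 0, xs ! 1) \<in> r then 1 else 0)"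
    using assms(1) unfolding cdec_def crec_def by blast
  then have "\<forall>m n. run p (char_fun X) [m, n] = Some (if (m, n) \<in> r then 1 else 0)" by simp
  then show ?thesis unfolding computable_ordinal_def using assms(2) by blast
qed

lemma otype_less_iff: "Well_order r \<Longrightarrow> Well_order s \<Longrightarrow> otype r < otype s \<longleftrightarrow> (r, s) \<in> ordLess"
  unfolding otype_def by (rule less_cord.abs_eq) (auto intro: ordIso_reflexive)

lemma not_computable_omega1: "\<not> computable_ordinal X (omega1 X)"
  unfolding omega1_def using ex_not_computable_ordinal by (rule LeastI_ex)

lemma computable_if_less_omega1: "\<alpha> < omega1 X \<Longrightarrow> computable_ordinal X \<alpha>"
  unfolding omega1_def using not_less_Least by blast

text \<open>Computable ordinals are closed downwards: an initial segment of a decidable well-order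
  is decidable with its end point as a fixed parameter. So a computable type cannot exceed the least
  non-computable one.\<close>

lemma cdec_otype_less_omega1_CK:
  assumes r: "cdec 2 (\<lambda>xs f. (xs ! 0, xs ! 1) \<in> r)" "Well_order r"
  shows "otype r < omega1_CK"
proof (rule ccontr)
  assume "\<not> ?thesis"
  moreover have "otype r \<noteq> omega1_CK"
    using computable_ordinal_if_cdec[OF r] not_computable_omega1 unfolding omega1_CK_def by metis
  ultimately have less: "omega1_CK < otype r" by simp
  obtain t where t: "Well_order t" "otype t = omega1_CK"
  proof -
    have "\<exists>s :: nat rel. (s, s) \<in> ordIso \<and> abs_cord s = omega1_CK"
      using Quotient_abs_rep[OF Quotient_cord] Quotient_rel_rep[OF Quotient_cord]
        Quotient_rep_reflp[OF Quotient_cord] by metis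
    then show ?thesis using that unfolding otype_def ordIso_def by blast
  qed
  have "(t, r) \<in> ordLess" using less otype_less_iff[OF t(1) r(2)] t(2) by simp
  then obtain a where a: "a \<in> Field r" "(t, Restr r (underS r a)) \<in> ordIso"
    using ordLess_iff_ordIso_Restr[OF r(2) t(1)] by blast
  let ?r = "Restr r (underS r a)"
  have wr: "Well_order ?r" using r(2) by (rule Well_order_Restr)
  have r': "cdec k (\<lambda>xs f. (A xs f, B xs f) \<in> r)" if "crec k A" "crec k B" for k A B
    using cdec_app[OF r(1) crecl_cons[OF that(1) crecl_cons[OF that(2) crecl_nil]]] by simp
  have "cdec 2 (\<lambda>xs f. (xs ! 0, xs ! 1) \<in> r \<and> (xs ! 0 \<noteq> a \<and> (xs ! 0, a) \<in> r) \<and> (xs ! 1 \<noteq> a \<and> (xs ! 1, a) \<in> r))"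
    by (rule r' crec_intros | simp; fail)+
  then have "cdec 2 (\<lambda>xs f. (xs ! 0, xs ! 1) \<in> ?r)"
    by (simp add: underS_def)
  from computable_ordinal_if_cdec[OF this wr] have "computable_ordinal (\<lambda>_. False) (otype ?r)" .
  moreover have "otype ?r = omega1_CK" using a(2) otype_eq_iff[OF t(1) wr] t(2) by simp
  ultimately show False using not_computable_omega1 unfolding omega1_CK_def by metis
qed

theorem theorem1p5:
  fixes Y :: cantor
  assumes "solovay_Sigma11_generic Y"
  shows "omega1 Y = omega1_CK"
proof (rule antisym)
  show "omega1_CK \<le> omega1 Y"
  proof (rule ccontr)
    assume "\<not> ?thesis"
    then have "computable_ordinal (\<lambda>_. False) (omega1 Y)"
      unfolding omega1_CK_def by (intro computable_if_less_omega1) simp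
    then obtain r p where r: "Well_order r" "otype r = omega1 Y"
      "\<And>m n. run p (char_fun (\<lambda>_. False)) [m, n] = Some (if (m, n) \<in> r then 1 else 0)"
      unfolding computable_ordinal_def by blast
    from computable_ordinal_if_cdec[OF cdec_if_run_empty[OF r(3)] r(1)] r(2) not_computable_omega1
    show False by metis
  qed
  show "omega1 Y \<le> omega1_CK"
  proof (rule ccontr)
    assume "\<not> ?thesis"
    then have "computable_ordinal Y omega1_CK" by (intro computable_if_less_omega1) simp
    then obtain r q where r: "Well_order r" "otype r = omega1_CK"
      "\<And>m n. run q (char_fun Y) [m, n] = Some (if (m, n) \<in> r then 1 else 0)"
      unfolding computable_ordinal_def by blast
    have lt_r: "(pfst u, pfst v) \<in> r - Id" if "lt q Y u v" for u v
    proof -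
      \<comment> \<open>In \<open>lt\<close> the clocked value \<open>2\<close> means that the
        output is \<open>1\<close>.\<close>
      have "crun q (char_fun Y) (psnd u) [pfst u, pfst v] = Suc 1" "pfst u \<noteq> pfst v"
        using that by (auto simp: lt_def)
      then show ?thesis using run_if_crun r(3)[of "pfst u" "pfst v"] by (fastforce split: if_splits)
    qed
    \<comment> \<open>Forgetting the time components projects a descent for \<open>lt\<close> to a
      strict descent in \<open>r\<close>.\<close>
    have acc: "Wellfounded.accp (lt q Y) n" for n
    proof (rule ccontr)
      assume "\<not> ?thesis"
      then obtain Z where "\<And>i. lt q Y (Z (Suc i)) (Z i)" unfolding not_accp_iff_chain by blast
      then have "\<And>i. (pfst (Z (Suc i)), pfst (Z i)) \<in> r - Id" using lt_r by blast
      moreover have "wf (r - Id)" using r(1) by (simp add: well_order_on_def)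
      ultimately show False unfolding wf_iff_no_infinite_down_chain
        by (elim notE, intro exI[of _ "\<lambda>i. pfst (Z i)"]) blast
    qed
    obtain E where E: "crec 1 (\<lambda>xs f. E (xs ! 0))" "is_tree E" "\<And>Z. \<not> is_path E Z"
      "\<And>n. \<not> Sim (kbt E) (lt q Y) 0 n"
      using ex_well_founded_tree_not_Sim[OF assms acc] by blast
    have E': "crec k (\<lambda>xs f. E (A xs f))" if "crec k A" for k A
      using crec_app[OF E(1) crecl_cons[OF that crecl_nil]] by simp
    have c: "cdec 2 (\<lambda>xs f. (xs ! 0, xs ! 1) \<in> kb_rel E)"
      unfolding kb_rel_def mem_Collect_eq case_prod_conv
      by (rule E' crec_intros | simp; fail)+
    have w: "Well_order (kb_rel E)" by (rule Well_order_kb_rel[OF E(2,3)])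
    have "(kb_rel E, r) \<in> ordLess"
      using cdec_otype_less_omega1_CK[OF c w] otype_less_iff[OF w r(1)] r(2) by simp
    then obtain f where f: "embed (kb_rel E) r f" unfolding ordLess_def embedS_def by blast
    have f_mono: "(f u, f v) \<in> r" if "(u, v) \<in> kb_rel E" for u v
      using embed_compat[OF f] that unfolding compat_def by blast
    have f_inj: "inj_on f (Field (kb_rel E))" using embed_inj_on[OF w f] .
    \<comment> \<open>The embedding answers each move; the time component of an answer is the stage
      at which \<open>q\<close> confirms it. Only the first component of the upper element enters
      \<open>lt\<close>, so the initial time \<open>0\<close> is arbitrary.\<close>
    have "Sim (kbt E) (lt q Y) 0 (prod_encode (f 0, 0))"
    proof (rule SimI[of "\<lambda>b m. E b \<noteq> 0 \<and> pfst m = f b"])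
      show "E 0 \<noteq> 0 \<and> pfst (prod_encode (f 0, 0)) = f 0" using E(2) by (simp add: is_tree_def)
      fix b m b' assume b: "E b \<noteq> 0 \<and> pfst m = f b" "kbt E b' b"
      have rel: "(b', b) \<in> kb_rel E" "b' \<noteq> b" using b(2) kb_irrefl by (auto simp: kbt_def kb_rel_def)
      have "b' \<in> Field (kb_rel E)" "b \<in> Field (kb_rel E)" using rel(1) by (auto simp: Field_def)
      then have ne: "f b' \<noteq> f b" using f_inj rel(2) by (auto dest: inj_onD)
      have "run q (char_fun Y) [f b', f b] = Some 1" using f_mono[OF rel(1)] r(3) by simp
      then obtain s where "crun q (char_fun Y) s [f b', f b] = Suc 1" using crun_if_run by blast
      then have "lt q Y (prod_encode (f b', s)) m" using b(1) ne by (simp add: lt_def)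
      then show "\<exists>m'. lt q Y m' m \<and> E b' \<noteq> 0 \<and> pfst m' = f b'"
        using b(2) by (intro exI[of _ "prod_encode (f b', s)"]) (auto simp: kbt_def)
    qed
    with E(4) show False by blast
  qed
qed

end
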